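(* Let $\gamma:S^n\to\mathbb R_{>0}$ be of class $C^2$. Let $X:M=\cup_{i=1}^kM_i\to\mathbb R^{n+1}$ be a closed piecewise-$C^2$ weak immersion whose $r$-th anisotropic mean curvature $H_r^\gamma$ for $\gamma$ is integrable on $M$ for $r=1,\dots,n$. Assume also that $$\tilde\xi_i(\zeta)=\tilde\xi_j(\zeta),\quad\forall\zeta\in\partial M_i\cap\partial M_j,$$ where $\tilde\xi_i=\xi\circ\nu_i:M_i\to\mathbb R^{n+1}$ is the Cahn-Hoffman field along $X|_{M_i}$. Then $$\int_M\big(\gamma(\nu)H_r^\gamma+\langle X,\nu\rangle H_{r+1}^\gamma\big)\,dA=0,\quad r=0,\dots,n-1.$$ In the special case $r=0$, $$\int_M(\gamma(\nu)+\Lambda\langle X,\nu\rangle)\,dA=0.$$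
   Context: **Piecewise-$C^r$ weak immersion.** $M=\cup_{i=1}^kM_i$ is an $n$-dimensional oriented compact connected $C^\infty$ manifold, where each $M_i$ is an $n$-dimensional connected compact submanifold of $M$ with piecewise-$C^\infty$ boundary and $M_i\cap M_j=\partial M_i\cap\partial M_j$ for $i\neq j$. A map $X:M\to\mathbb R^{n+1}$ is a piecewise-$C^r$ weak immersion if for each $i$: (A1) $X$ is continuous and $X|_{M_i}$ is of class $C^r$; (A2) $X$ restricted to the interior $M_i^o$ is a $C^r$-immersion; (A3) the unit normal field $\nu_i:M_i^o\to S^n$ extends to a $C^{r-1}$ map $\nu_i:M_i\to S^n$; here $\nu_i$ is chosen so that, in positively oriented local coordinates $(u^1,\dots,u^n)$, $(\nu_i,\partial_{u^1}X,\dots,\partial_{u^n}X)$ is compatible with the canonical orientation of $\mathbb R^{n+1}$. $\nu$ is the unit normal at regular points (points where $X$ is an immersion), $dA$ the $n$-dimensional volume form induced by $X$. **Cahn-Hoffman map.** $\xi(\nu)=D\gamma|_\nu+\gamma(\nu)\nu$ for $\nu$ in the unit sphere $S^n$, where $D\gamma$ is the gradient on $S^n$ and $T_\nu S^n\subset\mathbb R^{n+1}$. **Anisotropic curvatures.** At regular points of $X$, $k_1^\gamma,\dots,k_n^\gamma$ are the eigenvalues of $S^\gamma=-d(\xi\circ\nu)$, regarded as an endomorphism of the tangent space (the image of $d(\xi\circ\nu)$ is perpendicular to $\nu$). $H_r^\gamma=\binom nr^{-1}\sum_{l_1<\dots<l_r}k^\gamma_{l_1}\cdots k^\gamma_{l_r}$,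 $H_0^\gamma=1$, $\Lambda=H_1^\gamma$. Integrability is with respect to $dA$. *)

theory Defs
  imports "HOL-Analysis.Analysis"
begin

text \<open>
  The dimension is \<open>n = CARD('n)\<close>. The ambient space \<open>R^(n+1)\<close> is \<open>real ^ ('n option)\<close>, with first
  coordinate \<open>None\<close> followed by the coordinates \<open>Some i\<close>.
\<close>

primrec Ck_open :: "nat \<Rightarrow> ('v::euclidean_space \<Rightarrow> 'w::real_normed_vector) \<Rightarrow> 'v set \<Rightarrow> bool" where
  "Ck_open 0 f U \<longleftrightarrow> open U \<and> continuous_on U f"
| "Ck_open (Suc k) f U \<longleftrightarrow> open U \<and> (\<forall>x\<in>U. f differentiable (at x)) \<and>
     (\<forall>v. Ck_open k (\<lambda>x. frechet_derivative f (at x) v) U)"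

definition smooth_open :: "('v::euclidean_space \<Rightarrow> 'w::real_normed_vector) \<Rightarrow> 'v set \<Rightarrow> bool" where
  "smooth_open f U \<longleftrightarrow> (\<forall>k. Ck_open k f U)"

text \<open>
  On a set that need not be open (a domain with boundary, the unit sphere), a map is \<open>C^k\<close> if it
  extends to a \<open>C^k\<close> map near each point of the set.
\<close>

definition Ck_on :: "nat \<Rightarrow> ('v::euclidean_space \<Rightarrow> 'w::real_normed_vector) \<Rightarrow> 'v set \<Rightarrow> bool" where
  "Ck_on k f S \<longleftrightarrow> (\<forall>p\<in>S. \<exists>U g. p \<in> U \<and> Ck_open k g U \<and> (\<forall>x\<in>S \<inter> U. g x = f x))"

definition partial :: "(real^'n \<Rightarrow> 'w::real_normed_vector) \<Rightarrow> 'n \<Rightarrow> real^'n \<Rightarrow> 'w" where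
  "partial f i y = frechet_derivative f (at y) (axis i 1)"

type_synonym ('a, 'n) chart = "'a set \<times> ('a \<Rightarrow> real^'n)"

definition is_chart :: "'a::t2_space set \<Rightarrow> ('a, 'n::finite) chart \<Rightarrow> bool" where
  "is_chart M = (\<lambda>(U, \<phi>). openin (top_of_set M) U \<and> open (\<phi> ` U) \<and>
     homeomorphism U (\<phi> ` U) \<phi> (inv_into U \<phi>))"

definition in_chart :: "('a, 'n::finite) chart \<Rightarrow> ('a \<Rightarrow> 'w) \<Rightarrow> real^'n \<Rightarrow> 'w" where
  "in_chart = (\<lambda>(U, \<phi>) f y. f (inv_into U \<phi> y))"

definition transition_domain :: "('a, 'n::finite) chart \<Rightarrow> ('a, 'n) chart \<Rightarrow> (real^'n) set" where
  "transition_domain c d = snd c ` (fst c \<inter> fst d)"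

definition smoothly_compatible :: "('a, 'n::finite) chart \<Rightarrow> ('a, 'n) chart \<Rightarrow> bool" where
  "smoothly_compatible c d \<longleftrightarrow>
     smooth_open (in_chart c (snd d)) (transition_domain c d) \<and>
     smooth_open (in_chart d (snd c)) (transition_domain d c)"

definition oriented_atlas :: "'a::t2_space set \<Rightarrow> ('a, 'n::finite) chart set \<Rightarrow> bool" where
  "oriented_atlas M \<A> \<longleftrightarrow>
     (\<forall>c\<in>\<A>. is_chart M c) \<and> (\<Union>c\<in>\<A>. fst c) = M \<and>
     (\<forall>c\<in>\<A>. \<forall>d\<in>\<A>. smoothly_compatible c d \<and>
        (\<forall>y\<in>transition_domain c d.
           det (matrix (frechet_derivative (in_chart c (snd d)) (at y))) > 0))"

definition Ck_on_mfd ::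
  "nat \<Rightarrow> ('a, 'n::finite) chart set \<Rightarrow> ('a \<Rightarrow> 'w::real_normed_vector) \<Rightarrow> 'a set \<Rightarrow> bool" where
  "Ck_on_mfd k \<A> f S \<longleftrightarrow> (\<forall>c\<in>\<A>. Ck_on k (in_chart c f) (snd c ` (fst c \<inter> S)))"

text \<open>
  A submanifold of full dimension has its topological interior and frontier in \<open>M\<close> as manifold
  interior and manifold boundary (invariance of domain).
\<close>

definition mfd_interior :: "'a::t2_space set \<Rightarrow> 'a set \<Rightarrow> 'a set" where
  "mfd_interior M N = (top_of_set M) interior_of N"

definition mfd_boundary :: "'a::t2_space set \<Rightarrow> 'a set \<Rightarrow> 'a set" where
  "mfd_boundary M N = (top_of_set M) frontier_of N"

text \<open>
  The smooth pieces of the boundary are smoothly embedded closed \<open>(n-1)\<close>-cubes. Such a cube has a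
  trivial normal bundle, so it is a face of an \<open>n\<close>-cube in suitable smooth coordinates of \<open>M\<close>
  (points if \<open>n = 1\<close>); the coordinates need not be positively oriented.
\<close>

definition smooth_cell :: "'a::t2_space set \<Rightarrow> ('a, 'n::finite) chart set \<Rightarrow> 'a set \<Rightarrow> bool" where
  "smooth_cell M \<A> \<Gamma> \<longleftrightarrow>
     (\<exists>c a. is_chart M c \<and> (\<forall>d\<in>\<A>. smoothly_compatible c d) \<and>
        \<Gamma> \<subseteq> fst c \<and> snd c ` \<Gamma> = {y \<in> cbox 0 1. y $ a = 0})"

definition piecewise_smooth_domain ::
  "'a::t2_space set \<Rightarrow> ('a, 'n::finite) chart set \<Rightarrow> 'a set \<Rightarrow> bool" where
  "piecewise_smooth_domain M \<A> N \<longleftrightarrow>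
     N \<noteq> {} \<and> N \<subseteq> M \<and> compact N \<and> connected N \<and>
     (\<forall>p\<in>N. \<exists>W (h :: 'a \<Rightarrow> real^'n) g a. p \<in> W \<and> openin (top_of_set N) W \<and>
        openin (top_of_set {y. 0 \<le> y $ a}) (h ` W) \<and> homeomorphism W (h ` W) h g) \<and>
     (\<exists>\<G>. finite \<G> \<and> (\<forall>\<Gamma>\<in>\<G>. smooth_cell M \<A> \<Gamma>) \<and> mfd_boundary M N = \<Union>\<G>)"

definition piecewise_manifold ::
  "'a::t2_space set \<Rightarrow> ('a, 'n::finite) chart set \<Rightarrow> nat \<Rightarrow> (nat \<Rightarrow> 'a set) \<Rightarrow> bool" where
  "piecewise_manifold M \<A> k Mi \<longleftrightarrow>
     M \<noteq> {} \<and> compact M \<and> connected M \<and> oriented_atlas M \<A> \<and>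
     M = (\<Union>i\<in>{1..k}. Mi i) \<and>
     (\<forall>i\<in>{1..k}. piecewise_smooth_domain M \<A> (Mi i)) \<and>
     (\<forall>i\<in>{1..k}. \<forall>j\<in>{1..k}. i \<noteq> j \<longrightarrow>
        Mi i \<inter> Mi j = mfd_boundary M (Mi i) \<inter> mfd_boundary M (Mi j))"

definition normal_frame ::
  "real^('n option) \<Rightarrow> (real^'n \<Rightarrow> real^('n option)) \<Rightarrow> real^'n \<Rightarrow> real^('n option)^('n option)"
  where
  "normal_frame v f y = (\<chi> a. case a of None \<Rightarrow> v | Some i \<Rightarrow> partial f i y)"

definition unit_normal ::
  "('a, 'n::finite) chart set \<Rightarrow> ('a \<Rightarrow> real^('n option)) \<Rightarrow> 'a \<Rightarrow> real^('n option)" where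
  "unit_normal \<A> X p = (THE v. norm v = 1 \<and>
     (\<forall>c\<in>\<A>. p \<in> fst c \<longrightarrow>
        (\<forall>i. v \<bullet> partial (in_chart c X) i (snd c p) = 0) \<and>
        det (normal_frame v (in_chart c X) (snd c p)) > 0))"

text \<open>
  The argument \<open>\<nu>\<close> collects the extended fields \<open>\<nu>\<^sub>i\<close> of (A3); they are determined on \<open>M\<^sub>i\<close> by \<open>X\<close>
  since the interior of \<open>M\<^sub>i\<close> is dense in \<open>M\<^sub>i\<close>.
\<close>

definition piecewise_weak_immersion ::
  "nat \<Rightarrow> 'a::t2_space set \<Rightarrow> ('a, 'n::finite) chart set \<Rightarrow> nat \<Rightarrow> (nat \<Rightarrow> 'a set) \<Rightarrow>
     ('a \<Rightarrow> real^('n option)) \<Rightarrow> (nat \<Rightarrow> 'a \<Rightarrow> real^('n option)) \<Rightarrow> bool" where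
  "piecewise_weak_immersion r M \<A> k Mi X \<nu> \<longleftrightarrow>
     continuous_on M X \<and>
     (\<forall>i\<in>{1..k}.
        Ck_on_mfd r \<A> X (Mi i) \<and>
        (\<forall>c\<in>\<A>. \<forall>p\<in>fst c \<inter> mfd_interior M (Mi i).
           inj (frechet_derivative (in_chart c X) (at (snd c p)))) \<and>
        \<nu> i ` Mi i \<subseteq> sphere 0 1 \<and>
        Ck_on_mfd (r - 1) \<A> (\<nu> i) (Mi i) \<and>
        (\<forall>p\<in>mfd_interior M (Mi i). \<nu> i p = unit_normal \<A> X p))"

definition volume_density :: "(real^'n::finite \<Rightarrow> real^('n option)) \<Rightarrow> real^'n \<Rightarrow> real" where
  "volume_density f y = sqrt (det (\<chi> i j. partial f i y \<bullet> partial f j y))"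

definition lebesgue_sets :: "'a set \<Rightarrow> ('a, 'n::finite) chart set \<Rightarrow> 'a set set" where
  "lebesgue_sets M \<A> = {A. A \<subseteq> M \<and> (\<forall>c\<in>\<A>. snd c ` (A \<inter> fst c) \<in> sets lebesgue)}"

text \<open>
  Where \<open>X\<close> is not differentiable the density below is arbitrary; for a piecewise weak immersion this
  concerns only points of the boundaries \<open>\<partial>M\<^sub>i\<close>, which are null sets.
\<close>

definition volume_measure ::
  "'a set \<Rightarrow> ('a, 'n::finite) chart set \<Rightarrow> ('a \<Rightarrow> real^('n option)) \<Rightarrow> 'a measure" where
  "volume_measure M \<A> X = (THE \<mu>. space \<mu> = M \<and> sets \<mu> = lebesgue_sets M \<A> \<and>
     (\<forall>c\<in>\<A>. \<forall>A\<in>sets \<mu>. A \<subseteq> fst c \<longrightarrow>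
        emeasure \<mu> A =
          (\<integral>\<^sup>+y\<in>snd c ` A. ennreal (volume_density (in_chart c X) y) \<partial>lebesgue)))"

text \<open>
  A derivative within the sphere is determined on tangent vectors only; the condition \<open>w \<bullet> x = 0\<close>
  selects the tangential gradient.
\<close>

definition sphere_grad :: "('v::euclidean_space \<Rightarrow> real) \<Rightarrow> 'v \<Rightarrow> 'v" where
  "sphere_grad \<gamma> x = (THE w. w \<bullet> x = 0 \<and> (\<gamma> has_derivative (\<lambda>v. w \<bullet> v)) (at x within sphere 0 1))"

definition cahn_hoffman :: "('v::euclidean_space \<Rightarrow> real) \<Rightarrow> 'v \<Rightarrow> 'v" where
  "cahn_hoffman \<gamma> x = sphere_grad \<gamma> x + \<gamma> x *\<^sub>R x"

text \<open>
  Matrix, in the coordinates of a chart, of the endomorphism \<open>-d(\<xi> \<circ> \<nu>)\<close> of the tangent space, which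
  is identified with the hyperplane orthogonal to \<open>\<nu>\<close> by \<open>dX\<close>.
\<close>

definition shape_matrix ::
  "(real^('n option) \<Rightarrow> real) \<Rightarrow> ('a, 'n::finite) chart set \<Rightarrow> ('a \<Rightarrow> real^('n option)) \<Rightarrow>
     ('a, 'n) chart \<Rightarrow> 'a \<Rightarrow> real^'n^'n" where
  "shape_matrix \<gamma> \<A> X c p = (THE S. \<forall>v.
     frechet_derivative (in_chart c X) (at (snd c p)) (S *v v) =
       - frechet_derivative (in_chart c (\<lambda>q. cahn_hoffman \<gamma> (unit_normal \<A> X q))) (at (snd c p)) v)"

text \<open>
  Since \<open>\<gamma>\<close> is not assumed convex, eigenvalues may be non-real. They are counted with algebraic
  multiplicity, and their enumeration by \<open>'n\<close> is arbitrary.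
\<close>

definition aniso_principal_curvatures ::
  "(real^('n option) \<Rightarrow> real) \<Rightarrow> ('a, 'n::finite) chart set \<Rightarrow> ('a \<Rightarrow> real^('n option)) \<Rightarrow>
     'a \<Rightarrow> 'n \<Rightarrow> complex" where
  "aniso_principal_curvatures \<gamma> \<A> X p = (SOME \<kappa>. \<forall>c\<in>\<A>. p \<in> fst c \<longrightarrow>
     (\<forall>z. det (mat z - (\<chi> i j. complex_of_real (shape_matrix \<gamma> \<A> X c p $ i $ j)))
        = (\<Prod>l\<in>UNIV. z - \<kappa> l)))"

text \<open>The symmetric functions below are real, as non-real eigenvalues come in conjugate pairs.\<close>

definition aniso_mean_curvature ::
  "(real^('n option) \<Rightarrow> real) \<Rightarrow> ('a, 'n::finite) chart set \<Rightarrow> ('a \<Rightarrow> real^('n option)) \<Rightarrow>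
     nat \<Rightarrow> 'a \<Rightarrow> real" where
  "aniso_mean_curvature \<gamma> \<A> X r p =
     Re (\<Sum>L | card L = r. \<Prod>l\<in>L. aniso_principal_curvatures \<gamma> \<A> X p l) / real (CARD('n) choose r)"

abbreviation aniso_Lambda ::
  "(real^('n option) \<Rightarrow> real) \<Rightarrow> ('a, 'n::finite) chart set \<Rightarrow> ('a \<Rightarrow> real^('n option)) \<Rightarrow>
     'a \<Rightarrow> real" where
  "aniso_Lambda \<gamma> \<A> X \<equiv> aniso_mean_curvature \<gamma> \<A> X 1"

end

theory Submission
  imports Defs "HOL-Computational_Algebra.Fundamental_Theorem_Algebra"
begin

text \<open>
  Let \<open>\<Xi>\<close> be the Cahn-Hoffman field along \<open>X\<close>. At regular points \<open>\<Xi> \<bullet> \<nu> = \<gamma>(\<nu>)\<close>, and \<open>d\<Xi> = - dX \<circ> S\<close> is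
  tangential (\<open>cahn_hoffman_inner\<close>, \<open>cahn_hoffman_field_derivative\<close>). So the tangent vectors of
  the parallel maps \<open>Y = X + t \<Xi>\<close> are perpendicular to \<open>\<nu>\<close>, and
  \<open>det (v, dY, \<dots>, dY) = det (1 - t S) (v \<bullet> \<nu>) dA\<close>, where
  \<open>det (1 - t S) = \<Sum>\<^sub>k (- t)^k (n choose k) H_k\<close> generates the curvatures. As \<open>S\<close> need not
  be symmetric, its eigenvalues are complex numbers, counted with multiplicity.

  On a closed oriented manifold, the differential of the form \<open>det (F, G, dF, \<dots>, dF)\<close> integrates to
  zero, that is, \<open>n det (G, dF, \<dots>, dF)\<close> and the sum of the terms \<open>det (F, dF, \<dots>, dG, \<dots>, dF)\<close> have the
  same integral. For \<open>F = Y\<close> and \<open>G = \<Xi>\<close> the difference of the two integrands is a polynomial in \<open>t\<close>;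
  its coefficient of \<open>t^r\<close> is
  \<open>(- 1)^r (n - r) (n choose r) (\<gamma>(\<nu>) H_r + (X \<bullet> \<nu>) H_{r+1})\<close> by \<open>stokes_density_parallel\<close>. As the
  integral vanishes for all \<open>t\<close>, so does the integral of each coefficient
  (\<open>has_bochner_integral_coeff_0\<close>), which is the claim.

  The maps \<open>X\<close> and \<open>\<Xi>\<close> need not be differentiable along the seams of the pieces. But \<open>X\<close> is continuous, and
  the matching condition says that \<open>\<Xi>\<close> is, too, although the normal may jump. Being piecewise \<open>C^1\<close> on finitely
  many closed pieces, both are locally Lipschitz (\<open>loc_lip_on_closed_cover\<close>), and the seams are null
  sets. Hence Stokes' theorem is needed for Lipschitz maps that are differentiable off a closed null
  set (\<open>has_bochner_integral_stokes\<close>).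

  In coordinates, Stokes' theorem is derived from the fact that the integral of a Jacobian depends only on the
  boundary values of the map (\<open>has_bochner_integral_jacobian_diff\<close>). If \<open>h0\<close> and \<open>h1\<close> agree outside a
  compact set \<open>B\<close>, then \<open>id + s h0\<close> and \<open>id + s h1\<close> are for small \<open>s\<close> bijections with the same image of
  \<open>B\<close>, whose volume is the integral of either Jacobian; comparing the coefficients of \<open>s^n\<close> gives the
  fact. Applied to the variations \<open>F + t g F\<close> with \<open>g\<close> of compact support, it
  yields the Stokes identity for \<open>F\<close> and \<open>G = g w\<close> with \<open>w\<close> constant
  (\<open>has_bochner_integral_frame_scalar\<close>), and a partition of unity globalizes it.
\<close>

section \<open>Coefficients of integrals of polynomials\<close>

text \<open>
  Integrating a polynomial family and comparing coefficients must not presuppose that the single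
  coefficients are integrable. Integrability comes with the result: \<open>p(t) - 2^d p(t/2)\<close> has lower
  degree than \<open>p\<close> and is again integrable with integral zero, so the coefficients are reached one
  after the other. The bound on \<open>t\<close> allows for identities
  that hold only near the identity map, as for the Jacobians below.
\<close>

lemma has_bochner_integral_coeff_0:
  fixes a :: "nat \<Rightarrow> 'x \<Rightarrow> real"
  assumes "0 < \<delta>"
    and "\<And>t. 0 < t \<Longrightarrow> t < \<delta> \<Longrightarrow> has_bochner_integral M (\<lambda>x. \<Sum>k\<le>d. t ^ k * a k x) 0"
    and "k \<le> d"
  shows "has_bochner_integral M (a k) 0"
  using assms(2,3)
proof (induction d arbitrary: a k)
  case 0
  have "has_bochner_integral M (\<lambda>x. \<Sum>k\<le>0. (\<delta>/2) ^ k * a k x) 0"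
    using \<open>0 < \<delta>\<close> by (intro 0) auto
  then show ?case using 0(2) by simp
next
  case (Suc d)
  let ?P = "\<lambda>a t x. \<Sum>k\<le>Suc d. t ^ k * a k x"
  define b :: "nat \<Rightarrow> 'x \<Rightarrow> real" where "b = (\<lambda>k x. (1 - 2 ^ Suc d / 2 ^ k) * a k x)"
  have low: "has_bochner_integral M (a k) 0" if "k \<le> d" for k
  proof -
    have "has_bochner_integral M (b k) 0"
    proof (rule Suc.IH [OF _ that])
      fix t :: real assume t: "0 < t" "t < \<delta>"
      have "has_bochner_integral M (\<lambda>x. ?P a t x - 2 ^ Suc d * ?P a (t/2) x) (0 - 2 ^ Suc d * 0)"
        using t by (intro has_bochner_integral_diff has_bochner_integral_mult_right Suc.prems(1)) auto
      moreover have "?P a t x - 2 ^ Suc d * ?P a (t/2) x = (\<Sum>k\<le>d. t ^ k * b k x)" for x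
      proof -
        have "?P a t x - 2 ^ Suc d * ?P a (t/2) x = (\<Sum>k\<le>Suc d. t ^ k * b k x)"
          by (simp only: sum_distrib_left sum_subtractf [symmetric])
             (intro sum.cong, auto simp: b_def power_divide field_simps)
        then show ?thesis by (simp add: b_def)
      qed
      ultimately show "has_bochner_integral M (\<lambda>x. \<Sum>k\<le>d. t ^ k * b k x) 0" by simp
    qed
    then have *: "has_bochner_integral M (\<lambda>x. inverse (1 - 2 ^ Suc d / 2 ^ k) * b k x) (inverse (1 - 2 ^ Suc d / 2 ^ k) * 0)"
      by (intro has_bochner_integral_mult_right)
    have "(1 - 2 ^ Suc d / 2 ^ k :: real) \<noteq> 0"
    proof -
      have "(2::real) ^ k < 2 ^ Suc d" using that by (intro power_strict_increasing) auto
      then show ?thesis by simp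
    qed
    then have "inverse (1 - 2 ^ Suc d / 2 ^ k) * b k x = a k x" for x
      by (simp add: b_def del: power_Suc)
    then show ?thesis using * by simp
  qed
  show ?case
  proof (cases "k \<le> d")
    case False
    then have k: "k = Suc d" using Suc.prems by simp
    let ?t = "\<delta>/2"
    have *: "has_bochner_integral M (\<lambda>x. inverse (?t ^ Suc d) * (?P a ?t x - (\<Sum>k\<le>d. ?t ^ k * a k x)))
       (inverse (?t ^ Suc d) * (0 - (\<Sum>k\<le>d. ?t ^ k * 0)))"
      using \<open>0 < \<delta>\<close>
      by (intro has_bochner_integral_mult_right has_bochner_integral_diff Suc.prems(1)
          has_bochner_integral_sum low) auto
    have "inverse (?t ^ Suc d) * (?P a ?t x - (\<Sum>k\<le>d. ?t ^ k * a k x)) = a k x" for x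
      using \<open>0 < \<delta>\<close> by (simp add: k del: power_Suc)
    then show ?thesis using * by simp
  qed (rule low)
qed

section \<open>Determinants of matrix pencils\<close>

lemma sum_UNIV_option:
  fixes f :: "'n::finite option \<Rightarrow> 'b::comm_monoid_add"
  shows "sum f UNIV = f None + (\<Sum>i\<in>UNIV. f (Some i))"
  by (simp add: UNIV_option_conv sum.reindex)

text \<open>
  A permutation that moves an index outside the range of \<open>f\<close> picks up a zero of a unit row; the
  remaining ones are exactly the extensions by the identity of permutations of the small index type,
  with the same sign.
\<close>

lemma det_embedded_block:
  fixes A :: "'a::comm_ring_1^'m::finite^'m" and f :: "'n::finite \<Rightarrow> 'm"
  assumes f: "inj f" and A: "\<And>i. i \<notin> range f \<Longrightarrow> A $ i = axis i 1"
  shows "det A = det (\<chi> i j. A $ f i $ f j)"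
proof -
  let ?m = "map_permutation UNIV f"
  let ?g = "\<lambda>p. of_int (sign p) * (\<Prod>i\<in>UNIV. A $ i $ p i)"
  have app: "?m q (f i) = f (q i)" for q i
    using f by (simp add: map_permutation_apply)
  have out: "?m q i = i" if "i \<notin> range f" for q i
    using that by (simp add: map_permutation_def)
  have "inj_on ?m {q. q permutes UNIV}"
  proof (rule inj_onI)
    fix p q assume "?m p = ?m q"
    then have "f (p i) = f (q i)" for i using app by metis
    then show "p = q" using f by (auto simp: inj_def)
  qed
  then have "sum ?g (?m ` {q. q permutes UNIV}) = (\<Sum>q\<in>{q. q permutes UNIV}. ?g (?m q))"
    by (simp add: sum.reindex o_def)
  also have "\<dots> = det (\<chi> i j. A $ f i $ f j)"
    unfolding det_def
  proof (intro sum.cong refl)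
    fix q :: "'n \<Rightarrow> 'n" assume "q \<in> {q. q permutes UNIV}"
    then have "sign (?m q) = sign q"
      using f by (intro sign_map_permutation) auto
    moreover have "(\<Prod>i\<in>UNIV. A $ i $ ?m q i) = (\<Prod>i\<in>range f. A $ i $ ?m q i)"
      by (rule prod.mono_neutral_right) (auto simp: A out)
    moreover have "\<dots> = (\<Prod>i\<in>UNIV. A $ f i $ f (q i))"
      using f by (subst prod.reindex) (auto simp: app)
    ultimately show "?g (?m q) = of_int (sign q) * (\<Prod>i\<in>UNIV. (\<chi> i j. A $ f i $ f j) $ i $ q i)"
      by simp
  qed
  also have "sum ?g (?m ` {q. q permutes UNIV}) = sum ?g {p. p permutes UNIV}"
  proof (rule sum.mono_neutral_left)
    show "?m ` {q. q permutes UNIV} \<subseteq> {p. p permutes UNIV}"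
    proof clarify
      fix q :: "'n \<Rightarrow> 'n" assume "q permutes UNIV"
      then have "?m q permutes range f"
        using f by (intro map_permutation_permutes) (auto simp: bij_betw_def)
      then show "?m q permutes UNIV" by (rule permutes_subset) auto
    qed
    show "\<forall>p\<in>{p. p permutes UNIV} - ?m ` {q. q permutes UNIV}. ?g p = 0"
    proof clarify
      fix p :: "'m \<Rightarrow> 'm" assume p: "p permutes UNIV" and notin: "p \<notin> ?m ` {q. q permutes UNIV}"
      show "?g p = 0"
      proof (cases "\<forall>i. i \<notin> range f \<longrightarrow> p i = i")
        case True
        have inj: "inj p" using p by (simp add: permutes_inj)
        have in_range: "p (f i) \<in> range f" for i
          using True inj by (metis injD rangeI)
        define q where "q i = inv f (p (f i))" for i
        have fq: "f (q i) = p (f i)" for i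
          using in_range f by (simp add: q_def f_inv_into_f)
        have "inj q"
          by (metis fq f inj injD injI)
        then have "q permutes UNIV"
          by (intro bij_imp_permutes) (auto simp: bij_def finite_UNIV_inj_surj)
        moreover have "p = ?m q"
        proof
          fix i show "p i = ?m q i"
            by (cases "i \<in> range f") (auto simp: app fq out True)
        qed
        ultimately show ?thesis using notin by blast
      next
        case False
        then obtain i where "i \<notin> range f" "p i \<noteq> i" by blast
        then have "A $ i $ p i = 0" by (simp add: A axis_def)
        then have "(\<Prod>i\<in>UNIV. A $ i $ p i) = 0" by (meson UNIV_I finite prod_zero)
        then show ?thesis by simp
      qed
    qed
  qed simp
  finally show ?thesis by (simp add: det_def)
qed

corollary det_reindex:
  fixes A :: "'a::comm_ring_1^'m::finite^'m" and f :: "'n::finite \<Rightarrow> 'm"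
  assumes "bij f"
  shows "det (\<chi> i j. A $ f i $ f j) = det A"
  using det_embedded_block [of f A] assms by (simp add: bij_def)

corollary det_option_block:
  fixes A :: "'a::comm_ring_1^('n::finite option)^('n option)"
  assumes "A $ None = axis None 1"
  shows "det A = det (\<chi> i j. A $ Some i $ Some j)"
proof (rule det_embedded_block)
  fix i :: "'n option" assume "i \<notin> range Some"
  then show "A $ i = axis i 1" using assms by (cases i) auto
qed auto

definition row_mix :: "'m set \<Rightarrow> 'a^'m^'m \<Rightarrow> 'a^'m^'m \<Rightarrow> 'a^'m^'m" where
  "row_mix L R S = (\<chi> i. if i \<in> L then S $ i else R $ i)"

text \<open>
  The coefficient of \<open>t^k\<close> in \<open>det (R + t S)\<close>, written as a sum of determinants with mixed rows so
  that multilinearity can be used on it; the name is justified by \<open>det_pencil\<close> below.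
\<close>

definition det_coeff :: "nat \<Rightarrow> 'a::comm_ring_1^'m::finite^'m \<Rightarrow> 'a^'m^'m \<Rightarrow> 'a" where
  "det_coeff k R S = (\<Sum>L | card L = k. det (row_mix L R S))"

lemma det_pencil:
  fixes R S :: "real^'m::finite^'m"
  shows "det (R + t *\<^sub>R S) = (\<Sum>k\<le>CARD('m). t ^ k * det_coeff k R S)"
proof -
  let ?P = "{p. p permutes (UNIV :: 'm set)}"
  have "det (R + t *\<^sub>R S) = (\<Sum>p\<in>?P. of_int (sign p) * (\<Sum>L\<in>UNIV. t ^ card L * (\<Prod>i\<in>UNIV. row_mix L R S $ i $ p i)))"
    unfolding det_def
  proof (intro sum.cong refl arg_cong2 [where f = "(*)"])
    fix p :: "'m \<Rightarrow> 'm"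
    have "(\<Prod>i\<in>UNIV. (R + t *\<^sub>R S) $ i $ p i) = (\<Prod>i\<in>UNIV. t * S $ i $ p i + R $ i $ p i)"
      by (simp add: add.commute)
    also have "\<dots> = (\<Sum>L\<in>UNIV. (\<Prod>i\<in>L. t * S $ i $ p i) * (\<Prod>i\<in>UNIV - L. R $ i $ p i))"
      by (subst prod_add) auto
    also have "\<dots> = (\<Sum>L\<in>UNIV. t ^ card L * (\<Prod>i\<in>UNIV. row_mix L R S $ i $ p i))"
    proof (rule sum.cong [OF refl])
      fix L :: "'m set"
      have "(\<Prod>i\<in>UNIV. row_mix L R S $ i $ p i) = (\<Prod>i\<in>L. S $ i $ p i) * (\<Prod>i\<in>UNIV - L. R $ i $ p i)"
        by (subst prod.subset_diff [of L]) (auto simp: row_mix_def intro!: arg_cong2 [where f = "(*)"] prod.cong)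
      then show "(\<Prod>i\<in>L. t * S $ i $ p i) * (\<Prod>i\<in>UNIV - L. R $ i $ p i) = t ^ card L * (\<Prod>i\<in>UNIV. row_mix L R S $ i $ p i)"
        by (simp add: prod.distrib)
    qed
    finally show "(\<Prod>i\<in>UNIV. (R + t *\<^sub>R S) $ i $ p i) = (\<Sum>L\<in>UNIV. t ^ card L * (\<Prod>i\<in>UNIV. row_mix L R S $ i $ p i))" .
  qed
  also have "\<dots> = (\<Sum>L\<in>UNIV. t ^ card L * det (row_mix L R S))"
    unfolding det_def sum_distrib_left
    by (subst sum.swap) (simp add: ac_simps)
  also have "\<dots> = (\<Sum>k\<le>CARD('m). \<Sum>L | card L = k. t ^ card L * det (row_mix L R S))"
    by (subst sum.group [symmetric, where T = "{..CARD('m)}" and g = card]) (auto simp: card_mono)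
  also have "\<dots> = (\<Sum>k\<le>CARD('m). t ^ k * det_coeff k R S)"
    by (simp add: det_coeff_def sum_distrib_left)
  finally show ?thesis .
qed

lemma det_coeff_top: "det_coeff CARD('m) R S = det (S :: 'a::comm_ring_1^'m::finite^'m)"
proof -
  have "{L :: 'm set. card L = CARD('m)} = {UNIV}"
    using card_subset_eq [of "UNIV :: 'm set"] by auto
  then show ?thesis by (simp add: det_coeff_def row_mix_def)
qed

lemma det_coeff_0: "det_coeff 0 R S = det (R :: 'a::comm_ring_1^'m::finite^'m)"
proof -
  have "{L :: 'm set. card L = 0} = {{}}" by auto
  then show ?thesis by (simp add: det_coeff_def row_mix_def)
qed

lemma det_coeff_1:
  "det_coeff 1 R S = (\<Sum>k\<in>UNIV. det ((\<chi> i. if i = k then S $ i else R $ i) :: 'a::comm_ring_1^'m::finite^'m))"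
proof -
  have "{L :: 'm set. card L = 1} = (\<lambda>k. {k}) ` UNIV"
    by (auto simp: card_1_singleton_iff)
  then show ?thesis by (simp add: det_coeff_def row_mix_def sum.reindex)
qed

lemma det_pencil_deriv:
  fixes R S :: "real^'m::finite^'m"
  shows "((\<lambda>t. det (R + t *\<^sub>R S)) has_real_derivative det_coeff 1 R S) (at 0)"
proof -
  have "((\<lambda>t. \<Sum>k\<le>CARD('m). t ^ k * det_coeff k R S) has_real_derivative
     (\<Sum>k\<le>CARD('m). real k * 0 ^ (k - Suc 0) * det_coeff k R S)) (at 0)"
    by (auto intro!: derivative_eq_intros simp: ac_simps)
  also have "(\<Sum>k\<le>CARD('m). real k * 0 ^ (k - Suc 0) * det_coeff k R S)
     = (\<Sum>k\<in>{1}. real k * 0 ^ (k - Suc 0) * det_coeff k R S)"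
    by (intro sum.mono_neutral_right) (auto simp: Suc_le_eq power_0_left)
  finally show ?thesis by (simp add: det_pencil)
qed

text \<open>
  Both sides are the derivative at \<open>0\<close> of \<open>t \<mapsto> det (P (R + t S))\<close>.
\<close>

lemma det_coeff_1_mult:
  fixes P R S :: "real^'m::finite^'m"
  shows "det_coeff 1 (P ** R) (P ** S) = det P * det_coeff 1 R S"
proof -
  have eq: "det (P ** R + t *\<^sub>R (P ** S)) = det P * det (R + t *\<^sub>R S)" for t
    by (simp add: det_mul [symmetric] matrix_add_ldistrib matrix_scalar_ac flip: scalar_matrix_assoc)
  have "((\<lambda>t. det P * det (R + t *\<^sub>R S)) has_real_derivative det P * det_coeff 1 R S) (at 0)"
    by (intro DERIV_cmult det_pencil_deriv)
  moreover have "((\<lambda>t. det P * det (R + t *\<^sub>R S)) has_real_derivative det_coeff 1 (P ** R) (P ** S)) (at 0)"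
    using det_pencil_deriv [of "P ** R" "P ** S"] by (simp only: eq)
  ultimately show ?thesis using DERIV_unique by blast
qed

section \<open>Change of variables over an arbitrary finite index type\<close>

text \<open>
  A copy of a finite index type that carries a well-order. Change of variables for well-ordered
  coordinates is transported along the renaming of coordinates to coordinates without an order, such
  as those of a manifold chart.
\<close>

typedef ('n::finite) enumerated = "UNIV :: 'n set" ..

lemma bij_Rep_enumerated: "bij (Rep_enumerated :: 'n::finite enumerated \<Rightarrow> 'n)"
  by (intro bijI' exI [of _ "Abs_enumerated _"])
    (auto simp: Rep_enumerated_inject Abs_enumerated_inverse)

instance enumerated :: (finite) finite
  by standard (metis bij_Rep_enumerated bij_betw_finite finite_class.finite_UNIV)

definition element_number :: "'n::finite \<Rightarrow> nat" where
  "element_number = (SOME f. inj f)"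

lemma inj_element_number: "inj (element_number :: 'n::finite \<Rightarrow> nat)"
proof -
  have "\<exists>f :: 'n \<Rightarrow> nat. inj f"
    using finite_imp_inj_to_nat_seg [OF finite_class.finite_UNIV] by blast
  then show ?thesis unfolding element_number_def by (rule someI_ex)
qed

instantiation enumerated :: (finite) wellorder
begin

definition less_eq_enumerated :: "'a enumerated \<Rightarrow> 'a enumerated \<Rightarrow> bool" where
  "x \<le> y \<longleftrightarrow> element_number (Rep_enumerated x) \<le> element_number (Rep_enumerated y)"

definition less_enumerated :: "'a enumerated \<Rightarrow> 'a enumerated \<Rightarrow> bool" where
  "x < y \<longleftrightarrow> element_number (Rep_enumerated x) < element_number (Rep_enumerated y)"

instance
proof
  fix x y :: "'a enumerated"
  show "x \<le> y \<Longrightarrow> y \<le> x \<Longrightarrow> x = y"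
    using inj_element_number by (metis Rep_enumerated_inject antisym injD less_eq_enumerated_def)
next
  fix P :: "'a enumerated \<Rightarrow> bool" and a
  assume "\<And>x. (\<And>y. y < x \<Longrightarrow> P y) \<Longrightarrow> P x"
  then show "P a"
    unfolding less_enumerated_def
    by (rule measure_induct [where f = "\<lambda>x. element_number (Rep_enumerated x)"]) blast
qed (auto simp: less_eq_enumerated_def less_enumerated_def)

end

definition relabel :: "('m \<Rightarrow> 'n) \<Rightarrow> real^'n \<Rightarrow> real^'m" where
  "relabel f x = (\<chi> i. x $ f i)"

lemma relabel_inv:
  assumes "bij f"
  shows "relabel f (relabel (inv f) x) = x" "relabel (inv f) (relabel f y) = y"
  using assms by (auto simp: relabel_def vec_eq_iff bij_is_surj bij_is_inj surj_f_inv_f)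

lemma bounded_linear_relabel: "bounded_linear (relabel (f :: 'm::finite \<Rightarrow> 'n::finite))"
  unfolding linear_conv_bounded_linear [symmetric]
  by (auto simp: relabel_def linear_iff vec_eq_iff)

lemma prod_Basis_vec:
  fixes F :: "real^'n::finite \<Rightarrow> real"
  shows "(\<Prod>b\<in>Basis. F b) = (\<Prod>i\<in>UNIV. F (axis i 1))"
proof -
  have *: "(Basis :: (real^'n) set) = range (\<lambda>i. axis i 1)"
    by (auto simp: Basis_vec_def)
  have "inj (\<lambda>i. axis i 1 :: real^'n)"
    by (auto simp: inj_def axis_eq_axis)
  then show ?thesis unfolding * by (subst prod.reindex) (auto simp: o_def)
qed

lemma lborel_relabel:
  fixes f :: "'m::finite \<Rightarrow> 'n::finite"
  assumes f: "bij f"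
  shows "distr lborel borel (relabel f) = lborel"
proof (rule lborel_eqI [symmetric])
  have meas: "relabel f \<in> borel_measurable borel"
    by (intro borel_measurable_continuous_onI linear_continuous_on bounded_linear_relabel)
  fix l u :: "real^'m" assume le: "\<And>b. b \<in> Basis \<Longrightarrow> l \<bullet> b \<le> u \<bullet> b"
  have le': "l $ i \<le> u $ i" for i
    using le [of "axis i 1"] by (simp add: inner_axis axis_in_Basis_iff)
  let ?g = "relabel (inv f)"
  have "relabel f -` box l u = box (?g l) (?g u)"
  proof -
    have "(\<forall>i. l $ i < x $ f i \<and> x $ f i < u $ i) \<longleftrightarrow>
          (\<forall>j. l $ inv f j < x $ j \<and> x $ j < u $ inv f j)" for x :: "real^'n"
    proof -
      have "(\<forall>i. Q (f i)) \<longleftrightarrow> (\<forall>j. Q j)" for Q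
        using bij_is_surj [OF f] by (metis surjD)
      from this [of "\<lambda>j. l $ inv f j < x $ j \<and> x $ j < u $ inv f j"] show ?thesis
        using f by (simp add: bij_is_inj)
    qed
    then show ?thesis
      by (auto simp: mem_box_cart relabel_def)
  qed
  then have "emeasure (distr lborel borel (relabel f)) (box l u) = emeasure lborel (box (?g l) (?g u))"
    using meas by (subst emeasure_distr) auto
  also have "\<dots> = (\<Prod>b\<in>Basis. (?g u - ?g l) \<bullet> b)"
    by (subst emeasure_lborel_box) (use le' in \<open>auto simp: Basis_vec_def inner_axis relabel_def\<close>)
  also have "(\<Prod>b\<in>Basis. (?g u - ?g l) \<bullet> b) = (\<Prod>j\<in>UNIV. (u - l) $ inv f j)"
    by (simp add: prod_Basis_vec inner_axis relabel_def)
  also have "\<dots> = (\<Prod>i\<in>UNIV. (u - l) $ i)"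
    using f by (intro prod.reindex_bij_betw) (simp add: bij_imp_bij_inv)
  finally show "emeasure (distr lborel borel (relabel f)) (box l u) = (\<Prod>b\<in>Basis. (u - l) \<bullet> b)"
    by (simp add: prod_Basis_vec inner_axis)
qed simp

lemma relabel_image_eq_vimage:
  assumes "bij f" shows "relabel (inv f) ` A = relabel f -` A"
  using relabel_inv [OF assms] by (auto simp: image_iff) metis

text \<open>
  A Lebesgue set differs from a Borel set by a subset of a Borel null set, and renaming coordinates
  preserves the Borel measure.
\<close>

lemma emeasure_lebesgue_relabel:
  fixes f :: "'m::finite \<Rightarrow> 'n::finite"
  assumes f: "bij f" and A: "A \<in> sets lebesgue"
  shows "relabel f ` A \<in> sets lebesgue" "emeasure lebesgue (relabel f ` A) = emeasure lebesgue A"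
proof -
  note bl = bounded_linear_relabel
  show "relabel f ` A \<in> sets lebesgue"
  proof (rule differentiable_image_in_sets_lebesgue [OF A])
    show "DIM(real^'n) \<le> DIM(real^'m)"
      using bij_betw_same_card [OF f] by simp
    show "relabel f differentiable_on A"
      by (intro linear_imp_differentiable_on bounded_linear.linear [OF bl])
  qed
  obtain S N N' where A': "A = S \<union> N" "N \<subseteq> N'" "N' \<in> null_sets lborel" "S \<in> sets lborel"
    using A by (rule sets_completionE)
  let ?g = "inv f"
  have g: "bij ?g" "inv ?g = f"
    using f by (auto simp: bij_imp_bij_inv inv_inv_eq)
  have meas: "relabel ?g \<in> borel_measurable borel"
    by (intro borel_measurable_continuous_onI linear_continuous_on bl)
  have im: "relabel f ` B = relabel ?g -` B" for B
    using relabel_image_eq_vimage [OF g(1)] by (simp add: g)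
  have borel: "relabel f ` B \<in> sets lborel \<and> emeasure lborel (relabel f ` B) = emeasure lborel B"
    if "B \<in> sets lborel" for B
  proof
    show "relabel f ` B \<in> sets lborel"
      using measurable_sets [OF meas, of B] that by (simp add: im)
    have "emeasure lborel B = emeasure (distr lborel borel (relabel ?g)) B"
      by (simp add: lborel_relabel [OF g(1)])
    also have "\<dots> = emeasure lborel (relabel f ` B)"
      using meas that by (subst emeasure_distr) (auto simp: im)
    finally show "emeasure lborel (relabel f ` B) = emeasure lborel B" ..
  qed
  have null: "N' \<in> null_sets lborel" "relabel f ` N' \<in> null_sets lborel"
    using A'(3) borel [of N'] by (auto simp: null_sets_def)
  have "emeasure lebesgue (B \<union> C) = emeasure lborel B"
    if "B \<in> sets lborel" "C \<subseteq> D" "D \<in> null_sets lborel" for B C D :: "(real^'k::finite) set"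
  proof -
    have C: "C \<in> null_sets lebesgue"
      using that by (meson null_sets_completionI null_sets_completion_subset)
    then have "emeasure lebesgue (B \<union> C) = emeasure lebesgue B"
      using that by (intro emeasure_Un_null_set) auto
    then show ?thesis using that by simp
  qed
  note * = this
  show "emeasure lebesgue (relabel f ` A) = emeasure lebesgue A"
    unfolding A'(1) image_Un
    using A' null borel [OF A'(4)] *[of S N N'] *[of "relabel f ` S" "relabel f ` N" "relabel f ` N'"]
    by (simp add: image_mono)
qed

lemma lebesgue_relabel:
  fixes f :: "'m::finite \<Rightarrow> 'n::finite"
  assumes f: "bij f" 
  shows "relabel f \<in> lebesgue \<rightarrow>\<^sub>M lebesgue" "distr lebesgue lebesgue (relabel f) = lebesgue"
proof -
  have g: "bij (inv f)" "inv (inv f) = f"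
    using f by (auto simp: bij_imp_bij_inv inv_inv_eq)
  show meas: "relabel f \<in> lebesgue \<rightarrow>\<^sub>M lebesgue"
    using emeasure_lebesgue_relabel(1) [OF g(1)] relabel_image_eq_vimage [OF f]
    by (intro measurableI) auto
  show "distr lebesgue lebesgue (relabel f) = lebesgue"
    using emeasure_lebesgue_relabel(2) [OF g(1)] relabel_image_eq_vimage [OF f] meas
    by (intro measure_eqI) (auto simp: emeasure_distr)
qed

text \<open>
  The value \<open>\<infinity>\<close> is included: a finite integral of the Jacobian is equivalent to a finite measure of
  the image, with the same value, so both are infinite together.
\<close>

lemma emeasure_differentiable_image_wellorder:
  fixes g :: "real^'n::{finite,wellorder} \<Rightarrow> real^'n::_"
  assumes S: "S \<in> sets lebesgue"
    and der: "\<And>x. x \<in> S \<Longrightarrow> (g has_derivative g' x) (at x within S)"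
    and inj: "inj_on g S"
  shows "(\<lambda>x. \<bar>det (matrix (g' x))\<bar> * indicator S x) \<in> borel_measurable lebesgue"
    and "emeasure lebesgue (g ` S) = (\<integral>\<^sup>+x. ennreal (\<bar>det (matrix (g' x))\<bar> * indicator S x) \<partial>lebesgue)"
proof -
  let ?d = "\<lambda>x. \<bar>det (matrix (g' x))\<bar> * indicator S x"
  have "(\<lambda>x. det (matrix (g' x))) \<in> borel_measurable (lebesgue_on S)"
    by (intro borel_measurable_det_Jacobian [where f = g] S der)
  then have "(\<lambda>x. \<bar>det (matrix (g' x))\<bar>) \<in> borel_measurable (lebesgue_on S)"
    by measurable
  then show meas: "?d \<in> borel_measurable lebesgue"
    using S by (subst (asm) borel_measurable_restrict_space_iff) (auto simp: mult.commute)
  have gS: "g ` S \<in> sets lebesgue"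
  proof (rule differentiable_image_in_sets_lebesgue [OF S])
    show "g differentiable_on S"
      using der by (auto simp: differentiable_on_def differentiable_def)
  qed simp
  have iff: "g ` S \<in> lmeasurable \<and> measure lebesgue (g ` S) = m \<longleftrightarrow> integral\<^sup>N lebesgue ?d = ennreal m \<and> 0 \<le> m" for m
  proof -
    have "g ` S \<in> lmeasurable \<and> measure lebesgue (g ` S) = m \<longleftrightarrow> ((\<lambda>x. \<bar>det (matrix (g' x))\<bar>) has_integral m) S"
      by (rule has_measure_differentiable_image [OF S der inj])
    also have "\<dots> \<longleftrightarrow> (?d has_integral m) UNIV"
      unfolding has_integral_restrict_UNIV [of S, symmetric] by (intro has_integral_cong) (auto simp: indicator_def)
    also have "\<dots> \<longleftrightarrow> integral\<^sup>N lebesgue ?d = ennreal m \<and> 0 \<le> m"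
      using meas by (subst has_integral_iff_nn_integral_lebesgue) auto
    finally show ?thesis .
  qed
  show "emeasure lebesgue (g ` S) = integral\<^sup>N lebesgue ?d"
  proof (cases "integral\<^sup>N lebesgue ?d" rule: ennreal_cases)
    case (real m)
    then have "g ` S \<in> lmeasurable" "measure lebesgue (g ` S) = m" using iff [of m] by blast+
    then show ?thesis using real by (simp only: emeasure_eq_measure2)
  next
    case top
    then have "g ` S \<notin> lmeasurable" using iff [of "measure lebesgue (g ` S)"] by simp
    then have "\<not> emeasure lebesgue (g ` S) < \<infinity>" using gS by (auto simp: fmeasurable_def)
    then show ?thesis by (metis infinity_ennreal_def top top.not_eq_extremum)
  qed
qed

lemma emeasure_differentiable_image:
  fixes g :: "real^'n::finite \<Rightarrow> real^'n"
  assumes S: "S \<in> sets lebesgue"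
    and der: "\<And>x. x \<in> S \<Longrightarrow> (g has_derivative g' x) (at x within S)"
    and inj: "inj_on g S"
  shows "(\<lambda>x. \<bar>det (matrix (g' x))\<bar> * indicator S x) \<in> borel_measurable lebesgue"
    and "emeasure lebesgue (g ` S) = (\<integral>\<^sup>+x. ennreal (\<bar>det (matrix (g' x))\<bar> * indicator S x) \<partial>lebesgue)"
proof -
  let ?r = "Rep_enumerated :: 'n enumerated \<Rightarrow> 'n"
  let ?T = "relabel ?r" and ?U = "relabel (inv ?r)"
  note r = bij_Rep_enumerated [where 'n = 'n]
  note r' = bij_imp_bij_inv [OF r]
  have TU: "?T (?U x) = x" "?U (?T y) = y" for x y
    using relabel_inv [OF r] by auto
  note bl = bounded_linear_relabel
  define S' where "S' = ?T ` S"
  define G where "G = (\<lambda>x. ?T (g (?U x)))"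
  define G' where "G' = (\<lambda>x v. ?T (g' (?U x) (?U v)))"
  have S': "S' \<in> sets lebesgue"
    unfolding S'_def by (intro emeasure_lebesgue_relabel r S)
  have US': "?U ` S' = S" unfolding S'_def image_image by (simp add: TU)
  have der': "(G has_derivative G' x) (at x within S')" if "x \<in> S'" for x
  proof -
    have "?U x \<in> S" using that US' by blast
    then have "(g has_derivative g' (?U x)) (at (?U x) within ?U ` S')"
      by (simp add: der US')
    moreover have "(?U has_derivative ?U) (at x within S')"
      by (intro bounded_linear_imp_has_derivative bl)
    ultimately have "(g \<circ> ?U has_derivative g' (?U x) \<circ> ?U) (at x within S')"
      by (intro diff_chain_within)
    then have "((\<lambda>x. ?T ((g \<circ> ?U) x)) has_derivative (\<lambda>v. ?T ((g' (?U x) \<circ> ?U) v))) (at x within S')"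
      by (intro bounded_linear.has_derivative [OF bl])
    then show ?thesis by (simp add: G_def G'_def)
  qed
  have inj': "inj_on G S'"
  proof (rule inj_onI)
    fix x y assume "x \<in> S'" "y \<in> S'" "G x = G y"
    then have "?U x \<in> S" "?U y \<in> S" "?U (G x) = ?U (G y)" using US' by auto
    then have "?U x = ?U y" using inj by (auto simp: G_def TU dest: inj_onD)
    then have "?T (?U x) = ?T (?U y)" by (rule arg_cong)
    then show "x = y" by (simp only: TU)
  qed
  have GS: "G ` S' = ?T ` g ` S"
    unfolding G_def S'_def image_image by (simp add: TU)
  have det: "det (matrix (G' (?T x))) = det (matrix (g' x))" for x
  proof -
    have "matrix (G' (?T x)) = (\<chi> i j. matrix (g' x) $ ?r i $ ?r j)"
    proof -
      have "?U (axis j 1) = axis (?r j) 1" for j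
      proof -
        have "inv ?r i = j \<longleftrightarrow> i = ?r j" for i
          using r by (metis bij_inv_eq_iff)
        then show ?thesis by (auto simp: relabel_def vec_eq_iff axis_def)
      qed
      then show ?thesis
        by (simp add: vec_eq_iff matrix_def G'_def TU) (simp add: relabel_def)
    qed
    then show ?thesis by (simp add: det_reindex [OF r])
  qed
  note * = emeasure_differentiable_image_wellorder [OF S' der' inj']
  have ind: "indicator S' (?T x) = (indicator S x :: real)" for x
  proof -
    have "inj ?T" by (rule injI) (metis TU(2))
    then show ?thesis by (simp add: S'_def indicator_def inj_image_mem_iff)
  qed
  have "(\<lambda>x. \<bar>det (matrix (G' (?T x)))\<bar> * indicator S' (?T x)) \<in> borel_measurable lebesgue"
    using measurable_compose [OF lebesgue_relabel(1) [OF r] *(1)] .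
  then show "(\<lambda>x. \<bar>det (matrix (g' x))\<bar> * indicator S x) \<in> borel_measurable lebesgue"
    by (simp add: det ind)
  have gS: "g ` S \<in> sets lebesgue"
  proof (rule differentiable_image_in_sets_lebesgue [OF S])
    show "g differentiable_on S"
      using der by (auto simp: differentiable_on_def differentiable_def)
  qed simp
  have "emeasure lebesgue (g ` S) = emeasure lebesgue (G ` S')"
    unfolding GS using emeasure_lebesgue_relabel(2) [OF r gS] by simp
  also have "\<dots> = (\<integral>\<^sup>+x. ennreal (\<bar>det (matrix (G' x))\<bar> * indicator S' x) \<partial>distr lebesgue lebesgue ?T)"
    using *(2) lebesgue_relabel(2) [OF r] by simp
  also have "\<dots> = (\<integral>\<^sup>+x. ennreal (\<bar>det (matrix (G' (?T x)))\<bar> * indicator S' (?T x)) \<partial>lebesgue)"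
    using *(1) lebesgue_relabel(1) [OF r] by (intro nn_integral_distr) auto
  finally show "emeasure lebesgue (g ` S) = (\<integral>\<^sup>+x. ennreal (\<bar>det (matrix (g' x))\<bar> * indicator S x) \<partial>lebesgue)"
    by (simp add: det ind)
qed

text \<open>
  The two sides are the integrals of \<open>f\<close> against the push-forward of the Jacobian density and against
  Lebesgue measure on the image; these measures agree by the area formula for images of subsets.
  The differentiable left inverse \<open>h\<close> makes preimages of Lebesgue sets, and not only of Borel sets,
  Lebesgue measurable.
\<close>

theorem nn_integral_change_of_variables:
  fixes g h :: "real^'n::finite \<Rightarrow> real^'n" and f :: "real^'n \<Rightarrow> ennreal"
  assumes S: "S \<in> sets lebesgue"
    and der: "\<And>x. x \<in> S \<Longrightarrow> (g has_derivative g' x) (at x within S)"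
    and h: "h differentiable_on g ` S" and hg: "\<And>x. x \<in> S \<Longrightarrow> h (g x) = x"
    and f: "f \<in> borel_measurable lebesgue"
  shows "(\<integral>\<^sup>+y. f y * indicator (g ` S) y \<partial>lebesgue)
       = (\<integral>\<^sup>+x. ennreal (\<bar>det (matrix (g' x))\<bar>) * f (g x) * indicator S x \<partial>lebesgue)"
proof -
  let ?d = "\<lambda>x. \<bar>det (matrix (g' x))\<bar> * indicator S x"
  have inj: "inj_on g S" using hg by (metis inj_onI)
  note * = emeasure_differentiable_image [OF S der inj]
  have gS: "g ` S \<in> sets lebesgue"
  proof (rule differentiable_image_in_sets_lebesgue [OF S])
    show "g differentiable_on S"
      using der by (auto simp: differentiable_on_def differentiable_def)
  qed simp
  define g1 where "g1 = (\<lambda>x. if x \<in> S then g x else 0)"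
  have pre: "{x \<in> S. g x \<in> A} \<in> sets lebesgue" if "A \<in> sets lebesgue" for A
  proof -
    have "{x \<in> S. g x \<in> A} = h ` (g ` S \<inter> A)"
      using hg by force
    moreover have "h ` (g ` S \<inter> A) \<in> sets lebesgue"
      using h gS that by (intro differentiable_image_in_sets_lebesgue) (auto intro: differentiable_on_subset)
    ultimately show ?thesis by simp
  qed
  have g1: "g1 \<in> lebesgue \<rightarrow>\<^sub>M lebesgue"
  proof (rule measurableI)
    fix A :: "(real^'n) set" assume A: "A \<in> sets lebesgue"
    have "g1 -` A \<inter> space lebesgue = {x \<in> S. g x \<in> A} \<union> (if 0 \<in> A then - S else {})"
      by (auto simp: g1_def split: if_splits)
    also have "\<dots> \<in> sets lebesgue"
      using pre [OF A] S by (auto simp: Compl_in_sets_lebesgue intro!: sets.Un)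
    finally show "g1 -` A \<inter> space lebesgue \<in> sets lebesgue" .
  qed auto
  have eq: "distr (density lebesgue (\<lambda>x. ennreal (?d x))) lebesgue g1 = density lebesgue (indicator (g ` S))"
  proof (rule measure_eqI)
    fix A :: "(real^'n) set" assume "A \<in> sets (distr (density lebesgue (\<lambda>x. ennreal (?d x))) lebesgue g1)"
    then have A: "A \<in> sets lebesgue" by simp
    let ?B = "{x \<in> S. g x \<in> A}"
    have "emeasure (distr (density lebesgue (\<lambda>x. ennreal (?d x))) lebesgue g1) A
       = emeasure (density lebesgue (\<lambda>x. ennreal (?d x))) (g1 -` A)"
      using g1 A by (subst emeasure_distr) (auto simp: measurable_def)
    also have "\<dots> = (\<integral>\<^sup>+x. ennreal (?d x) * indicator (g1 -` A) x \<partial>lebesgue)"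
      using *(1) measurable_sets [OF g1 A] by (intro emeasure_density) auto
    also have "\<dots> = (\<integral>\<^sup>+x. ennreal (\<bar>det (matrix (g' x))\<bar> * indicator ?B x) \<partial>lebesgue)"
      by (intro nn_integral_cong) (auto simp: indicator_def g1_def)
    also have "\<dots> = emeasure lebesgue (g ` ?B)"
      using pre [OF A] inj
      by (intro emeasure_differentiable_image(2) [symmetric])
         (auto intro: has_derivative_subset [OF der] inj_on_subset)
    also have "g ` ?B = g ` S \<inter> A" by auto
    also have "emeasure lebesgue (g ` S \<inter> A) = emeasure (density lebesgue (indicator (g ` S))) A"
      using gS A by (simp add: emeasure_density indicator_inter_arith [symmetric])
    finally show "emeasure (distr (density lebesgue (\<lambda>x. ennreal (?d x))) lebesgue g1) A
        = emeasure (density lebesgue (indicator (g ` S))) A" .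
  qed simp
  have "(\<integral>\<^sup>+y. f y * indicator (g ` S) y \<partial>lebesgue) = (\<integral>\<^sup>+y. f y \<partial>density lebesgue (indicator (g ` S)))"
    using f gS by (subst nn_integral_density) (auto simp: mult.commute)
  also have "\<dots> = (\<integral>\<^sup>+y. f y \<partial>distr (density lebesgue (\<lambda>x. ennreal (?d x))) lebesgue g1)"
    by (simp add: eq)
  also have "\<dots> = (\<integral>\<^sup>+x. f (g1 x) \<partial>density lebesgue (\<lambda>x. ennreal (?d x)))"
    using g1 f by (intro nn_integral_distr) (auto simp: measurable_def)
  also have "\<dots> = (\<integral>\<^sup>+x. ennreal (?d x) * f (g1 x) \<partial>lebesgue)"
    using *(1) measurable_compose [OF g1 f] by (intro nn_integral_density) auto
  also have "\<dots> = (\<integral>\<^sup>+x. ennreal (\<bar>det (matrix (g' x))\<bar>) * f (g x) * indicator S x \<partial>lebesgue)"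
    by (intro nn_integral_cong) (auto simp: indicator_def g1_def)
  finally show ?thesis .
qed

section \<open>The integral of a Jacobian depends only on boundary values\<close>

lemma lipschitz_derivative_bound:
  fixes h :: "'a::real_normed_vector \<Rightarrow> 'b::real_normed_vector"
  assumes lip: "L-lipschitz_on UNIV h" and der: "(h has_derivative D) (at x)"
  shows "norm (D v) \<le> L * norm v"
proof (cases "v = 0")
  case True
  then show ?thesis using has_derivative_linear [OF der] by (simp add: linear_0)
next
  case False
  have bl: "bounded_linear D" using der by (rule has_derivative_bounded_linear)
  have "norm (D v) \<le> (L + e) * norm v" if "0 < e" for e
  proof -
    obtain d where d: "0 < d" "\<And>y. norm (y - x) < d \<Longrightarrow> norm (h y - h x - D (y - x)) \<le> e * norm (y - x)"
      using der \<open>0 < e\<close> unfolding has_derivative_at_alt by blast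
    define t where "t = d / (2 * norm v)"
    have t: "0 < t" "norm (t *\<^sub>R v) < d"
      using d(1) False by (auto simp: t_def)
    have "norm (D (t *\<^sub>R v)) \<le> norm (h (x + t *\<^sub>R v) - h x) + norm (h (x + t *\<^sub>R v) - h x - D (t *\<^sub>R v))"
      using norm_triangle_ineq4 [of "h (x + t *\<^sub>R v) - h x" "h (x + t *\<^sub>R v) - h x - D (t *\<^sub>R v)"] by simp
    also have "\<dots> \<le> L * norm (t *\<^sub>R v) + e * norm (t *\<^sub>R v)"
      using lipschitz_on_normD [OF lip, of "x + t *\<^sub>R v" x] d(2) [of "x + t *\<^sub>R v"] t by simp
    finally have "t * norm (D v) \<le> t * ((L + e) * norm v)"
      using t by (simp add: linear_cmul [OF bounded_linear.linear [OF bl]] algebra_simps)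
    then show ?thesis using t by simp
  qed
  note * = this
  have "norm (D v) \<le> L * norm v + e" if "0 < e" for e
    using *[of "e / norm v"] that False by (simp add: algebra_simps)
  then show ?thesis by (rule field_le_epsilon)
qed

text \<open>
  The determinant is \<open>1\<close> at \<open>s = 0\<close>; if it were not positive later, it would vanish in between, and a
  kernel vector \<open>v\<close> would satisfy \<open>v = - r D v\<close>, which the bound on \<open>D\<close> excludes.
\<close>

lemma det_perturbed_identity_pos:
  fixes D :: "real^'n::finite \<Rightarrow> real^'n"
  assumes lin: "linear D" and bound: "\<And>v. norm (D v) \<le> L * norm v" and s: "0 \<le> s" "s * L < 1"
  shows "0 < det (mat 1 + s *\<^sub>R matrix D)"
proof (rule ccontr)
  let ?p = "\<lambda>r. det (mat 1 + r *\<^sub>R matrix D)"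
  assume "\<not> 0 < ?p s"
  moreover have "continuous_on {0..s} ?p"
    unfolding det_pencil by (intro continuous_intros)
  moreover have "?p 0 = 1" by simp
  ultimately obtain r where r: "0 \<le> r" "r \<le> s" "?p r = 0"
    using IVT2' [of ?p s 0 0] s by auto
  define g where "g v = v + r *\<^sub>R D v" for v
  have g: "linear g"
    unfolding g_def by (intro linear_compose_add linear_compose_scale_right lin linear_ident)
  have "matrix g = mat 1 + r *\<^sub>R matrix D"
    by (simp add: matrix_def g_def mat_def vec_eq_iff axis_def)
  then have "\<not> inj g"
    using r det_nz_iff_inj [OF g] by simp
  then obtain v where v: "g v = 0" "v \<noteq> 0"
    using g by (auto simp: linear_injective_0)
  then have "v = - (r *\<^sub>R D v)" by (simp add: g_def add_eq_0_iff2)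
  then have "norm v = r * norm (D v)" using r by (metis abs_of_nonneg norm_minus_cancel norm_scaleR)
  also have "\<dots> \<le> s * norm (D v)" using r by (intro mult_right_mono) auto
  also have "\<dots> \<le> s * (L * norm v)" using s bound by (intro mult_left_mono) auto
  also have "\<dots> < norm v" using s v by simp
  finally show False by simp
qed

text \<open>
  Solving \<open>x + s h x = y\<close> is a fixed point problem for the contraction \<open>x \<mapsto> y - s h x\<close>.
\<close>

lemma bij_perturbed_identity:
  fixes h :: "'a::{real_normed_vector, complete_space} \<Rightarrow> 'a"
  assumes lip: "L-lipschitz_on UNIV h" and s: "0 \<le> s" "s * L < 1"
  shows "bij (\<lambda>x. x + s *\<^sub>R h x)"
proof (rule bijI')
  fix x y
  show "x + s *\<^sub>R h x = y + s *\<^sub>R h y \<longleftrightarrow> x = y"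
  proof
    assume "x + s *\<^sub>R h x = y + s *\<^sub>R h y"
    moreover have "x - y - s *\<^sub>R (h y - h x) = (x + s *\<^sub>R h x) - (y + s *\<^sub>R h y)"
      by (simp add: algebra_simps)
    ultimately have "x - y = s *\<^sub>R (h y - h x)" by simp
    then have "norm (x - y) = s * norm (h x - h y)" using s by (simp add: norm_minus_commute)
    also have "\<dots> \<le> s * (L * norm (x - y))"
      using s lipschitz_on_normD [OF lip, of x y] by (intro mult_left_mono) auto
    finally have "(1 - s * L) * norm (x - y) \<le> 0" by (simp add: algebra_simps)
    then show "x = y" using s by (simp add: mult_le_0_iff)
  qed simp
next
  fix y
  have "\<exists>!x\<in>UNIV. y - s *\<^sub>R h x = x"
  proof (rule Banach_fix [where c = "s * L"])
    show "0 \<le> s * L" using s lipschitz_on_nonneg [OF lip] by simp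
    fix u v :: 'a
    have "dist (y - s *\<^sub>R h u) (y - s *\<^sub>R h v) = s * dist (h u) (h v)"
      using s by (simp add: dist_norm norm_minus_commute flip: scaleR_diff_right)
    also have "\<dots> \<le> s * (L * dist u v)"
      using s lipschitz_onD [OF lip, of u v] by (intro mult_left_mono) auto
    finally show "dist (y - s *\<^sub>R h u) (y - s *\<^sub>R h v) \<le> s * L * dist u v" by (simp add: ac_simps)
  qed (use s in \<open>auto simp: complete_UNIV\<close>)
  then obtain x where "y - s *\<^sub>R h x = x" by blast
  then have "y = x + s *\<^sub>R h x" by (metis diff_add_cancel)
  then show "\<exists>x. y = x + s *\<^sub>R h x" ..
qed

lemma partial_eq:
  assumes "(f has_derivative D) (at y)"
  shows "partial f i y = D (axis i 1)"
  using frechet_derivative_at [OF assms] by (simp add: partial_def)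

lemma matrix_eq_partial:
  assumes "(f has_derivative D) (at y)"
  shows "matrix D = transpose (\<chi> i. partial f i y)"
  using partial_eq [OF assms] by (simp add: matrix_def transpose_def)

text \<open>
  For small \<open>s\<close> the map \<open>x \<mapsto> x + s h x\<close> is a bijection with positive Jacobian, so integrating its
  Jacobian over \<open>B\<close> gives the measure of the image of \<open>B\<close>. The exceptional set \<open>N\<close> has a null image
  because the map is Lipschitz.
\<close>

lemma has_bochner_integral_perturbed_jacobian:
  fixes h :: "real^'n::finite \<Rightarrow> real^'n"
  assumes lip: "L-lipschitz_on UNIV h" and B: "compact B" and N: "negligible N"
    and diff: "\<And>x. x \<in> B - N \<Longrightarrow> h differentiable (at x)"
    and s: "0 \<le> s" "s * L < 1"
  shows "has_bochner_integral lebesgue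
     (\<lambda>x. indicator (B - N) x * det (mat 1 + s *\<^sub>R (\<chi> i. partial h i x)))
     (measure lebesgue ((\<lambda>x. x + s *\<^sub>R h x) ` B))"
proof -
  let ?\<psi> = "\<lambda>x. x + s *\<^sub>R h x"
  define D where "D x = frechet_derivative h (at x)" for x
  have der: "(h has_derivative D x) (at x)" if "x \<in> B - N" for x
    using diff [OF that] by (simp add: D_def frechet_derivative_works)
  have D\<psi>: "(?\<psi> has_derivative (\<lambda>v. v + s *\<^sub>R D x v)) (at x within B - N)" if "x \<in> B - N" for x
    using der [OF that] by (auto intro!: derivative_eq_intros intro: has_derivative_at_withinI)
  have mat: "matrix (\<lambda>v. v + s *\<^sub>R D x v) = transpose (mat 1 + s *\<^sub>R (\<chi> i. partial h i x))" if "x \<in> B - N" for x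
    using partial_eq [OF der [OF that]]
    by (auto simp: matrix_def transpose_def vec_eq_iff mat_def axis_def)
  have meas: "B - N \<in> sets lebesgue"
    using B N by (intro sets.Diff) (auto simp: compact_imp_closed negligible_imp_sets)
  have bij: "bij ?\<psi>" by (rule bij_perturbed_identity [OF lip s])
  have lip\<psi>: "(1 + s * L)-lipschitz_on UNIV ?\<psi>"
    using s by (intro lipschitz_intros lip) auto
  have neg: "negligible (?\<psi> ` (B \<inter> N))"
  proof (rule negligible_locally_Lipschitz_image)
    show "negligible (B \<inter> N)" using N by (rule negligible_subset) auto
    show "\<exists>T C. open T \<and> x \<in> T \<and> (\<forall>y\<in>B \<inter> N \<inter> T. norm (?\<psi> y - ?\<psi> x) \<le> C * norm (y - x))" for x
    proof (intro exI conjI ballI)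
      show "norm (?\<psi> y - ?\<psi> x) \<le> (1 + s * L) * norm (y - x)" for y
        using lipschitz_on_normD [OF lip\<psi>, of y x] by simp
    qed (rule open_UNIV, simp)
  qed simp
  have comp: "compact (?\<psi> ` B)"
    using B lip\<psi> by (intro compact_continuous_image)
      (auto intro: continuous_on_subset lipschitz_on_continuous_on)
  have pos: "0 < det (mat 1 + s *\<^sub>R (\<chi> i. partial h i x))" if "x \<in> B - N" for x
  proof -
    have "0 < det (mat 1 + s *\<^sub>R matrix (D x))"
      using lipschitz_derivative_bound [OF lip der [OF that]] s has_derivative_linear [OF der [OF that]]
      by (intro det_perturbed_identity_pos)
    also have "mat 1 + s *\<^sub>R matrix (D x) = transpose (mat 1 + s *\<^sub>R (\<chi> i. partial h i x))"
      by (simp add: matrix_eq_partial [OF der [OF that]] transpose_def vec_eq_iff mat_def)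
    finally show ?thesis by simp
  qed
  let ?d = "\<lambda>x. \<bar>det (matrix (\<lambda>v. v + s *\<^sub>R D x v))\<bar> * indicator (B - N) x"
  have inj: "inj_on ?\<psi> (B - N)" using bij by (auto simp: bij_def intro: inj_on_subset)
  note * = emeasure_differentiable_image [OF meas D\<psi> inj]
  have "emeasure lebesgue (?\<psi> ` B) = emeasure lebesgue (?\<psi> ` (B - N))"
  proof -
    have "?\<psi> ` B = ?\<psi> ` (B - N) \<union> ?\<psi> ` (B \<inter> N)" by auto
    moreover have "?\<psi> ` (B - N) \<in> sets lebesgue"
      using D\<psi> by (intro differentiable_image_in_sets_lebesgue [OF meas])
        (auto simp: differentiable_on_def differentiable_def)
    ultimately show ?thesis
      using neg by (simp add: emeasure_Un_null_set negligible_iff_null_sets)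
  qed
  then have "integral\<^sup>N lebesgue ?d = emeasure lebesgue (?\<psi> ` B)" using *(2) by simp
  also have "\<dots> = ennreal (measure lebesgue (?\<psi> ` B))"
    using comp by (intro emeasure_eq_measure2 lmeasurable_compact)
  finally have "has_bochner_integral lebesgue ?d (measure lebesgue (?\<psi> ` B))"
    using *(1) by (intro has_bochner_integral_nn_integral) auto
  moreover have "?d = (\<lambda>x. indicator (B - N) x * det (mat 1 + s *\<^sub>R (\<chi> i. partial h i x)))"
  proof
    fix x show "?d x = indicator (B - N) x * det (mat 1 + s *\<^sub>R (\<chi> i. partial h i x))"
    proof (cases "x \<in> B - N")
      case True
      then show ?thesis by (simp only: mat det_transpose pos abs_of_pos mult.commute)
    qed simp
  qed
  ultimately show ?thesis by simp
qed

text \<open>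
  The bijections \<open>x \<mapsto> x + s h0 x\<close> and \<open>x \<mapsto> x + s h1 x\<close> agree outside \<open>B\<close>, hence they map \<open>B\<close> onto the
  same set and their Jacobians have the same integral over \<open>B\<close>. This holds for all small \<open>s\<close>, and the
  coefficient of the highest power of \<open>s\<close> is the difference of the Jacobians of \<open>h1\<close> and \<open>h0\<close>.
\<close>

theorem has_bochner_integral_jacobian_diff:
  fixes h0 h1 :: "real^'n::finite \<Rightarrow> real^'n"
  assumes lip: "L0-lipschitz_on UNIV h0" "L1-lipschitz_on UNIV h1" and B: "compact B" and N: "negligible N"
    and eq: "\<And>x. x \<notin> B \<Longrightarrow> h0 x = h1 x"
    and diff: "\<And>x. x \<in> B - N \<Longrightarrow> h0 differentiable (at x) \<and> h1 differentiable (at x)"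
  shows "has_bochner_integral lebesgue
     (\<lambda>x. indicator (B - N) x * (det (\<chi> i. partial h1 i x) - det (\<chi> i. partial h0 i x))) 0"
proof -
  define L where "L = max L0 L1"
  have lip: "L-lipschitz_on UNIV h0" "L-lipschitz_on UNIV h1"
    using lip by (auto intro: lipschitz_on_mono simp: L_def)
  have L: "0 \<le> L" using lip lipschitz_on_nonneg by blast
  \<comment> \<open>Below this bound both maps are contractive perturbations of the identity; the
    summand 1 covers \<open>L = 0\<close>.\<close>
  define \<delta> where "\<delta> = 1 / (L + 1)"
  have \<delta>: "0 < \<delta>" using L by (simp add: \<delta>_def)
  define a :: "nat \<Rightarrow> real^'n \<Rightarrow> real" where
    "a = (\<lambda>k x. indicator (B - N) x * (det_coeff k (mat 1) (\<chi> i. partial h1 i x) - det_coeff k (mat 1) (\<chi> i. partial h0 i x)))"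
  have "has_bochner_integral lebesgue (a CARD('n)) 0"
  proof (rule has_bochner_integral_coeff_0 [OF \<delta> _ order_refl])
    fix s :: real assume "0 < s" "s < \<delta>"
    then have s: "0 \<le> s" "s * L < 1"
      using L by (auto simp: \<delta>_def field_simps)
    let ?\<psi> = "\<lambda>h x. x + s *\<^sub>R h x"
    have "?\<psi> h0 ` (- B) = ?\<psi> h1 ` (- B)"
      using eq by (intro image_cong) auto
    moreover have "bij (?\<psi> h0)" "bij (?\<psi> h1)"
      using lip s by (auto intro: bij_perturbed_identity)
    ultimately have "?\<psi> h0 ` B = ?\<psi> h1 ` B"
      by (simp add: bij_image_Compl_eq)
    moreover have "has_bochner_integral lebesgue
     (\<lambda>x. indicator (B - N) x * det (mat 1 + s *\<^sub>R (\<chi> i. partial h1 i x))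
        - indicator (B - N) x * det (mat 1 + s *\<^sub>R (\<chi> i. partial h0 i x)))
       (measure lebesgue (?\<psi> h1 ` B) - measure lebesgue (?\<psi> h0 ` B))"
      using diff by (intro has_bochner_integral_diff
        has_bochner_integral_perturbed_jacobian [OF lip(1) B N _ s]
        has_bochner_integral_perturbed_jacobian [OF lip(2) B N _ s]) blast+
    moreover have "(\<Sum>k\<le>CARD('n). s ^ k * a k x) =
      indicator (B - N) x * det (mat 1 + s *\<^sub>R (\<chi> i. partial h1 i x))
        - indicator (B - N) x * det (mat 1 + s *\<^sub>R (\<chi> i. partial h0 i x))" for x
      unfolding det_pencil a_def right_diff_distrib [symmetric] sum_subtractf [symmetric] sum_distrib_left
      by (intro sum.cong refl) (simp only: ac_simps right_diff_distrib)
    ultimately show "has_bochner_integral lebesgue (\<lambda>x. \<Sum>k\<le>CARD('n). s ^ k * a k x) 0"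
      by simp
  qed
  then show ?thesis by (simp add: a_def det_coeff_top)
qed

section \<open>A Stokes identity on a ball\<close>

lemma vec_sum_axis: "(\<Sum>b\<in>UNIV. (v $ b) *\<^sub>R axis b 1) = (v :: real^'m::finite)"
  by (simp add: vec_eq_iff axis_def if_distrib [where f = "\<lambda>x. _ * x"] cong: if_cong)

definition frame :: "real^('n::finite option) \<Rightarrow> ('n \<Rightarrow> real^('n option)) \<Rightarrow> real^('n option)^('n option)" where
  "frame v r = (\<chi> a. case a of None \<Rightarrow> v | Some i \<Rightarrow> r i)"

lemma frame_nth [simp]: "frame v r $ None = v" "frame v r $ Some i = r i"
  by (simp_all add: frame_def)

lemma normal_frame_eq: "normal_frame v f y = frame v (\<lambda>i. partial f i y)"
  by (simp add: normal_frame_def frame_def)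

lemma frame_eqI:
  "R $ None = v \<Longrightarrow> (\<And>i. R $ Some i = r i) \<Longrightarrow> R = frame v r"
  by (simp add: vec_eq_iff frame_def split: option.split)

lemma linear_det_row:
  fixes c :: "'m::finite \<Rightarrow> real^'m"
  shows "linear (\<lambda>x. det (\<chi> a. if a = k then x else c a))"
proof (rule linearI)
  fix x y :: "real^'m" and t :: real
  show "det (\<chi> a. if a = k then x + y else c a) = det (\<chi> a. if a = k then x else c a) + det (\<chi> a. if a = k then y else c a)"
    by (rule det_row_add)
  have "t *\<^sub>R x = t *s x" by (simp add: vec_eq_iff)
  then show "det (\<chi> a. if a = k then t *\<^sub>R x else c a) = t *\<^sub>R det (\<chi> a. if a = k then x else c a)"
    by (simp only: det_row_mul real_scaleR_def)
qed

lemma linear_det_frame: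
  fixes r :: "'n::finite \<Rightarrow> real^('n option)"
  shows "linear (\<lambda>v. det (frame v r))"
proof -
  have "frame v r = (\<chi> a. if a = None then v else frame 0 r $ a)" for v
    by (rule frame_eqI [symmetric]) auto
  then show ?thesis using linear_det_row [of None "\<lambda>a. frame 0 r $ a"] by simp
qed

lemma linear_det_frame_upd:
  fixes r :: "'n::finite \<Rightarrow> real^('n option)"
  shows "linear (\<lambda>x. det (frame v (r(i := x))))"
proof -
  have "frame v (r(i := x)) = (\<chi> a. if a = Some i then x else frame v r $ a)" for x
    by (rule frame_eqI [symmetric]) auto
  then show ?thesis using linear_det_row [of "Some i" "\<lambda>a. frame v r $ a"] by simp
qed

lemma det_frame_swap:
  fixes r :: "'n::finite \<Rightarrow> real^('n option)"
  shows "det (frame v (r(i := w))) = - det (frame w (r(i := v)))"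
proof -
  let ?t = "Transposition.transpose None (Some i)"
  have "frame v (r(i := w)) = (\<chi> a. frame w (r(i := v)) $ ?t a)"
    by (rule frame_eqI [symmetric]) (auto simp: transpose_def)
  moreover have "?t permutes UNIV" by (simp add: permutes_swap_id)
  ultimately show ?thesis
    using det_permute_rows [of ?t "frame w (r(i := v))"] by (simp add: sign_swap_id)
qed

lemma det_coeff_1_frame:
  fixes r s :: "'n::finite \<Rightarrow> real^('n option)"
  shows "det_coeff 1 (frame v r) (frame 0 s) = (\<Sum>i\<in>UNIV. det (frame v (r(i := s i))))"
proof -
  have "det (\<chi> a. if a = None then frame 0 s $ a else frame v r $ a) = 0"
    using linear_0 [OF linear_det_frame [of r]]
    by (rule back_subst [where P = "\<lambda>R. det R = 0"]) (rule frame_eqI [symmetric], auto)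
  moreover have "(\<chi> a. if a = Some i then frame 0 s $ a else frame v r $ a) = frame v (r(i := s i))" for i
    by (rule frame_eqI) auto
  ultimately show ?thesis
    unfolding det_coeff_1 by (simp add: sum_UNIV_option)
qed

text \<open>
  Exchanging column \<open>b\<close> with the first one turns the first row into the first unit vector. The
  remaining block consists of the vectors \<open>r i\<close> without their coordinate \<open>b\<close>.
\<close>

lemma det_frame_axis:
  fixes r :: "'n::finite \<Rightarrow> real^('n option)" and b :: "'n option"
  defines "\<tau> \<equiv> Transposition.transpose None b"
  shows "det (frame (axis b 1) r) = of_int (sign \<tau>) * det (\<chi> i. relabel (\<lambda>j. \<tau> (Some j)) (r i))"
proof -
  let ?A = "frame (axis b 1) r"
  have \<tau>: "\<tau> permutes UNIV" by (simp add: \<tau>_def permutes_swap_id)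
  have "det (\<chi> i j. ?A $ i $ \<tau> j) = det (\<chi> i j. r i $ \<tau> (Some j))"
  proof (subst det_option_block)
    show "(\<chi> i j. ?A $ i $ \<tau> j) $ None = axis None 1"
      by (auto simp: \<tau>_def vec_eq_iff axis_def transpose_eq_iff)
  qed simp
  moreover have "det (\<chi> i j. ?A $ i $ \<tau> j) = of_int (sign \<tau>) * det ?A"
    by (rule det_permute_columns [OF \<tau>])
  ultimately have "of_int (sign \<tau>) * (of_int (sign \<tau>) * det ?A) = of_int (sign \<tau>) * det (\<chi> i j. r i $ \<tau> (Some j))"
    by simp
  then show ?thesis
    by (simp add: relabel_def mult.assoc [symmetric] flip: of_int_mult)
qed

text \<open>
  For a constant first row the determinant is a linear combination of Jacobians of the maps obtained
  by dropping one coordinate, and each of them is determined by its boundary values.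
\<close>

lemma has_bochner_integral_frame_diff:
  fixes h0 h1 :: "real^'n::finite \<Rightarrow> real^('n option)"
  assumes lip: "L0-lipschitz_on UNIV h0" "L1-lipschitz_on UNIV h1" and B: "compact B" and N: "negligible N"
    and eq: "\<And>x. x \<notin> B \<Longrightarrow> h0 x = h1 x"
    and diff: "\<And>x. x \<in> B - N \<Longrightarrow> h0 differentiable (at x) \<and> h1 differentiable (at x)"
  shows "has_bochner_integral lebesgue
     (\<lambda>x. indicator (B - N) x * (det (normal_frame w h1 x) - det (normal_frame w h0 x))) 0"
proof -
  define \<tau> where "\<tau> b = Transposition.transpose None (b :: 'n option)" for b
  define T where "T b = (relabel (\<lambda>j. \<tau> b (Some j)) :: real^('n option) \<Rightarrow> real^'n)" for b
  have bl: "bounded_linear (T b)" for b by (simp add: T_def bounded_linear_relabel)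
  have part: "partial (\<lambda>x. T b (h x)) i x = T b (partial h i x)" if "h differentiable (at x)" for h i x b
  proof -
    have "(h has_derivative frechet_derivative h (at x)) (at x)"
      using that by (simp add: frechet_derivative_works)
    then have "((\<lambda>x. T b (h x)) has_derivative (\<lambda>v. T b (frechet_derivative h (at x) v))) (at x)"
      by (rule bounded_linear.has_derivative [OF bl])
    then show ?thesis by (simp add: partial_eq) (simp add: partial_def)
  qed
  have 1: "has_bochner_integral lebesgue
     (\<lambda>x. indicator (B - N) x * (det (\<chi> i. partial (\<lambda>x. T b (h1 x)) i x) - det (\<chi> i. partial (\<lambda>x. T b (h0 x)) i x))) 0" for b
  proof -
    obtain K where K: "K-lipschitz_on UNIV (T b)"
      using bounded_linear.lipschitz_boundE [OF bl] by blast
    show ?thesis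
    proof (rule has_bochner_integral_jacobian_diff [OF _ _ B N])
      show "(K * L0)-lipschitz_on UNIV (\<lambda>x. T b (h0 x))" "(K * L1)-lipschitz_on UNIV (\<lambda>x. T b (h1 x))"
        using lip K by (auto intro!: lipschitz_on_compose2 [where g = "T b"] intro: lipschitz_on_subset)
      show "(\<lambda>x. T b (h0 x)) differentiable at x \<and> (\<lambda>x. T b (h1 x)) differentiable at x" if "x \<in> B - N" for x
        using diff [OF that] bounded_linear.has_derivative [OF bl] unfolding differentiable_def by blast
    qed (use eq in auto)
  qed
  have 2: "indicator (B - N) x * (det (normal_frame w h1 x) - det (normal_frame w h0 x))
    = (\<Sum>b\<in>UNIV. w $ b * of_int (sign (\<tau> b)) * (indicator (B - N) x * (det (\<chi> i. partial (\<lambda>x. T b (h1 x)) i x) - det (\<chi> i. partial (\<lambda>x. T b (h0 x)) i x))))" for x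
  proof (cases "x \<in> B - N")
    case True
    have "det (frame w r) = (\<Sum>b\<in>UNIV. w $ b * of_int (sign (\<tau> b)) * det (\<chi> i. T b (r i)))" for r
    proof -
      have "det (frame w r) = det (frame (\<Sum>b\<in>UNIV. w $ b *\<^sub>R axis b 1) r)"
        by (simp only: vec_sum_axis)
      also have "\<dots> = (\<Sum>b\<in>UNIV. w $ b * det (frame (axis b 1) r))"
        by (simp add: linear_sum [OF linear_det_frame] linear_cmul [OF linear_det_frame])
      finally show ?thesis by (simp add: det_frame_axis T_def \<tau>_def mult.assoc)
    qed
    then show ?thesis
      using True diff [OF True] by (simp add: normal_frame_eq part right_diff_distrib sum_subtractf)
  qed simp
  have "has_bochner_integral lebesgue (\<lambda>x. \<Sum>b\<in>UNIV. w $ b * of_int (sign (\<tau> b)) * (indicator (B - N) x * (det (\<chi> i. partial (\<lambda>x. T b (h1 x)) i x) - det (\<chi> i. partial (\<lambda>x. T b (h0 x)) i x))))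
     (\<Sum>b\<in>UNIV. w $ b * of_int (sign (\<tau> b)) * 0)"
    by (intro has_bochner_integral_sum has_bochner_integral_mult_right 1)
  then show ?thesis by (simp only: 2) simp
qed

lemma lipschitz_on_scaleR_bounded:
  fixes g :: "'a::metric_space \<Rightarrow> real" and F :: "'a \<Rightarrow> 'b::real_normed_vector"
  assumes g: "K-lipschitz_on S g" and F: "L-lipschitz_on S F"
    and bg: "\<And>x. x \<in> S \<Longrightarrow> \<bar>g x\<bar> \<le> b" and bF: "\<And>x. x \<in> S \<Longrightarrow> norm (F x) \<le> c"
    and bc: "0 \<le> b" "0 \<le> c"
  shows "(b * L + K * c)-lipschitz_on S (\<lambda>x. g x *\<^sub>R F x)"
proof (rule lipschitz_onI)
  fix x y assume xy: "x \<in> S" "y \<in> S"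
  have "g x *\<^sub>R F x - g y *\<^sub>R F y = g x *\<^sub>R (F x - F y) + (g x - g y) *\<^sub>R F y"
    by (simp add: algebra_simps)
  then have "dist (g x *\<^sub>R F x) (g y *\<^sub>R F y) \<le> \<bar>g x\<bar> * dist (F x) (F y) + dist (g x) (g y) * norm (F y)"
    using norm_triangle_ineq [of "g x *\<^sub>R (F x - F y)" "(g x - g y) *\<^sub>R F y"] by (simp add: dist_norm)
  also have "\<dots> \<le> b * (L * dist x y) + (K * dist x y) * c"
    using lipschitz_onD [OF g xy] lipschitz_onD [OF F xy] bg bF xy bc lipschitz_on_nonneg [OF g]
    by (intro add_mono mult_mono) auto
  finally show "dist (g x *\<^sub>R F x) (g y *\<^sub>R F y) \<le> (b * L + K * c) * dist x y"
    by (simp add: algebra_simps)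
qed (use bc lipschitz_on_nonneg [OF g] lipschitz_on_nonneg [OF F] in auto)

lemma det_coeff_1_frame_sum:
  fixes r :: "'n::finite \<Rightarrow> real^('n option)"
  shows "det_coeff 1 (frame v r) (frame 0 (\<lambda>i. \<Sum>b\<in>A. s b i)) = (\<Sum>b\<in>A. det_coeff 1 (frame v r) (frame 0 (s b)))"
  unfolding det_coeff_1_frame by (simp add: linear_sum [OF linear_det_frame_upd] sum.swap [of _ _ A])

text \<open>
  The rows \<open>g r\<^sub>i + c\<^sub>i v\<close> are the partial derivatives of a product of a scalar function and a map,
  with \<open>r\<close> the frame of the map. The first summands reproduce the row that they replace, once for
  each \<open>i\<close>; the second ones are brought to the first row by an exchange.
\<close>

lemma det_coeff_1_frame_product:
  fixes r s :: "'n::finite \<Rightarrow> real^('n option)"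
  shows "det_coeff 1 (frame w r) (frame 0 (\<lambda>i. g *\<^sub>R r i + c i *\<^sub>R v))
    = real CARD('n) * det (frame (g *\<^sub>R w) r) - det_coeff 1 (frame v r) (frame 0 (\<lambda>i. c i *\<^sub>R w))"
proof -
  have "det (frame w (r(i := g *\<^sub>R r i + c i *\<^sub>R v))) = det (frame (g *\<^sub>R w) r) - det (frame v (r(i := c i *\<^sub>R w)))" for i
  proof -
    have "det (frame w (r(i := g *\<^sub>R r i + c i *\<^sub>R v))) = g * det (frame w (r(i := r i))) + c i * det (frame w (r(i := v)))"
      by (simp only: linear_add [OF linear_det_frame_upd] linear_cmul [OF linear_det_frame_upd] real_scaleR_def)
    also have "det (frame w (r(i := v))) = - det (frame v (r(i := w)))"
      by (rule det_frame_swap)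
    finally show ?thesis
      by (simp only: linear_cmul [OF linear_det_frame] linear_cmul [OF linear_det_frame_upd] fun_upd_triv real_scaleR_def)
  qed
  then show ?thesis unfolding det_coeff_1_frame by (simp add: sum_subtractf)
qed

lemma has_frechet_derivative:
  assumes "f differentiable (at y)"
  shows "(f has_derivative frechet_derivative f (at y)) (at y)"
  using assms by (simp add: frechet_derivative_works)

text \<open>
  The variation \<open>F + t g F\<close> keeps the values of \<open>F\<close> outside \<open>B\<close>, so the integral of the determinant
  with constant first row \<open>w\<close> does not depend on \<open>t\<close>. The coefficient of \<open>t\<close> is the Stokes
  identity for \<open>F\<close> and \<open>g w\<close>.
\<close>

lemma has_bochner_integral_frame_scalar:
  fixes F :: "real^'n::finite \<Rightarrow> real^('n option)" and g :: "real^'n \<Rightarrow> real"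
  assumes F: "L-lipschitz_on UNIV F" "bounded (range F)" and g: "K-lipschitz_on UNIV g" "bounded (range g)"
    and B: "compact B" and N: "negligible N"
    and zero: "\<And>x. x \<notin> B \<Longrightarrow> g x = 0"
    and diff: "\<And>x. x \<in> B - N \<Longrightarrow> F differentiable (at x) \<and> g differentiable (at x)"
  shows "has_bochner_integral lebesgue
     (\<lambda>x. indicator (B - N) x * (real CARD('n) * det (normal_frame (g x *\<^sub>R w) F x)
         - det_coeff 1 (normal_frame (F x) F x) (frame 0 (\<lambda>i. partial g i x *\<^sub>R w)))) 0"
proof -
  let ?I = "indicator (B - N) :: real^'n \<Rightarrow> real"
  define u where "u x = g x *\<^sub>R F x" for x
  obtain b c where bc: "\<And>x. norm (g x) \<le> b" "\<And>x. norm (F x) \<le> c"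
    using F(2) g(2) unfolding bounded_iff by auto
  then have bc0: "0 \<le> b" "0 \<le> c" using norm_ge_zero order_trans by blast+
  have u: "(b * L + K * c)-lipschitz_on UNIV u"
    unfolding u_def using bc bc0 by (intro lipschitz_on_scaleR_bounded g F) auto
  have Du: "(u has_derivative (\<lambda>v. g x *\<^sub>R frechet_derivative F (at x) v + frechet_derivative g (at x) v *\<^sub>R F x)) (at x)"
    if "x \<in> B - N" for x
    unfolding u_def using diff [OF that]
    by (intro has_derivative_scaleR has_frechet_derivative) auto
  have part_u: "partial u i x = g x *\<^sub>R partial F i x + partial g i x *\<^sub>R F x" if "x \<in> B - N" for i x
    using partial_eq [OF Du [OF that]] by (simp add: partial_def)
  \<comment> \<open>The coefficient of \<open>t^0\<close> belongs to \<open>F\<close> itself and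
    cancels in the difference.\<close>
  define a where "a k x = (if k = 0 then 0 else ?I x * det_coeff k (normal_frame w F x) (frame 0 (\<lambda>i. partial u i x)))" for k x
  have int: "has_bochner_integral lebesgue (a 1) 0"
  proof (rule has_bochner_integral_coeff_0 [where \<delta> = 1 and d = "CARD('n option)"])
    fix t :: real assume "0 < t"
    define h where "h x = F x + t *\<^sub>R u x" for x
    have h: "(L + t * (b * L + K * c))-lipschitz_on UNIV h"
      unfolding h_def using \<open>0 < t\<close> by (intro lipschitz_intros F u) auto
    have Dh: "(h has_derivative (\<lambda>v. frechet_derivative F (at x) v + t *\<^sub>R frechet_derivative u (at x) v)) (at x)"
      if "x \<in> B - N" for x
    proof -
      have "u differentiable (at x)" using Du [OF that] by (auto simp: differentiable_def)
      then show ?thesis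
        unfolding h_def using diff [OF that]
        by (intro has_derivative_add has_derivative_scaleR_right has_frechet_derivative) auto
    qed
    have part_h: "partial h i x = partial F i x + t *\<^sub>R partial u i x" if "x \<in> B - N" for i x
      using partial_eq [OF Dh [OF that]] by (simp add: partial_def)
    have "has_bochner_integral lebesgue (\<lambda>x. ?I x * (det (normal_frame w h x) - det (normal_frame w F x))) 0"
    proof (rule has_bochner_integral_frame_diff [OF F(1) h B N])
      show "F x = h x" if "x \<notin> B" for x using zero [OF that] by (simp add: h_def u_def)
      show "F differentiable (at x) \<and> h differentiable (at x)" if "x \<in> B - N" for x
        using diff [OF that] Dh [OF that] by (auto simp: differentiable_def)
    qed
    moreover have "?I x * (det (normal_frame w h x) - det (normal_frame w F x)) = (\<Sum>k\<le>CARD('n option). t ^ k * a k x)" for x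
    proof (cases "x \<in> B - N")
      case True
      let ?c = "\<lambda>k. det_coeff k (normal_frame w F x) (frame 0 (\<lambda>i. partial u i x))"
      have "normal_frame w h x = normal_frame w F x + t *\<^sub>R frame 0 (\<lambda>i. partial u i x)"
        unfolding normal_frame_eq by (rule frame_eqI [symmetric]) (auto simp: part_h [OF True])
      then have "det (normal_frame w h x) = (\<Sum>k\<le>CARD('n option). t ^ k * ?c k)"
        by (simp only: det_pencil)
      also have "\<dots> = ?c 0 + (\<Sum>k\<in>{..CARD('n option)} - {0}. t ^ k * ?c k)"
        by (subst sum.remove [where x = 0]) auto
      also have "(\<Sum>k\<in>{..CARD('n option)} - {0}. t ^ k * ?c k) = (\<Sum>k\<in>{..CARD('n option)} - {0}. t ^ k * a k x)"
        using True by (intro sum.cong) (auto simp: a_def)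
      also have "\<dots> = (\<Sum>k\<le>CARD('n option). t ^ k * a k x)"
        by (subst (2) sum.remove [where x = 0]) (auto simp: a_def)
      finally show ?thesis using True by (simp add: det_coeff_0)
    next
      case False
      then have "a k x = 0" for k by (simp add: a_def)
      then show ?thesis using False by simp
    qed
    ultimately show "has_bochner_integral lebesgue (\<lambda>x. \<Sum>k\<le>CARD('n option). t ^ k * a k x) 0" by simp
  qed auto
  have "a 1 x = ?I x * (real CARD('n) * det (normal_frame (g x *\<^sub>R w) F x)
         - det_coeff 1 (normal_frame (F x) F x) (frame 0 (\<lambda>i. partial g i x *\<^sub>R w)))" for x
  proof (cases "x \<in> B - N")
    case True
    then show ?thesis
      by (simp only: a_def part_u normal_frame_eq det_coeff_1_frame_product) simp
  qed (simp add: a_def)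
  then have "a 1 = (\<lambda>x. ?I x * (real CARD('n) * det (normal_frame (g x *\<^sub>R w) F x)
         - det_coeff 1 (normal_frame (F x) F x) (frame 0 (\<lambda>i. partial g i x *\<^sub>R w))))"
    by (rule ext)
  with int show ?thesis by (simp only:)
qed

text \<open>
  This is the integral of the differential of the form \<open>det (F, G, dF, \<dots>, dF)\<close>, for \<open>G\<close> vanishing
  at the boundary of the ball; no derivative of \<open>F\<close> or \<open>G\<close> is differentiated again, so Lipschitz maps
  suffice. It follows from the scalar case for the coordinates of \<open>G\<close>.
\<close>

theorem has_bochner_integral_frame_stokes:
  fixes F G :: "real^'n::finite \<Rightarrow> real^('n option)"
  assumes F: "L-lipschitz_on (cball a R) F" and G: "K-lipschitz_on UNIV G" and R: "0 < R"
    and N: "negligible N"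
    and zero: "\<And>x. x \<notin> ball a R \<Longrightarrow> G x = 0"
    and diff: "\<And>x. x \<in> ball a R - N \<Longrightarrow> F differentiable (at x) \<and> G differentiable (at x)"
  shows "has_bochner_integral lebesgue
     (\<lambda>x. indicator (ball a R - N) x * (real CARD('n) * det (normal_frame (G x) F x)
         - det_coeff 1 (normal_frame (F x) F x) (normal_frame 0 G x))) 0"
proof -
  let ?B = "cball a R" and ?N = "N \<union> sphere a R"
  \<comment> \<open>The retraction onto the closed ball extends \<open>F\<close> to a bounded
    Lipschitz map on the whole space; only on the sphere, a null set, differentiability may be
    lost.\<close>
  define F1 where "F1 = F \<circ> closest_point ?B"
  have ne: "?B \<noteq> {}" using R by auto
  have cp: "1-lipschitz_on UNIV (closest_point ?B)"
    using closest_point_lipschitz [OF convex_cball closed_cball ne] by (auto simp: lipschitz_on_def)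
  have cpB: "range (closest_point ?B) \<subseteq> ?B"
    using closest_point_in_set [OF closed_cball ne] by auto
  have F1: "L-lipschitz_on UNIV F1"
    using lipschitz_on_compose [OF cp, of L F] lipschitz_on_subset [OF F cpB] by (simp add: F1_def)
  have "bounded (F ` ?B)"
    using lipschitz_on_continuous_on [OF F] by (intro compact_imp_bounded compact_continuous_image) auto
  then have bF1: "bounded (range F1)"
    by (rule bounded_subset) (use cpB in \<open>auto simp: F1_def\<close>)
  have F1_eq: "F1 x = F x" if "x \<in> ?B" for x
    using that by (simp add: F1_def closest_point_self)
  have set: "?B - ?N = ball a R - N" by auto
  have DF1: "(F1 has_derivative frechet_derivative F (at x)) (at x)" if "x \<in> ball a R - N" for x
    using diff [OF that] that
    by (intro has_derivative_transform_within_open [OF has_frechet_derivative open_ball, of F x a R])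
      (auto simp: F1_eq)
  have part: "partial F1 i x = partial F i x" if "x \<in> ball a R - N" for i x
    using partial_eq [OF DF1 [OF that]] by (simp add: partial_def)
  let ?e = "\<lambda>b. axis b 1 :: real^('n option)"
  have lipG: "K-lipschitz_on UNIV (\<lambda>x. G x $ b)" for b
  proof (rule lipschitz_onI)
    fix x y
    have "dist (G x $ b) (G y $ b) \<le> dist (G x) (G y)" by (rule dist_vec_nth_le)
    also have "\<dots> \<le> K * dist x y" using lipschitz_onD [OF G] by simp
    finally show "dist (G x $ b) (G y $ b) \<le> K * dist x y" .
  qed (rule lipschitz_on_nonneg [OF G])
  have bG: "bounded (range (\<lambda>x. G x $ b))" for b
  proof (rule bounded_subset)
    show "bounded (insert 0 ((\<lambda>x. G x $ b) ` ?B))"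
      using lipschitz_on_continuous_on [OF lipG]
      by (intro bounded_insert [THEN iffD2] compact_imp_bounded compact_continuous_image)
        (auto intro: continuous_on_subset)
    show "range (\<lambda>x. G x $ b) \<subseteq> insert 0 ((\<lambda>x. G x $ b) ` ?B)"
    proof clarify
      fix x assume "G x $ b \<notin> (\<lambda>x. G x $ b) ` ?B"
      then have "x \<notin> ball a R" by auto
      then show "G x $ b = 0" using zero by simp
    qed
  qed
  have DG: "((\<lambda>x. G x $ b) has_derivative (\<lambda>v. frechet_derivative G (at x) v $ b)) (at x)"
    if "x \<in> ball a R - N" for x b
    using diff [OF that] by (intro bounded_linear.has_derivative [OF bounded_linear_vec_nth] has_frechet_derivative) auto
  have partG: "partial (\<lambda>x. G x $ b) i x = partial G i x $ b" if "x \<in> ball a R - N" for i x b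
    using partial_eq [OF DG [OF that]] by (simp add: partial_def)
  have *: "has_bochner_integral lebesgue
     (\<lambda>x. indicator (?B - ?N) x * (real CARD('n) * det (normal_frame ((G x $ b) *\<^sub>R ?e b) F1 x)
         - det_coeff 1 (normal_frame (F1 x) F1 x) (frame 0 (\<lambda>i. partial (\<lambda>x. G x $ b) i x *\<^sub>R ?e b)))) 0" for b
  proof (rule has_bochner_integral_frame_scalar [OF F1 bF1 lipG bG])
    show "F1 differentiable (at x) \<and> (\<lambda>x. G x $ b) differentiable (at x)" if "x \<in> ?B - ?N" for x
      using DF1 DG that unfolding set differentiable_def by blast
  qed (use zero N negligible_sphere [of a R] in auto)
  have eq: "indicator (ball a R - N) x * (real CARD('n) * det (normal_frame (G x) F x)
         - det_coeff 1 (normal_frame (F x) F x) (normal_frame 0 G x))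
    = (\<Sum>b\<in>UNIV. indicator (?B - ?N) x * (real CARD('n) * det (normal_frame ((G x $ b) *\<^sub>R ?e b) F1 x)
         - det_coeff 1 (normal_frame (F1 x) F1 x) (frame 0 (\<lambda>i. partial (\<lambda>x. G x $ b) i x *\<^sub>R ?e b))))" for x
  proof (cases "x \<in> ball a R - N")
    case True
    have "det (normal_frame (G x) F x) = (\<Sum>b\<in>UNIV. det (normal_frame ((G x $ b) *\<^sub>R ?e b) F x))"
      unfolding normal_frame_eq linear_sum [OF linear_det_frame, symmetric] vec_sum_axis ..
    moreover have "det_coeff 1 (normal_frame (F x) F x) (normal_frame 0 G x) =
       (\<Sum>b\<in>UNIV. det_coeff 1 (normal_frame (F x) F x) (frame 0 (\<lambda>i. (partial G i x $ b) *\<^sub>R ?e b)))"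
      unfolding normal_frame_eq det_coeff_1_frame_sum [symmetric] vec_sum_axis ..
    ultimately show ?thesis
      using True by (simp add: set part partG F1_eq normal_frame_eq sum_subtractf sum_distrib_left)
  qed (simp add: set)
  have "(0::real) = (\<Sum>b\<in>(UNIV :: 'n option set). 0)" by simp
  then show ?thesis
    unfolding eq by (rule ssubst) (intro has_bochner_integral_sum *)
qed

section \<open>Locally Lipschitz maps\<close>

definition loc_lip_on :: "('a::metric_space \<Rightarrow> 'b::metric_space) \<Rightarrow> 'a set \<Rightarrow> bool" where
  "loc_lip_on f S \<longleftrightarrow> (\<forall>x\<in>S. \<exists>e>0. \<exists>L. L-lipschitz_on (S \<inter> ball x e) f)"

lemma loc_lip_onD:
  "loc_lip_on f S \<Longrightarrow> x \<in> S \<Longrightarrow> \<exists>e>0. \<exists>L. L-lipschitz_on (S \<inter> ball x e) f"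
  by (simp add: loc_lip_on_def)

lemma loc_lip_onI:
  assumes "\<And>x. x \<in> S \<Longrightarrow> \<exists>e L. 0 < e \<and> L-lipschitz_on (S \<inter> ball x e) f"
  shows "loc_lip_on f S"
  using assms by (auto simp: loc_lip_on_def)

lemma loc_lip_on_subset:
  assumes "loc_lip_on f S" "T \<subseteq> S"
  shows "loc_lip_on f T"
  unfolding loc_lip_on_def
proof
  fix x assume "x \<in> T"
  then obtain e L where "0 < e" "L-lipschitz_on (S \<inter> ball x e) f"
    using loc_lip_onD [OF assms(1), of x] assms(2) by blast
  then show "\<exists>e>0. \<exists>L. L-lipschitz_on (T \<inter> ball x e) f"
    using assms(2) by (intro exI [of _ e] exI [of _ L]) (auto intro: lipschitz_on_subset)
qed

lemma loc_lip_on_cong: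
  assumes "\<And>x. x \<in> S \<Longrightarrow> f x = g x"
  shows "loc_lip_on f S \<longleftrightarrow> loc_lip_on g S"
proof -
  have "L-lipschitz_on (S \<inter> T) f \<longleftrightarrow> L-lipschitz_on (S \<inter> T) g" for L T
    using assms by (intro lipschitz_on_cong) auto
  then show ?thesis by (simp add: loc_lip_on_def)
qed

lemma loc_lip_on_local:
  assumes "\<And>x. x \<in> S \<Longrightarrow> \<exists>W. open W \<and> x \<in> W \<and> loc_lip_on f (S \<inter> W)"
  shows "loc_lip_on f S"
  unfolding loc_lip_on_def
proof
  fix x assume x: "x \<in> S"
  then obtain W where W: "open W" "x \<in> W" "loc_lip_on f (S \<inter> W)" using assms by blast
  obtain e L where e: "0 < e" "L-lipschitz_on (S \<inter> W \<inter> ball x e) f"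
    using loc_lip_onD [OF W(3), of x] W(2) x by blast
  obtain d where d: "0 < d" "ball x d \<subseteq> W" using W by (meson openE)
  show "\<exists>e>0. \<exists>L. L-lipschitz_on (S \<inter> ball x e) f"
  proof (intro exI conjI)
    show "L-lipschitz_on (S \<inter> ball x (min e d)) f"
      using d by (intro lipschitz_on_subset [OF e(2)]) auto
  qed (use e d in auto)
qed

lemma loc_lip_on_continuous:
  assumes "loc_lip_on f S" shows "continuous_on S f"
  unfolding continuous_on_eq_continuous_within
proof
  fix x assume x: "x \<in> S"
  then obtain e L where e: "0 < e" "L-lipschitz_on (S \<inter> ball x e) f"
    using loc_lip_onD [OF assms x] by blast
  then have "continuous_on (S \<inter> ball x e) f" by (intro lipschitz_on_continuous_on)
  then have "continuous (at x within S \<inter> ball x e) f"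
    using x e(1) by (simp add: continuous_on_eq_continuous_within)
  moreover have "at x within S \<inter> ball x e = at x within S"
    using e(1) by (intro at_within_nhd [of x "ball x e"]) auto
  ultimately show "continuous (at x within S) f" by simp
qed

lemma loc_lip_on_lipschitz: "L-lipschitz_on S f \<Longrightarrow> loc_lip_on f S"
proof (rule loc_lip_onI)
  fix x assume "L-lipschitz_on S f"
  then have "L-lipschitz_on (S \<inter> ball x 1) f" by (rule lipschitz_on_subset) auto
  then show "\<exists>e L. 0 < e \<and> L-lipschitz_on (S \<inter> ball x e) f" using zero_less_one by blast
qed

lemma loc_lip_on_compose:
  assumes f: "loc_lip_on f S" and g: "loc_lip_on g T" and fS: "f ` S \<subseteq> T"
  shows "loc_lip_on (\<lambda>x. g (f x)) S"
  unfolding loc_lip_on_def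
proof
  fix x assume x: "x \<in> S"
  obtain e L where e: "0 < e" "L-lipschitz_on (S \<inter> ball x e) f"
    using loc_lip_onD [OF f x] by blast
  obtain d K where d: "0 < d" "K-lipschitz_on (T \<inter> ball (f x) d) g"
    using loc_lip_onD [OF g, of "f x"] x fS by blast
  obtain r where r: "0 < r" "\<And>y. y \<in> S \<Longrightarrow> dist y x < r \<Longrightarrow> dist (f y) (f x) < d"
    using loc_lip_on_continuous [OF f] x d(1) unfolding continuous_on_iff by blast
  let ?B = "S \<inter> ball x (min e r)"
  have "L-lipschitz_on ?B f" using e(2) by (rule lipschitz_on_subset) auto
  moreover have "f ` ?B \<subseteq> T \<inter> ball (f x) d" using fS r(2) by (auto simp: dist_commute)
  then have "K-lipschitz_on (f ` ?B) g" by (rule lipschitz_on_subset [OF d(2)])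
  ultimately have "(K * L)-lipschitz_on ?B (\<lambda>x. g (f x))" by (rule lipschitz_on_compose2)
  then show "\<exists>e>0. \<exists>L. L-lipschitz_on (S \<inter> ball x e) (\<lambda>x. g (f x))"
    using e(1) r(1) by (metis min_less_iff_conj)
qed

lemma loc_lip_on_add:
  fixes f g :: "'a::metric_space \<Rightarrow> 'b::real_normed_vector"
  assumes f: "loc_lip_on f S" and g: "loc_lip_on g S"
  shows "loc_lip_on (\<lambda>x. f x + g x) S"
  unfolding loc_lip_on_def
proof
  fix x assume x: "x \<in> S"
  obtain e L where e: "0 < e" "L-lipschitz_on (S \<inter> ball x e) f" using loc_lip_onD [OF f x] by blast
  obtain d K where d: "0 < d" "K-lipschitz_on (S \<inter> ball x d) g" using loc_lip_onD [OF g x] by blast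
  have "(L + K)-lipschitz_on (S \<inter> ball x (min e d)) (\<lambda>x. f x + g x)"
  proof (rule lipschitz_on_add)
    show "L-lipschitz_on (S \<inter> ball x (min e d)) f" by (rule lipschitz_on_subset [OF e(2)]) auto
    show "K-lipschitz_on (S \<inter> ball x (min e d)) g" by (rule lipschitz_on_subset [OF d(2)]) auto
  qed
  then show "\<exists>e>0. \<exists>L. L-lipschitz_on (S \<inter> ball x e) (\<lambda>x. f x + g x)"
    using e(1) d(1) by (metis min_less_iff_conj)
qed

lemma loc_lip_on_const: "loc_lip_on (\<lambda>x. c) S"
  by (rule loc_lip_on_lipschitz [OF lipschitz_on_constant])

lemma loc_lip_on_sum:
  fixes f :: "'i \<Rightarrow> 'a::metric_space \<Rightarrow> 'b::real_normed_vector"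
  assumes "\<And>i. i \<in> I \<Longrightarrow> loc_lip_on (f i) S"
  shows "loc_lip_on (\<lambda>x. \<Sum>i\<in>I. f i x) S"
  using assms by (induction I rule: infinite_finite_induct) (auto intro: loc_lip_on_add loc_lip_on_const)

lemma loc_lip_on_boundedE:
  fixes f :: "'a::metric_space \<Rightarrow> 'b::real_normed_vector"
  assumes f: "loc_lip_on f S" and x: "x \<in> S"
  obtains e L where "0 < e" "\<And>d. d \<le> e \<Longrightarrow> L-lipschitz_on (S \<inter> ball x d) f"
    "\<And>y. y \<in> S \<inter> ball x e \<Longrightarrow> norm (f y) \<le> norm (f x) + 1"
proof -
  obtain e L where e: "0 < e" "L-lipschitz_on (S \<inter> ball x e) f" using loc_lip_onD [OF f x] by blast
  obtain r where r: "0 < r" "\<And>y. y \<in> S \<Longrightarrow> dist y x < r \<Longrightarrow> dist (f y) (f x) < 1"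
    using loc_lip_on_continuous [OF f] x unfolding continuous_on_iff by (metis zero_less_one)
  show thesis
  proof (rule that [of "min e r"])
    show "L-lipschitz_on (S \<inter> ball x d) f" if "d \<le> min e r" for d
      using that by (intro lipschitz_on_subset [OF e(2)]) auto
    show "norm (f y) \<le> norm (f x) + 1" if "y \<in> S \<inter> ball x (min e r)" for y
    proof -
      have "norm (f y - f x) < 1" using r(2) [of y] that by (simp add: dist_commute dist_norm norm_minus_commute)
      then show ?thesis using norm_triangle_ineq2 [of "f y" "f x"] by linarith
    qed
  qed (use e r in auto)
qed

lemma loc_lip_on_bilinear:
  fixes f :: "'m::metric_space \<Rightarrow> 'a::real_normed_vector" and g :: "'m \<Rightarrow> 'b::real_normed_vector"
    and h :: "'a \<Rightarrow> 'b \<Rightarrow> 'c::real_normed_vector"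
  assumes h: "bounded_bilinear h" and f: "loc_lip_on f S" and g: "loc_lip_on g S"
  shows "loc_lip_on (\<lambda>x. h (f x) (g x)) S"
  unfolding loc_lip_on_def
proof
  fix x assume x: "x \<in> S"
  obtain e L where e: "0 < e" "\<And>d. d \<le> e \<Longrightarrow> L-lipschitz_on (S \<inter> ball x d) f"
    "\<And>y. y \<in> S \<inter> ball x e \<Longrightarrow> norm (f y) \<le> norm (f x) + 1"
    using loc_lip_on_boundedE [OF f x] by blast
  obtain e' L' where e': "0 < e'" "\<And>d. d \<le> e' \<Longrightarrow> L'-lipschitz_on (S \<inter> ball x d) g"
    "\<And>y. y \<in> S \<inter> ball x e' \<Longrightarrow> norm (g y) \<le> norm (g x) + 1"
    using loc_lip_on_boundedE [OF g x] by blast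
  obtain K where K: "0 \<le> K" "\<And>a b. norm (h a b) \<le> norm a * norm b * K"
    using bounded_bilinear.nonneg_bounded [OF h] by blast
  let ?B = "S \<inter> ball x (min e e')" and ?F = "norm (f x) + 1" and ?G = "norm (g x) + 1"
  have L: "L-lipschitz_on ?B f" "L'-lipschitz_on ?B g" using e(2) e'(2) by auto
  have "(K * (?F * L' + L * ?G))-lipschitz_on ?B (\<lambda>x. h (f x) (g x))"
  proof (rule lipschitz_onI)
    fix y z assume yz: "y \<in> ?B" "z \<in> ?B"
    have "h (f y) (g y) - h (f z) (g z) = h (f y) (g y - g z) + h (f y - f z) (g z)"
      by (simp add: bounded_bilinear.diff_left [OF h] bounded_bilinear.diff_right [OF h])
    then have "dist (h (f y) (g y)) (h (f z) (g z)) \<le> norm (h (f y) (g y - g z)) + norm (h (f y - f z) (g z))"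
      by (simp add: dist_norm norm_triangle_ineq)
    also have "\<dots> \<le> norm (f y) * norm (g y - g z) * K + norm (f y - f z) * norm (g z) * K"
      by (intro add_mono K)
    also have "\<dots> \<le> ?F * (L' * dist y z) * K + (L * dist y z) * ?G * K"
      using e(3) [of y] e'(3) [of z] yz K lipschitz_onD [OF L(1) yz] lipschitz_onD [OF L(2) yz]
        lipschitz_on_nonneg [OF L(1)] lipschitz_on_nonneg [OF L(2)]
      by (intro add_mono mult_mono) (auto simp: dist_norm)
    finally show "dist (h (f y) (g y)) (h (f z) (g z)) \<le> K * (?F * L' + L * ?G) * dist y z"
      by (simp add: algebra_simps)
  qed (use K lipschitz_on_nonneg [OF L(1)] lipschitz_on_nonneg [OF L(2)] in auto)
  then show "\<exists>e>0. \<exists>L. L-lipschitz_on (S \<inter> ball x e) (\<lambda>x. h (f x) (g x))"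
    using e(1) e'(1) by (metis min_less_iff_conj)
qed

lemma loc_lip_on_inverse:
  fixes f :: "'a::metric_space \<Rightarrow> real"
  assumes f: "loc_lip_on f S" and pos: "\<And>x. x \<in> S \<Longrightarrow> 0 < f x"
  shows "loc_lip_on (\<lambda>x. inverse (f x)) S"
proof (rule loc_lip_on_compose [OF f])
  show "loc_lip_on inverse {0::real<..}"
    unfolding loc_lip_on_def
  proof
    fix x :: real assume "x \<in> {0<..}"
    then have x: "0 < x" by simp
    have "(4 / x^2)-lipschitz_on ({0<..} \<inter> ball x (x/2)) inverse"
    proof (rule lipschitz_onI)
      fix y z assume "y \<in> {0<..} \<inter> ball x (x/2)" "z \<in> {0<..} \<inter> ball x (x/2)"
      then have yz: "x / 2 \<le> y" "x / 2 \<le> z" by (auto simp: dist_real_def abs_if split: if_splits)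
      then have "(x/2) * (x/2) \<le> y * z" using x by (intro mult_mono) auto
      then have "1 / (y * z) \<le> 4 / x^2" using x yz by (simp add: field_simps power2_eq_square)
      moreover have "inverse y - inverse z = (z - y) * (1 / (y * z))"
        using x yz by (simp add: field_simps)
      then have "dist (inverse y) (inverse z) = dist y z * (1 / (y * z))"
        using x yz by (simp add: dist_real_def abs_mult abs_minus_commute)
      ultimately show "dist (inverse y) (inverse z) \<le> 4 / x^2 * dist y z"
        by (metis mult.commute mult_left_mono zero_le_dist)
    qed simp
    then show "\<exists>e>0. \<exists>L. L-lipschitz_on ({0<..} \<inter> ball x e) inverse"
      using x by (metis half_gt_zero)
  qed
qed (use pos in auto)

lemma loc_lip_on_compact_imp_lipschitz:
  assumes f: "loc_lip_on f S" and K: "compact K" "K \<subseteq> S"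
  obtains L where "L-lipschitz_on K f"
proof -
  have "local_lipschitz {0::real} K (\<lambda>_. f)"
    unfolding local_lipschitz_def
  proof (intro ballI)
    fix x t assume "x \<in> K"
    then obtain e L where e: "0 < e" "L-lipschitz_on (S \<inter> ball x e) f"
      using loc_lip_onD [OF f, of x] K by blast
    then have "L-lipschitz_on (cball x (e/2) \<inter> K) f"
      using K by (intro lipschitz_on_subset [OF e(2)]) auto
    then show "\<exists>u>0. \<exists>L. \<forall>t\<in>cball t u \<inter> {0}. L-lipschitz_on (cball x u \<inter> K) f"
      using e by (intro exI [of _ "e/2"]) auto
  qed
  then show thesis
    using local_lipschitz_compact_implies_lipschitz [of "{0::real}" K "\<lambda>_. f"] K that by auto
qed

text \<open>
  Along the segment between two nearby points, the closed sets \<open>C i\<close> cut the parameter interval into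
  closed pieces, on each of which \<open>f\<close> is Lipschitz with a common constant. Here continuity across the
  seams of a piecewise immersion becomes a Lipschitz condition.
\<close>

lemma loc_lip_on_closed_cover:
  fixes f :: "'a::euclidean_space \<Rightarrow> 'b::metric_space"
  assumes V: "open V" "V \<subseteq> (\<Union>i\<in>I. C i)" and I: "finite I"
    and C: "\<And>i. i \<in> I \<Longrightarrow> closedin (top_of_set V) (C i)" "\<And>i. i \<in> I \<Longrightarrow> loc_lip_on f (C i)"
  shows "loc_lip_on f V"
  unfolding loc_lip_on_def
proof
  fix x assume x: "x \<in> V"
  have CV: "C i \<subseteq> V" if "i \<in> I" for i using C(1) [OF that] by (meson closedin_imp_subset)
  have "\<exists>e>0. \<exists>L\<ge>0. L-lipschitz_on (C i \<inter> ball x e) f" if i: "i \<in> I" for i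
  proof (cases "x \<in> C i")
    case True
    then obtain e L where e: "0 < e" "L-lipschitz_on (C i \<inter> ball x e) f"
      using loc_lip_onD [OF C(2) [OF i]] by blast
    then show ?thesis using lipschitz_on_nonneg [OF e(2)] by blast
  next
    case False
    have "openin (top_of_set V) (V - C i)" using C(1) [OF that] by (simp add: openin_diff)
    then have "open (V - C i)" using V(1) by (meson openin_open_trans)
    then obtain e where "0 < e" "ball x e \<subseteq> V - C i" using False x by (meson DiffI openE)
    then have "C i \<inter> ball x e = {}" using CV that by blast
    then have "0-lipschitz_on (C i \<inter> ball x e) f" by simp
    then show ?thesis using \<open>0 < e\<close> by blast
  qed
  then obtain e L where eL: "\<And>i. i \<in> I \<Longrightarrow> 0 < e i \<and> 0 \<le> L i \<and> (L i)-lipschitz_on (C i \<inter> ball x (e i)) f"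
    by metis
  obtain r where r: "0 < r" "ball x r \<subseteq> V" using V x by (meson openE)
  define d where "d = Min (insert r (e ` I))"
  have d: "0 < d" "d \<le> r" "\<And>i. i \<in> I \<Longrightarrow> d \<le> e i"
    using r eL I by (auto simp: d_def)
  define K where "K = Max (insert 0 (L ` I))"
  have K: "0 \<le> K" "\<And>i. i \<in> I \<Longrightarrow> L i \<le> K" using I by (auto simp: K_def)
  have "K-lipschitz_on (ball x d) f"
  proof (rule lipschitz_onI)
    fix y z assume yz: "y \<in> ball x d" "z \<in> ball x d"
    define p where "p t = y + t *\<^sub>R (z - y)" for t :: real
    have p_lip: "(norm (z - y))-lipschitz_on T p" for T
      by (rule lipschitz_onI) (auto simp: p_def dist_norm scaleR_left_diff_distrib [symmetric] mult.commute)
    have p_in: "p t \<in> ball x d" if "t \<in> {0..1}" for t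
    proof -
      have "p t = (1 - t) *\<^sub>R y + t *\<^sub>R z" by (simp add: p_def algebra_simps)
      then show ?thesis using convexD [OF convex_ball yz, of "1 - t" t] that by simp
    qed
    have p_V: "p ` {0..1} \<subseteq> V" using p_in d r by force
    define U where "U i = {t \<in> {0..1}. p t \<in> C i}" for i
    have "(K * norm (z - y))-lipschitz_on {0..1} (\<lambda>t. f (p t))"
    proof (rule lipschitz_on_closed_Union [where U = U and I = I])
      fix i assume i: "i \<in> I"
      show "(K * norm (z - y))-lipschitz_on (U i) (\<lambda>t. f (p t))"
      proof (rule lipschitz_on_compose2 [OF p_lip])
        have "p ` U i \<subseteq> C i \<inter> ball x (e i)"
          using p_in d(3) [OF i] by (force simp: U_def)
        then show "K-lipschitz_on (p ` U i) f"
          using eL [OF i] K(2) [OF i] by (meson lipschitz_on_mono)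
      qed
      show "closed (U i)"
      proof -
        have "continuous_on {0..1} p" using p_lip by (rule lipschitz_on_continuous_on)
        moreover have "p \<in> {0..1} \<rightarrow> V" using p_V by auto
        ultimately have "closedin (top_of_set {0..1}) ({0..1} \<inter> p -` C i)"
          using C(1) [OF i] by (intro continuous_closedin_preimage_gen) auto
        moreover have "{0..1} \<inter> p -` C i = U i" by (auto simp: U_def)
        ultimately show ?thesis by (metis closed_atLeastAtMost closedin_closed_trans)
      qed
    next
      show "{0..1} \<subseteq> (\<Union>i\<in>I. U i)" using p_V V(2) by (fastforce simp: U_def)
    qed (use I K in auto)
    from lipschitz_onD [OF this, of 0 1]
    show "dist (f y) (f z) \<le> K * dist y z" by (simp add: p_def dist_norm norm_minus_commute)
  qed (rule K)
  then show "\<exists>e>0. \<exists>L. L-lipschitz_on (V \<inter> ball x e) f"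
    using d(1) by (metis inf_le2 lipschitz_on_subset)
qed

lemma Ck_open_open: "Ck_open k f U \<Longrightarrow> open U"
  by (cases k) auto

lemma Ck_open_SucD:
  assumes "Ck_open (Suc k) f U"
  shows "open U" "\<And>x. x \<in> U \<Longrightarrow> f differentiable (at x)"
    "\<And>v. Ck_open k (\<lambda>x. frechet_derivative f (at x) v) U"
  using assms [unfolded Ck_open.simps] by blast+

lemma Ck_open_continuous:
  assumes "Ck_open k f U"
  shows "continuous_on U f"
proof (cases k)
  case (Suc m)
  then have "f differentiable (at x)" if "x \<in> U" for x
    using Ck_open_SucD(2) assms that by blast
  then show ?thesis
    by (intro continuous_at_imp_continuous_on ballI differentiable_imp_continuous_within)
qed (use assms in simp)

lemma Ck_open_loc_lip:
  fixes f :: "'v::euclidean_space \<Rightarrow> 'w::real_normed_vector"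
  assumes f: "Ck_open (Suc k) f U"
  shows "loc_lip_on f U"
  unfolding loc_lip_on_def
proof
  fix x assume x: "x \<in> U"
  let ?D = "\<lambda>y. frechet_derivative f (at y)"
  have U: "open U" by (rule Ck_open_SucD(1) [OF f])
  then obtain r where r: "0 < r" "cball x r \<subseteq> U" using x open_contains_cball_eq by blast
  have D: "(f has_derivative ?D y) (at y)" if "y \<in> U" for y
    by (rule has_frechet_derivative [OF Ck_open_SucD(2) [OF f that]])
  have "\<exists>c. \<forall>y\<in>cball x r. norm (?D y b) \<le> c" for b
  proof -
    have "Ck_open k (\<lambda>y. ?D y b) U" by (rule Ck_open_SucD(3) [OF f])
    then have "continuous_on (cball x r) (\<lambda>y. ?D y b)"
      using continuous_on_subset [OF Ck_open_continuous] r(2) by blast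
    then have "bounded ((\<lambda>y. ?D y b) ` cball x r)"
      by (intro compact_imp_bounded compact_continuous_image) auto
    then show ?thesis by (auto simp: bounded_iff)
  qed
  then have "\<forall>b. \<exists>c. \<forall>y\<in>cball x r. norm (?D y b) \<le> c" ..
  then obtain c where "\<forall>b. \<forall>y\<in>cball x r. norm (?D y b) \<le> c b" by (rule choice [THEN exE])
  then have c: "\<And>b y. y \<in> cball x r \<Longrightarrow> norm (?D y b) \<le> c b" by blast
  define K where "K = (\<Sum>b\<in>Basis. c b)"
  have c0: "0 \<le> c b" for b using order_trans [OF norm_ge_zero c [of x b]] r(1) by simp
  then have K0: "0 \<le> K" by (simp add: K_def sum_nonneg)
  have bound: "norm (?D y v) \<le> K * norm v" if y: "y \<in> cball x r" for y v
  proof -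
    have lin: "linear (?D y)" using has_derivative_linear [OF D [of y]] y r(2) by blast
    have "?D y (\<Sum>b\<in>Basis. (v \<bullet> b) *\<^sub>R b) = (\<Sum>b\<in>Basis. (v \<bullet> b) *\<^sub>R ?D y b)"
      by (simp only: linear_sum [OF lin] linear_cmul [OF lin])
    then have "?D y v = (\<Sum>b\<in>Basis. (v \<bullet> b) *\<^sub>R ?D y b)"
      by (simp only: euclidean_representation)
    also have "norm \<dots> \<le> (\<Sum>b\<in>Basis. norm v * c b)"
    proof (rule sum_norm_le)
      fix b :: 'v assume "b \<in> Basis"
      then show "norm ((v \<bullet> b) *\<^sub>R ?D y b) \<le> norm v * c b"
        using c [OF y, of b] Basis_le_norm [of b v] by (simp add: mult_mono)
    qed
    finally show ?thesis by (simp add: K_def sum_distrib_left mult.commute)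
  qed
  have "K-lipschitz_on (U \<inter> ball x r) f"
  proof (rule lipschitz_onI)
    fix y z assume "y \<in> U \<inter> ball x r" "z \<in> U \<inter> ball x r"
    then have yz: "y \<in> ball x r" "z \<in> ball x r" by auto
    show "dist (f y) (f z) \<le> K * dist y z"
      unfolding dist_norm
    proof (rule differentiable_bound [OF convex_ball _ _ yz])
      fix w assume w: "w \<in> ball x r"
      then have "w \<in> U" using r(2) by auto
      then show "(f has_derivative ?D w) (at w within ball x r)"
        by (rule has_derivative_at_withinI [OF D])
      show "onorm (?D w) \<le> K"
        using bound w K0 by (intro onorm_le) auto
    qed
  qed (rule K0)
  then show "\<exists>e>0. \<exists>L. L-lipschitz_on (U \<inter> ball x e) f" using r(1) by blast
qed

lemma Ck_on_loc_lip:
  fixes f :: "'v::euclidean_space \<Rightarrow> 'w::real_normed_vector"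
  assumes f: "Ck_on (Suc k) f S"
  shows "loc_lip_on f S"
proof (rule loc_lip_on_local)
  fix x assume "x \<in> S"
  then obtain U g where U: "x \<in> U" "Ck_open (Suc k) g U" "\<forall>y\<in>S \<inter> U. g y = f y"
    using f unfolding Ck_on_def by blast
  then have "loc_lip_on g (S \<inter> U)" using loc_lip_on_subset [OF Ck_open_loc_lip] by blast
  then have "loc_lip_on f (S \<inter> U)" using U by (subst loc_lip_on_cong [of _ f g]) auto
  then show "\<exists>W. open W \<and> x \<in> W \<and> loc_lip_on f (S \<inter> W)" using U Ck_open_open by blast
qed

section \<open>The Cahn-Hoffman map\<close>

definition grad :: "('v::euclidean_space \<Rightarrow> real) \<Rightarrow> 'v \<Rightarrow> 'v" where
  "grad g x = (\<Sum>b\<in>Basis. frechet_derivative g (at x) b *\<^sub>R b)"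

lemma has_derivative_grad:
  assumes "g differentiable (at x)"
  shows "(g has_derivative (\<lambda>v. grad g x \<bullet> v)) (at x)"
proof -
  let ?D = "frechet_derivative g (at x)"
  have D: "(g has_derivative ?D) (at x)" using assms by (rule has_frechet_derivative)
  then have lin: "linear ?D" by (rule has_derivative_linear)
  have "?D v = grad g x \<bullet> v" for v
  proof -
    have "?D (\<Sum>b\<in>Basis. (v \<bullet> b) *\<^sub>R b) = (\<Sum>b\<in>Basis. (v \<bullet> b) *\<^sub>R ?D b)"
      by (simp only: linear_sum [OF lin] linear_cmul [OF lin])
    then have "?D v = (\<Sum>b\<in>Basis. (v \<bullet> b) *\<^sub>R ?D b)"
      by (simp only: euclidean_representation)
    also have "\<dots> = grad g x \<bullet> v"
      unfolding grad_def inner_sum_left by (intro sum.cong) (auto simp: inner_commute mult.commute)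
    finally show ?thesis .
  qed
  then have "?D = (\<lambda>v. grad g x \<bullet> v)" by (rule ext)
  with D show ?thesis by simp
qed

text \<open>
  Two candidates differ by a tangent vector, and a great circle in its direction detects it.
\<close>

lemma sphere_grad_unique:
  fixes w w' :: "'v::euclidean_space"
  assumes x: "x \<in> sphere 0 1"
    and w: "w \<bullet> x = 0" "(\<gamma> has_derivative (\<lambda>v. w \<bullet> v)) (at x within sphere 0 1)"
    and w': "w' \<bullet> x = 0" "(\<gamma> has_derivative (\<lambda>v. w' \<bullet> v)) (at x within sphere 0 1)"
  shows "w = w'"
proof (rule ccontr)
  define d where "d = w - w'"
  assume "w \<noteq> w'"
  then have d: "d \<noteq> 0" "d \<bullet> x = 0" using w w' by (auto simp: d_def inner_diff_left)
  have "((\<lambda>y. \<gamma> y - \<gamma> y) has_derivative (\<lambda>v. w \<bullet> v - w' \<bullet> v)) (at x within sphere 0 1)"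
    by (intro has_derivative_diff w w')
  then have D: "((\<lambda>y. 0) has_derivative (\<lambda>v. d \<bullet> v)) (at x within sphere 0 1)"
    by (simp add: d_def inner_diff_left)
  define u where "u = d /\<^sub>R norm d"
  have u: "u \<bullet> u = 1" "u \<bullet> x = 0" "d \<bullet> u = norm d"
    using d by (auto simp: u_def dot_square_norm power2_eq_square)
  define c where "c t = cos t *\<^sub>R x + sin t *\<^sub>R u" for t :: real
  have "norm (c t) = 1" for t
  proof -
    have "c t \<bullet> c t = (cos t)^2 * (x \<bullet> x) + (sin t)^2 * (u \<bullet> u) + 2 * (cos t * sin t * (u \<bullet> x))"
      by (simp add: c_def inner_simps inner_commute [of x u] power2_eq_square algebra_simps)
    then show ?thesis using u x by (simp add: norm_eq_sqrt_inner)
  qed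
  then have c_sphere: "range c \<subseteq> sphere 0 1" by auto
  have Dc: "(c has_derivative (\<lambda>t. t *\<^sub>R u)) (at 0)"
    unfolding c_def by (auto intro!: derivative_eq_intros)
  have "c 0 = x" by (simp add: c_def)
  then have "((\<lambda>y. 0::real) has_derivative (\<lambda>v. d \<bullet> v)) (at (c 0) within range c)"
    using has_derivative_subset [OF D c_sphere] by simp
  from has_derivative_in_compose [OF Dc this]
  have "((\<lambda>t::real. 0::real) has_derivative (\<lambda>t. d \<bullet> (t *\<^sub>R u))) (at 0)" .
  moreover have "((\<lambda>t::real. 0::real) has_derivative (\<lambda>t. 0)) (at 0)" by simp
  ultimately have "(\<lambda>t::real. d \<bullet> (t *\<^sub>R u)) = (\<lambda>t. 0)" by (rule has_derivative_unique)
  then have "d \<bullet> (1 *\<^sub>R u) = 0" by (rule fun_cong)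
  then show False using u d by simp
qed

text \<open>
  The tangential gradient is the tangential part of the gradient of any extension.
\<close>

lemma sphere_grad_eq:
  fixes \<gamma> g :: "'v::euclidean_space \<Rightarrow> real"
  assumes x: "x \<in> sphere 0 1" and U: "open U" "x \<in> U"
    and g: "g differentiable (at x)" "\<And>y. y \<in> sphere 0 1 \<inter> U \<Longrightarrow> g y = \<gamma> y"
  shows "sphere_grad \<gamma> x = grad g x - (grad g x \<bullet> x) *\<^sub>R x"
proof -
  let ?c = "grad g x \<bullet> x"
  let ?w = "grad g x - ?c *\<^sub>R x"
  have xx: "x \<bullet> x = 1" using x by (simp add: dot_square_norm)
  \<comment> \<open>A function with the prescribed gradient at \<open>x\<close>: the terms added to
    \<open>g\<close> cancel on the sphere, where \<open>(y - x) \<bullet> (y - x) = 2 - 2 (x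
    \<bullet> y)\<close>.\<close>
  define q where "q y = g y - ?c * (x \<bullet> y) - ?c / 2 * ((y - x) \<bullet> (y - x)) + ?c" for y
  have Dq: "(q has_derivative (\<lambda>v. ?w \<bullet> v)) (at x within sphere 0 1)"
    unfolding q_def
    by (rule has_derivative_eq_rhs, (rule derivative_intros has_derivative_at_withinI [OF has_derivative_grad [OF g(1)]])+)
      (simp add: fun_eq_iff inner_diff_left)
  obtain e where e: "0 < e" "ball x e \<subseteq> U" using U by (meson openE)
  have q: "q y = \<gamma> y" if "y \<in> sphere 0 1" "dist y x < e" for y
  proof -
    have "y \<bullet> y = 1" using that by (simp add: dot_square_norm)
    then have *: "(y - x) \<bullet> (y - x) = 2 - 2 * (x \<bullet> y)"
      using xx by (simp add: inner_diff_left inner_diff_right inner_commute)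
    have "q y = g y" unfolding q_def * by (simp add: right_diff_distrib)
    also have "\<dots> = \<gamma> y" using that e by (intro g(2)) (auto simp: dist_commute)
    finally show ?thesis .
  qed
  have w: "(\<gamma> has_derivative (\<lambda>v. ?w \<bullet> v)) (at x within sphere 0 1)"
    by (rule has_derivative_transform_within [OF Dq e(1) x q])
  have "?w \<bullet> x = 0" using xx by (simp add: inner_diff_left)
  then show ?thesis
    unfolding sphere_grad_def using w sphere_grad_unique [OF x] by (intro the_equality) blast+
qed

text \<open>
  The formula of the Cahn-Hoffman map, evaluated off the sphere with an extension \<open>g\<close> of \<open>\<gamma>\<close>; it turns
  derivatives along the sphere into ordinary derivatives.
\<close>

definition grad_extension :: "('v::euclidean_space \<Rightarrow> real) \<Rightarrow> 'v \<Rightarrow> 'v" where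
  "grad_extension g x = grad g x - (grad g x \<bullet> x) *\<^sub>R x + g x *\<^sub>R x"

lemma cahn_hoffman_extension:
  fixes \<gamma> :: "'v::euclidean_space \<Rightarrow> real"
  assumes \<gamma>: "Ck_on 2 \<gamma> (sphere 0 1)" and x: "x \<in> sphere 0 1"
  obtains U g where "open U" "x \<in> U" "loc_lip_on (grad_extension g) U"
    "\<And>y. y \<in> U \<Longrightarrow> grad_extension g differentiable (at y) \<and> g differentiable (at y)"
    "\<And>y. y \<in> sphere 0 1 \<inter> U \<Longrightarrow> cahn_hoffman \<gamma> y = grad_extension g y \<and> \<gamma> y = g y"
proof -
  obtain U g where U: "x \<in> U" "Ck_open (Suc (Suc 0)) g U" "\<And>y. y \<in> sphere 0 1 \<inter> U \<Longrightarrow> g y = \<gamma> y"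
    using \<gamma> x unfolding Ck_on_def by (metis numeral_2_eq_2)
  note g = Ck_open_SucD [OF U(2)]
  have lip_grad: "loc_lip_on (grad g) U"
  proof -
    have "loc_lip_on (\<lambda>y. frechet_derivative g (at y) b *\<^sub>R b) U" for b
      by (intro loc_lip_on_bilinear [OF bounded_bilinear_scaleR] loc_lip_on_const Ck_open_loc_lip [OF g(3)])
    then have "loc_lip_on (\<lambda>y. \<Sum>b\<in>Basis. frechet_derivative g (at y) b *\<^sub>R b) U"
      by (intro loc_lip_on_sum)
    then show ?thesis by (simp add: grad_def [abs_def])
  qed
  have lip_id: "loc_lip_on (\<lambda>y::'v. y) U" by (rule loc_lip_on_lipschitz [OF lipschitz_on_id])
  have lip_neg: "loc_lip_on (\<lambda>y. (- 1) *\<^sub>R ((grad g y \<bullet> y) *\<^sub>R y)) U"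
    by (intro loc_lip_on_bilinear [OF bounded_bilinear_scaleR] loc_lip_on_bilinear [OF bounded_bilinear_inner]
        lip_grad lip_id loc_lip_on_const)
  have "loc_lip_on (\<lambda>y. grad g y + (- 1) *\<^sub>R ((grad g y \<bullet> y) *\<^sub>R y) + g y *\<^sub>R y) U"
    by (intro loc_lip_on_add lip_grad lip_neg loc_lip_on_bilinear [OF bounded_bilinear_scaleR]
        lip_id Ck_open_loc_lip [OF U(2)])
  then have "loc_lip_on (grad_extension g) U" by (simp add: grad_extension_def [abs_def])
  moreover have "grad_extension g differentiable (at y) \<and> g differentiable (at y)" if y: "y \<in> U" for y
  proof -
    have "(\<lambda>y. frechet_derivative g (at y) b) differentiable (at y)" for b
      using Ck_open_SucD(2) [OF g(3) y] .
    then have "grad g differentiable (at y)"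
      unfolding grad_def [abs_def] by (intro differentiable_sum differentiable_scaleR) auto
    then show ?thesis
      unfolding grad_extension_def [abs_def]
      using g(2) [OF y] by (intro conjI differentiable_add differentiable_diff differentiable_scaleR differentiable_inner) auto
  qed
  moreover have "cahn_hoffman \<gamma> y = grad_extension g y \<and> \<gamma> y = g y" if y: "y \<in> sphere 0 1 \<inter> U" for y
  proof -
    have "sphere_grad \<gamma> y = grad g y - (grad g y \<bullet> y) *\<^sub>R y"
      using y g U(3) by (intro sphere_grad_eq [where U = U]) auto
    then show ?thesis using U(3) [OF y] by (simp add: cahn_hoffman_def grad_extension_def)
  qed
  ultimately show thesis using that U(1) g(1) by blast
qed

lemma cahn_hoffman_loc_lip:
  assumes \<gamma>: "Ck_on 2 \<gamma> (sphere 0 1)"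
  shows "loc_lip_on (cahn_hoffman \<gamma>) (sphere 0 1)"
proof (rule loc_lip_on_local)
  fix x :: 'a assume x: "x \<in> sphere 0 1"
  obtain U g where U: "open U" "x \<in> U" "loc_lip_on (grad_extension g) U"
    "\<And>y. y \<in> sphere 0 1 \<inter> U \<Longrightarrow> cahn_hoffman \<gamma> y = grad_extension g y \<and> \<gamma> y = g y"
    using cahn_hoffman_extension [OF \<gamma> x] by metis
  have "loc_lip_on (grad_extension g) (sphere 0 1 \<inter> U)" using U(3) by (rule loc_lip_on_subset) auto
  then have "loc_lip_on (cahn_hoffman \<gamma>) (sphere 0 1 \<inter> U)"
    using U(4) by (subst loc_lip_on_cong [where g = "grad_extension g"]) auto
  then show "\<exists>W. open W \<and> x \<in> W \<and> loc_lip_on (cahn_hoffman \<gamma>) (sphere 0 1 \<inter> W)" using U by blast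
qed

lemma cahn_hoffman_inner:
  assumes \<gamma>: "Ck_on 2 \<gamma> (sphere 0 1)" and x: "x \<in> sphere 0 1"
  shows "cahn_hoffman \<gamma> x \<bullet> x = \<gamma> x"
proof -
  obtain U g where "cahn_hoffman \<gamma> x = grad_extension g x" "\<gamma> x = g x"
    using cahn_hoffman_extension [OF \<gamma> x] x by (metis IntI)
  moreover have "x \<bullet> x = 1" using x by (simp add: dot_square_norm)
  ultimately show ?thesis by (simp add: grad_extension_def inner_diff_left inner_add_left)
qed

text \<open>
  Differentiating \<open>\<xi>(N) \<bullet> N = \<gamma>(N)\<close> gives \<open>d\<xi>(N) \<bullet> N + \<xi>(N) \<bullet> dN = grad \<gamma> \<bullet> dN\<close>. As \<open>dN\<close> is perpendicular to
  \<open>N\<close>, only the tangential part of \<open>\<xi>(N)\<close> contributes to the second term, so this term cancels against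
  the right-hand side.
\<close>

lemma cahn_hoffman_field_derivative:
  fixes N :: "'u::real_normed_vector \<Rightarrow> 'v::euclidean_space"
  assumes \<gamma>: "Ck_on 2 \<gamma> (sphere 0 1)" and V: "open V" "y \<in> V"
    and N: "N differentiable (at y)" "N ` V \<subseteq> sphere 0 1"
  obtains D where "((\<lambda>z. cahn_hoffman \<gamma> (N z)) has_derivative D) (at y)" "\<And>v. D v \<bullet> N y = 0"
proof -
  have Ny: "N y \<in> sphere 0 1" using N V by blast
  obtain U g where U: "open U" "N y \<in> U"
    and diff: "\<And>z. z \<in> U \<Longrightarrow> grad_extension g differentiable (at z) \<and> g differentiable (at z)"
    and eq: "\<And>z. z \<in> sphere 0 1 \<inter> U \<Longrightarrow> cahn_hoffman \<gamma> z = grad_extension g z \<and> \<gamma> z = g z"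
    using cahn_hoffman_extension [OF \<gamma> Ny] by metis
  obtain DN where DN: "(N has_derivative DN) (at y)" using N by (auto simp: differentiable_def)
  obtain E where E: "(grad_extension g has_derivative E) (at (N y))"
    using diff [OF U(2)] by (auto simp: differentiable_def)
  have Dg: "(g has_derivative (\<lambda>v. grad g (N y) \<bullet> v)) (at (N y))"
    using diff [OF U(2)] by (intro has_derivative_grad) blast
  have "\<forall>\<^sub>F z in at y. N z \<in> U"
    using has_derivative_continuous [OF DN] U unfolding continuous_within
    by (rule topological_tendstoD)
  then have "\<forall>\<^sub>F z in nhds y. N z \<in> U" using U by (simp add: eventually_nhds_conv_at)
  then obtain V' where V': "open V'" "y \<in> V'" "\<And>z. z \<in> V' \<Longrightarrow> N z \<in> U"
    unfolding eventually_nhds by blast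
  define W where "W = V \<inter> V'"
  have W: "open W" "y \<in> W" "\<And>z. z \<in> W \<Longrightarrow> N z \<in> sphere 0 1 \<inter> U"
    using V V' N(2) by (auto simp: W_def)
  have D\<Xi>: "((\<lambda>z. grad_extension g (N z)) has_derivative (\<lambda>v. E (DN v))) (at y)"
    by (rule has_derivative_compose [OF DN E])
  have 1: "((\<lambda>z. cahn_hoffman \<gamma> (N z)) has_derivative (\<lambda>v. E (DN v))) (at y)"
    by (rule has_derivative_transform_within_open [OF D\<Xi> W(1,2)]) (use eq W(3) in auto)
  have NN: "N z \<bullet> N z = 1" if "z \<in> W" for z using W(3) [OF that] by (simp add: dot_square_norm)
  have "((\<lambda>z. N z \<bullet> N z) has_derivative (\<lambda>v. N y \<bullet> DN v + DN v \<bullet> N y)) (at y)"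
    by (intro has_derivative_inner DN)
  moreover have "((\<lambda>z. N z \<bullet> N z) has_derivative (\<lambda>v. 0)) (at y)"
    by (rule has_derivative_transform_within_open [OF has_derivative_const [of 1] W(1,2)]) (use NN in auto)
  ultimately have "(\<lambda>v. N y \<bullet> DN v + DN v \<bullet> N y) = (\<lambda>v. 0)" by (rule has_derivative_unique)
  then have perp: "N y \<bullet> DN v = 0" for v by (simp add: fun_eq_iff inner_commute)
  have "((\<lambda>z. grad_extension g (N z) \<bullet> N z - g (N z)) has_derivative
     (\<lambda>v. grad_extension g (N y) \<bullet> DN v + E (DN v) \<bullet> N y - grad g (N y) \<bullet> DN v)) (at y)"
    by (intro has_derivative_inner has_derivative_diff D\<Xi> DN has_derivative_compose [OF DN Dg])
  moreover have "((\<lambda>z. grad_extension g (N z) \<bullet> N z - g (N z)) has_derivative (\<lambda>v. 0)) (at y)"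
    by (rule has_derivative_transform_within_open [OF has_derivative_const [of 0] W(1,2)])
      (use NN in \<open>auto simp: grad_extension_def inner_diff_left inner_add_left\<close>)
  ultimately have "(\<lambda>v. grad_extension g (N y) \<bullet> DN v + E (DN v) \<bullet> N y - grad g (N y) \<bullet> DN v) = (\<lambda>v. 0)"
    by (rule has_derivative_unique)
  then have "grad_extension g (N y) \<bullet> DN v + E (DN v) \<bullet> N y - grad g (N y) \<bullet> DN v = 0" for v
    by (rule fun_cong)
  moreover have "grad_extension g (N y) \<bullet> DN v = grad g (N y) \<bullet> DN v" for v
    using perp by (simp add: grad_extension_def inner_diff_left inner_add_left)
  ultimately have "E (DN v) \<bullet> N y = 0" for v by (metis add_diff_cancel_left')
  with 1 show thesis by (rule that)
qed

section \<open>Eigenvalues and hypersurface frames\<close>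

lemma prod_linear_polys:
  fixes a b :: "'i \<Rightarrow> 'a::comm_ring_1"
  assumes "finite S"
  shows "degree (\<Prod>i\<in>S. [:a i, b i:]) \<le> card S" "coeff (\<Prod>i\<in>S. [:a i, b i:]) (card S) = (\<Prod>i\<in>S. b i)"
proof -
  let ?P = "\<lambda>S. \<Prod>i\<in>S. [:a i, b i:]"
  have "degree (?P S) \<le> card S \<and> coeff (?P S) (card S) = (\<Prod>i\<in>S. b i)"
    using assms
  proof (induction S rule: finite_induct)
    case (insert x S)
    have "degree (?P (insert x S)) \<le> degree [:a x, b x:] + degree (?P S)"
      unfolding prod.insert [OF insert.hyps] by (rule degree_mult_le)
    also have "\<dots> \<le> 1 + card S" using insert.IH by (intro add_mono) (auto simp: degree_pCons_eq_if)
    finally have "degree (?P (insert x S)) \<le> card (insert x S)" using insert.hyps by simp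
    moreover have "coeff (?P S) (Suc (card S)) = 0" using insert.IH by (intro coeff_eq_0) auto
    ultimately show ?case using insert by (simp add: mult_pCons_left)
  qed simp
  then show "degree (?P S) \<le> card S" "coeff (?P S) (card S) = (\<Prod>i\<in>S. b i)" by auto
qed

text \<open>
  The Leibniz formula exhibits the determinant as a polynomial in \<open>z\<close>; only the identity permutation
  contributes to \<open>z^n\<close>, so it is monic of degree \<open>n\<close> and splits over the complex numbers.
\<close>

lemma charpoly_factorization:
  fixes A :: "complex^'n::finite^'n"
  obtains \<kappa> :: "'n \<Rightarrow> complex" where "\<And>z. det (mat z - A) = (\<Prod>l\<in>UNIV. z - \<kappa> l)"
proof -
  let ?n = "CARD('n)"
  let ?e = "\<lambda>i j. [: - (A $ i $ j), if i = j then 1 else 0 :]"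
  let ?\<Pi> = "{p. p permutes (UNIV :: 'n set)}"
  define P where "P = (\<Sum>p\<in>?\<Pi>. smult (of_int (sign p)) (\<Prod>i\<in>UNIV. ?e i (p i)))"
  have poly_P: "poly P z = det (mat z - A)" for z
    unfolding P_def det_def poly_sum poly_smult poly_prod
    by (intro sum.cong refl arg_cong2 [where f = "(*)"] prod.cong) (auto simp: mat_def)
  note pl = prod_linear_polys [OF finite_class.finite_UNIV [where 'a = 'n]]
  have "degree P \<le> ?n"
    unfolding P_def by (intro degree_sum_le) (auto intro!: order_trans [OF degree_smult_le] pl(1) simp del: degree_smult_eq)
  moreover have "coeff P ?n = 1"
  proof -
    have "coeff P ?n = (\<Sum>p\<in>?\<Pi>. of_int (sign p) * (\<Prod>i\<in>UNIV. if i = p i then 1 else 0))"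
      by (simp add: P_def coeff_sum pl(2))
    also have "\<dots> = (\<Sum>p\<in>{id :: 'n \<Rightarrow> 'n}. of_int (sign p) * (\<Prod>i\<in>UNIV. if i = p i then 1 else 0))"
    proof (rule sum.mono_neutral_right)
      show "\<forall>p\<in>?\<Pi> - {id}. of_int (sign p) * (\<Prod>i\<in>UNIV. if i = p i then 1 else 0) = (0::complex)"
      proof
        fix p assume "p \<in> ?\<Pi> - {id}"
        then have "p \<noteq> id" by simp
        then have "\<exists>i. i \<noteq> p i" by (metis eq_id_iff)
        then obtain i where "i \<noteq> p i" ..
        then have "(\<Prod>i\<in>UNIV. if i = p i then 1 else 0) = (0::complex)" by (intro prod_zero) auto
        then show "of_int (sign p) * (\<Prod>i\<in>UNIV. if i = p i then 1 else 0) = (0::complex)" by simp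
      qed
    qed (auto simp: permutes_id)
    finally show ?thesis by simp
  qed
  ultimately have deg: "degree P = ?n" using le_degree [of P ?n] by auto
  then have P: "P \<noteq> 0" "lead_coeff P = 1" using \<open>coeff P ?n = 1\<close> by auto
  obtain M where M: "size M = ?n" "P = smult (lead_coeff P) (\<Prod>x\<in>#M. [:-x, 1:])"
    using alg_closed_imp_factorization [OF P(1)] deg by auto
  obtain xs where xs: "mset xs = M" by (rule ex_mset [THEN exE])
  then have len: "length xs = ?n" using M by (metis size_mset)
  obtain h :: "'n \<Rightarrow> nat" where h: "bij_betw h UNIV {0..<?n}"
    using ex_bij_betw_finite_nat [OF finite_class.finite_UNIV] by blast
  show thesis
  proof (rule that [of "\<lambda>l. xs ! h l"])
    fix z
    have "det (mat z - A) = poly (\<Prod>x\<in>#mset xs. [:-x, 1:]) z"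
      using M(2) P(2) poly_P xs by simp
    also have "\<dots> = (\<Prod>x\<leftarrow>xs. z - x)"
      by (induction xs) (auto simp: left_diff_distrib)
    also have "\<dots> = (\<Prod>i\<in>{0..<?n}. z - xs ! i)"
      by (simp add: prod.list_conv_set_nth len)
    also have "\<dots> = (\<Prod>l\<in>UNIV. z - xs ! h l)"
      using prod.reindex_bij_betw [OF h, of "\<lambda>i. z - xs ! i"] by simp
    finally show "det (mat z - A) = (\<Prod>l\<in>UNIV. z - xs ! h l)" .
  qed
qed

definition elem_sym :: "nat \<Rightarrow> ('n::finite \<Rightarrow> complex) \<Rightarrow> complex" where
  "elem_sym k \<kappa> = (\<Sum>L | card L = k. \<Prod>l\<in>L. \<kappa> l)"

text \<open>
  For \<open>t \<noteq> 0\<close> this is the factorization of the characteristic polynomial at \<open>z = 1 / t\<close>, scaled by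
  \<open>t^n\<close>. The left-hand side is real, so real parts may be taken on the right.
\<close>

lemma det_pencil_elem_sym:
  fixes S :: "real^'n::finite^'n" and \<kappa> :: "'n \<Rightarrow> complex"
  assumes \<kappa>: "\<And>z. det (mat z - (\<chi> i j. complex_of_real (S $ i $ j))) = (\<Prod>l\<in>UNIV. z - \<kappa> l)"
  shows "det (mat 1 - t *\<^sub>R S) = (\<Sum>k\<le>CARD('n). (- t) ^ k * Re (elem_sym k \<kappa>))"
proof -
  let ?n = "CARD('n)" and ?C = "\<chi> i j. complex_of_real (S $ i $ j)"
  let ?w = "complex_of_real t"
  have "complex_of_real (det (mat 1 - t *\<^sub>R S)) = det (mat 1 - (\<chi> i j. ?w * ?C $ i $ j))"
    unfolding det_def of_real_sum of_real_mult of_real_prod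
    by (intro sum.cong refl arg_cong2 [where f = "(*)"] prod.cong) (auto simp: mat_def)
  also have "\<dots> = (\<Prod>l\<in>UNIV. 1 - ?w * \<kappa> l)"
  proof (cases "t = 0")
    case True
    have "mat 1 - (\<chi> i j. 0) = (mat 1 :: complex^'n^'n)" by (simp add: vec_eq_iff)
    then show ?thesis using True by simp
  next
    case False
    have det_scale: "det (\<chi> i. c *s M $ i) = c ^ ?n * det M" for c and M :: "complex^'n^'n"
      by (simp add: det_rows_mul)
    have "mat 1 - (\<chi> i j. ?w * ?C $ i $ j) = (\<chi> i. ?w *s (mat (1 / ?w) - ?C) $ i)"
      using False by (simp add: vec_eq_iff mat_def right_diff_distrib)
    then have "det (mat 1 - (\<chi> i j. ?w * ?C $ i $ j)) = ?w ^ ?n * det (mat (1 / ?w) - ?C)"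
      by (simp only: det_scale)
    also have "\<dots> = (\<Prod>l\<in>UNIV. ?w * (1 / ?w - \<kappa> l))" by (simp add: \<kappa> prod.distrib)
    also have "\<dots> = (\<Prod>l\<in>UNIV. 1 - ?w * \<kappa> l)"
      using False by (intro prod.cong) (auto simp: right_diff_distrib)
    finally show ?thesis .
  qed
  also have "\<dots> = (\<Prod>l\<in>UNIV. (- ?w) * \<kappa> l + 1)" by simp
  also have "\<dots> = (\<Sum>L\<in>UNIV. (\<Prod>l\<in>L. (- ?w) * \<kappa> l) * (\<Prod>l\<in>UNIV - L. 1))"
    by (subst prod_add) auto
  also have "\<dots> = (\<Sum>L\<in>UNIV. (- ?w) ^ card L * (\<Prod>l\<in>L. \<kappa> l))"
    unfolding prod.distrib by simp
  also have "\<dots> = (\<Sum>k\<le>?n. \<Sum>L | card L = k. (- ?w) ^ card L * (\<Prod>l\<in>L. \<kappa> l))"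
    by (subst sum.group [symmetric, where T = "{..?n}" and g = card]) (auto simp: card_mono)
  also have "\<dots> = (\<Sum>k\<le>?n. complex_of_real ((- t) ^ k) * elem_sym k \<kappa>)"
    by (simp add: elem_sym_def sum_distrib_left)
  finally have "Re (complex_of_real (det (mat 1 - t *\<^sub>R S))) = Re (\<Sum>k\<le>?n. complex_of_real ((- t) ^ k) * elem_sym k \<kappa>)"
    by (rule arg_cong)
  then show ?thesis by (simp del: of_real_power of_real_minus)
qed

lemma sum_matrix_axis: "(A ** B) $ i = (\<Sum>j\<in>UNIV. A $ i $ j *\<^sub>R (B :: real^'m::finite^'k::finite) $ j)"
  by (simp add: matrix_matrix_mult_def vec_eq_iff)

definition extend_block :: "real^'n::finite^'n \<Rightarrow> real^('n option)^('n option)" where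
  "extend_block J = (\<chi> a b. case a of None \<Rightarrow> (if b = None then 1 else 0)
     | Some i \<Rightarrow> (case b of None \<Rightarrow> 0 | Some j \<Rightarrow> J $ i $ j))"

lemma det_extend_block: "det (extend_block J) = det J"
  by (subst det_option_block) (simp_all add: extend_block_def vec_eq_iff axis_def)

lemma frame_extend_block:
  "extend_block J ** frame v r = frame v (\<lambda>i. \<Sum>j\<in>UNIV. J $ i $ j *\<^sub>R r j)"
proof (rule frame_eqI)
  show "(extend_block J ** frame v r) $ None = v"
    by (simp add: sum_matrix_axis sum_UNIV_option extend_block_def)
  show "(extend_block J ** frame v r) $ Some i = (\<Sum>j\<in>UNIV. J $ i $ j *\<^sub>R r j)" for i
    by (simp add: sum_matrix_axis sum_UNIV_option extend_block_def)
qed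

text \<open>
  A change of coordinates with Jacobian \<open>J\<close> acts on a frame by a block matrix that fixes the first
  row.
\<close>

lemma det_frame_transform:
  "det (frame v (\<lambda>i. \<Sum>j\<in>UNIV. J $ i $ j *\<^sub>R r j)) = det J * det (frame v r)"
  by (simp add: frame_extend_block [symmetric] det_mul det_extend_block)

lemma det_coeff_1_frame_transform:
  "det_coeff 1 (frame v (\<lambda>i. \<Sum>j\<in>UNIV. J $ i $ j *\<^sub>R r j)) (frame 0 (\<lambda>i. \<Sum>j\<in>UNIV. J $ i $ j *\<^sub>R s j))
    = det J * det_coeff 1 (frame v r) (frame 0 s)"
  unfolding frame_extend_block [symmetric] det_coeff_1_mult det_extend_block ..

text \<open>
  The partial derivatives of a map whose derivative is \<open>D\<close>.
\<close>

definition axis_images :: "(real^'n::finite \<Rightarrow> 'b) \<Rightarrow> 'n \<Rightarrow> 'b" where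
  "axis_images D i = D (axis i 1)"

lemma linear_axis_images:
  fixes D :: "real^'n::finite \<Rightarrow> 'b::real_vector"
  assumes "linear D"
  shows "D v = (\<Sum>j\<in>UNIV. v $ j *\<^sub>R axis_images D j)"
proof -
  have "D (\<Sum>j\<in>UNIV. (v $ j) *\<^sub>R axis j 1) = (\<Sum>j\<in>UNIV. v $ j *\<^sub>R axis_images D j)"
    by (simp add: linear_sum [OF assms] linear_cmul [OF assms] axis_images_def)
  then show ?thesis by (simp only: vec_sum_axis)
qed

definition oriented_normal :: "(real^'n::finite \<Rightarrow> real^('n option)) \<Rightarrow> real^('n option) \<Rightarrow> bool" where
  "oriented_normal D v \<longleftrightarrow> norm v = 1 \<and> (\<forall>i. v \<bullet> axis_images D i = 0) \<and> 0 < det (frame v (axis_images D))"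

lemma inner_linear_eq_0:
  fixes D :: "real^'n::finite \<Rightarrow> 'b::real_inner"
  assumes "linear D" "\<And>i. v \<bullet> axis_images D i = 0"
  shows "v \<bullet> D u = 0"
  using assms by (simp add: linear_axis_images [OF assms(1), of u] inner_sum_right)

text \<open>
  The range of an injective linear map has codimension one, hence a single normal direction.
\<close>

lemma hyperplane_range:
  fixes D :: "real^'n::finite \<Rightarrow> real^('n option)"
  assumes D: "linear D" "inj D"
  obtains a where "norm a = 1" "range D = {w. a \<bullet> w = 0}"
proof -
  have "dim (range D) = CARD('n)" using dim_image_eq [of D UNIV] D by simp
  then have "dim (range D) = DIM(real^('n option)) - 1" by simp
  then obtain a where a: "a \<noteq> 0" "span (range D) = {w. a \<bullet> w = 0}"
    by (rule lowdim_eq_hyperplane)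
  moreover have "span (range D) = range D"
    using D(1) by (simp add: linear_subspace_image span_eq_iff)
  ultimately show thesis
    by (intro that [of "a /\<^sub>R norm a"]) auto
qed

lemma oriented_normal_exists:
  fixes D :: "real^'n::finite \<Rightarrow> real^('n option)"
  assumes D: "linear D" "inj D"
  shows "\<exists>v. oriented_normal D v"
proof -
  obtain a where a: "norm a = 1" "range D = {w. a \<bullet> w = 0}" using hyperplane_range [OF D] .
  let ?d = "det (frame a (axis_images D))"
  have "?d \<noteq> 0"
  proof -
    have "x = 0" if "frame a (axis_images D) *v x = 0" for x
    proof -
      have "frame a (axis_images D) $ b \<bullet> x = 0" for b
        using that by (simp add: matrix_vector_mult_def inner_vec_def vec_eq_iff)
      from this [of None] this [of "Some _"] have x: "a \<bullet> x = 0" "\<And>i. axis_images D i \<bullet> x = 0" by simp_all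
      then obtain u where "x = D u" using a(2) by blast
      then have "x \<bullet> x = 0" using x(2) inner_linear_eq_0 [OF D(1), of x u] by (simp add: inner_commute)
      then show ?thesis by simp
    qed
    then have "\<exists>B. B ** frame a (axis_images D) = mat 1"
      by (simp add: matrix_left_invertible_ker)
    then show ?thesis
      by (simp add: invertible_left_inverse invertible_det_nz [symmetric])
  qed
  moreover have "det (frame (- a) (axis_images D)) = - ?d"
    using linear_neg [OF linear_det_frame] .
  moreover have "a \<bullet> axis_images D i = 0" for i using a(2) by (auto simp: axis_images_def)
  ultimately have "oriented_normal D a \<or> oriented_normal D (- a)"
    using a(1) by (auto simp: oriented_normal_def)
  then show ?thesis by blast
qed

lemma oriented_normal_decompose:
  fixes D :: "real^'n::finite \<Rightarrow> real^('n option)"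
  assumes D: "linear D" "inj D" and v: "oriented_normal D v"
  obtains u where "w = (w \<bullet> v) *\<^sub>R v + D u"
proof -
  obtain a where a: "norm a = 1" "range D = {w. a \<bullet> w = 0}" using hyperplane_range [OF D] .
  have vD: "v \<bullet> D u = 0" for u using v inner_linear_eq_0 [OF D(1)] by (auto simp: oriented_normal_def)
  have aa: "a \<bullet> a = 1" "v \<bullet> v = 1" using a(1) v by (auto simp: oriented_normal_def dot_square_norm)
  have "a \<bullet> (v - (a \<bullet> v) *\<^sub>R a) = 0" using aa by (simp add: inner_diff_right)
  then obtain u where u: "v - (a \<bullet> v) *\<^sub>R a = D u" using a(2) by blast
  have "D u \<bullet> D u = v \<bullet> D u - (a \<bullet> v) * (a \<bullet> D u)"
    by (simp add: u [symmetric] inner_diff_left)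
  moreover have "a \<bullet> D u = 0" using a(2) by blast
  ultimately have "D u = 0" using vD by simp
  then have va: "v = (a \<bullet> v) *\<^sub>R a" using u by simp
  have "(w - (w \<bullet> v) *\<^sub>R v) \<bullet> v = 0" using aa by (simp add: inner_diff_left)
  then have "(a \<bullet> v) * ((w - (w \<bullet> v) *\<^sub>R v) \<bullet> a) = 0"
    by (subst (asm) (3) va) simp
  moreover have "a \<bullet> v \<noteq> 0" using va v by (auto simp: oriented_normal_def)
  ultimately have "a \<bullet> (w - (w \<bullet> v) *\<^sub>R v) = 0" by (simp add: inner_commute)
  then obtain u where "w - (w \<bullet> v) *\<^sub>R v = D u" using a(2) by blast
  then show thesis by (intro that [of u]) (simp add: algebra_simps)
qed

text \<open>
  The tangential part of \<open>w\<close> is a combination of the other rows.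
\<close>

lemma det_frame_inner_normal:
  fixes D :: "real^'n::finite \<Rightarrow> real^('n option)"
  assumes D: "linear D" "inj D" and v: "oriented_normal D v"
  shows "det (frame w (axis_images D)) = (w \<bullet> v) * det (frame v (axis_images D))"
proof -
  obtain u where u: "w = (w \<bullet> v) *\<^sub>R v + D u" using oriented_normal_decompose [OF assms] .
  have "det (frame (axis_images D j) (axis_images D)) = 0" for j
    by (rule det_identical_rows [of None "Some j"]) (simp_all add: row_def vec_eq_iff)
  then have "det (frame (D u) (axis_images D)) = 0"
    by (simp add: linear_axis_images [OF D(1), of u] linear_sum [OF linear_det_frame] linear_cmul [OF linear_det_frame])
  then have "det (frame ((w \<bullet> v) *\<^sub>R v + D u) (axis_images D)) = (w \<bullet> v) * det (frame v (axis_images D))"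
    by (simp add: linear_add [OF linear_det_frame] linear_cmul [OF linear_det_frame])
  then show ?thesis using u by simp
qed

lemma oriented_normal_unique:
  fixes D :: "real^'n::finite \<Rightarrow> real^('n option)"
  assumes D: "linear D" "inj D" and v: "oriented_normal D v" and w: "oriented_normal D w"
  shows "w = v"
proof -
  obtain u where u: "w = (w \<bullet> v) *\<^sub>R v + D u" using oriented_normal_decompose [OF D v] .
  have "v \<bullet> D u = 0" "w \<bullet> D u = 0"
    using v w inner_linear_eq_0 [OF D(1)] by (auto simp: oriented_normal_def)
  moreover have "D u = w - (w \<bullet> v) *\<^sub>R v" using u by (metis add_diff_cancel_left')
  ultimately have "D u \<bullet> D u = 0" by (simp add: inner_diff_left)
  then have wv: "w = (w \<bullet> v) *\<^sub>R v" using u by simp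
  then have "\<bar>w \<bullet> v\<bar> = 1" using v w by (metis mult.right_neutral norm_scaleR oriented_normal_def)
  moreover have "0 < (w \<bullet> v) * det (frame v (axis_images D))"
    using w det_frame_inner_normal [OF D v, of w] by (simp add: oriented_normal_def)
  then have "0 < w \<bullet> v" using v by (simp add: oriented_normal_def zero_less_mult_iff)
  ultimately show ?thesis using wv by simp
qed

text \<open>
  The Gram matrix of the whole frame is the product of the frame with its transpose; as the normal is
  a unit vector perpendicular to the other rows, its block is the Gram matrix of the tangent vectors.
\<close>

lemma gram_det_oriented_normal:
  fixes D :: "real^'n::finite \<Rightarrow> real^('n option)"
  assumes v: "oriented_normal D v"
  shows "sqrt (det (\<chi> i j. axis_images D i \<bullet> axis_images D j)) = det (frame v (axis_images D))"
proof -
  let ?M = "frame v (axis_images D)"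
  have entry: "(?M ** transpose ?M) $ a $ b = ?M $ a \<bullet> ?M $ b" for a b
    by (simp add: matrix_matrix_mult_def transpose_def inner_vec_def)
  have "det (?M ** transpose ?M) = det (\<chi> i j. axis_images D i \<bullet> axis_images D j)"
  proof (subst det_option_block)
    have "v \<bullet> v = 1" using v by (simp add: oriented_normal_def dot_square_norm)
    moreover have "?M $ None \<bullet> ?M $ b = (if b = None then v \<bullet> v else 0)" for b
      using v by (cases b) (auto simp: oriented_normal_def)
    ultimately show "(?M ** transpose ?M) $ None = axis None 1"
      by (simp add: vec_eq_iff entry axis_def del: frame_nth)
  qed (simp add: entry)
  then have "det (\<chi> i j. axis_images D i \<bullet> axis_images D j) = (det ?M)\<^sup>2"
    by (simp add: det_mul power2_eq_square)
  then show ?thesis using v by (simp add: oriented_normal_def)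
qed

text \<open>
  \<open>E\<close> takes values in the hyperplane perpendicular to \<open>v\<close>, which is the range of \<open>D\<close>.
\<close>

lemma shape_operator_exists_unique:
  fixes D E :: "real^'n::finite \<Rightarrow> real^('n option)"
  assumes D: "linear D" "inj D" and v: "oriented_normal D v"
    and E: "linear E" "\<And>u. E u \<bullet> v = 0"
  shows "\<exists>!S :: real^'n^'n. \<forall>u. D (S *v u) = - E u"
proof -
  obtain g where g: "linear g" "\<And>u. g (D u) = u"
    using linear_injective_left_inverse [OF D] by (auto simp: fun_eq_iff)
  have Dg: "D (g (E u)) = E u" for u
  proof -
    obtain u' where "E u = (E u \<bullet> v) *\<^sub>R v + D u'" using oriented_normal_decompose [OF D v] .
    then show ?thesis using E(2) g(2) by simp
  qed
  show ?thesis
  proof (rule ex1I)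
    have "linear (\<lambda>u. - g (E u))"
      using linear_compose [OF E(1) g(1)] by (simp add: linear_compose_neg o_def)
    then have lin: "Vector_Spaces.linear (*s) (*s) (\<lambda>u. - g (E u))"
      by (simp only: linear_matrix_vector_mul_eq)
    show "\<forall>u. D (matrix (\<lambda>u. - g (E u)) *v u) = - E u"
      by (simp add: matrix_works [OF lin] linear_neg [OF D(1)] Dg)
    fix S :: "real^'n^'n" assume S: "\<forall>u. D (S *v u) = - E u"
    have "S *v u = matrix (\<lambda>u. - g (E u)) *v u" for u
    proof -
      have "D (S *v u) = D (matrix (\<lambda>u. - g (E u)) *v u)"
        using S by (simp add: matrix_works [OF lin] linear_neg [OF D(1)] Dg)
      then show ?thesis using D(2) by (simp add: inj_eq)
    qed
    then show "S = matrix (\<lambda>u. - g (E u))" by (simp add: matrix_eq)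
  qed
qed

text \<open>
  The derivative of a parallel map is \<open>D + t E = D \<circ> (1 - t S)\<close>, so the frame is transformed by the
  transpose of \<open>1 - t S\<close>.
\<close>

lemma det_frame_parallel:
  fixes D E :: "real^'n::finite \<Rightarrow> real^('n option)" and S :: "real^'n^'n"
  assumes D: "linear D" and E: "linear E" and S: "\<And>u. D (S *v u) = - E u"
  shows "det (frame w (\<lambda>i. axis_images D i + t *\<^sub>R axis_images E i)) = det (mat 1 - t *\<^sub>R S) * det (frame w (axis_images D))"
proof -
  let ?J = "transpose (mat 1 - t *\<^sub>R S)"
  have "axis_images D i + t *\<^sub>R axis_images E i = (\<Sum>j\<in>UNIV. ?J $ i $ j *\<^sub>R axis_images D j)" for i
  proof -
    have "axis_images D i + t *\<^sub>R axis_images E i = D (axis i 1) - t *\<^sub>R D (S *v axis i 1)"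
      by (simp add: S axis_images_def)
    also have "\<dots> = D (axis i 1 - t *\<^sub>R (S *v axis i 1))"
      by (simp only: linear_diff [OF D] linear_cmul [OF D])
    also have "\<dots> = (\<Sum>j\<in>UNIV. (axis i 1 - t *\<^sub>R (S *v axis i 1)) $ j *\<^sub>R axis_images D j)"
      by (rule linear_axis_images [OF D])
    finally have eq: "axis_images D i + t *\<^sub>R axis_images E i = (\<Sum>j\<in>UNIV. (axis i 1 - t *\<^sub>R (S *v axis i 1)) $ j *\<^sub>R axis_images D j)" .
    have "(axis i 1 - t *\<^sub>R (S *v axis i 1)) $ j = ?J $ i $ j" for j
      by (simp add: transpose_def mat_def axis_def matrix_vector_mult_def if_distrib [where f = "\<lambda>x. _ * x"] cong: if_cong) 
    then show ?thesis by (simp only: eq)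
  qed
  then show ?thesis using det_frame_transform [of w ?J "axis_images D"] by simp
qed

section \<open>Charts and bump functions\<close>

definition unchart :: "('a, 'n::finite) chart \<Rightarrow> real^'n \<Rightarrow> 'a" where
  "unchart c y = inv_into (fst c) (snd c) y"

abbreviation chart_range :: "('a, 'n::finite) chart \<Rightarrow> (real^'n) set" where
  "chart_range c \<equiv> snd c ` fst c"

lemma in_chart_eq: "in_chart c F y = F (unchart c y)"
  by (cases c) (simp add: in_chart_def unchart_def)

context
  fixes M :: "'a::t2_space set" and c :: "('a, 'n::finite) chart"
  assumes c: "is_chart M c"
begin

lemma chart_openin: "openin (top_of_set M) (fst c)"
  and chart_range_open: "open (chart_range c)"
  and chart_homeomorphism: "homeomorphism (fst c) (chart_range c) (snd c) (unchart c)"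
  using c by (cases c; simp add: is_chart_def unchart_def [abs_def])+

lemma chart_subset: "fst c \<subseteq> M"
  using chart_openin openin_imp_subset by blast

lemma unchart_chart: "p \<in> fst c \<Longrightarrow> unchart c (snd c p) = p"
  using chart_homeomorphism by (simp add: homeomorphism_def)

lemma chart_unchart: "y \<in> chart_range c \<Longrightarrow> snd c (unchart c y) = y"
  using homeomorphism_apply2 [OF chart_homeomorphism] by blast

lemma unchart_in: "y \<in> chart_range c \<Longrightarrow> unchart c y \<in> fst c"
  using unchart_chart by auto

lemma in_chart_chart: "p \<in> fst c \<Longrightarrow> in_chart c F (snd c p) = F p"
  by (simp add: in_chart_eq unchart_chart)

lemma chart_image_iff: "W \<subseteq> fst c \<Longrightarrow> y \<in> snd c ` W \<longleftrightarrow> y \<in> chart_range c \<and> unchart c y \<in> W"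
proof -
  assume W: "W \<subseteq> fst c"
  show ?thesis
  proof
    assume "y \<in> snd c ` W"
    then obtain p where "p \<in> W" "y = snd c p" by blast
    then show "y \<in> chart_range c \<and> unchart c y \<in> W" using W unchart_chart by auto
  next
    assume "y \<in> chart_range c \<and> unchart c y \<in> W"
    then show "y \<in> snd c ` W" using chart_unchart by (metis image_eqI)
  qed
qed

lemma chart_image_open:
  assumes "openin (top_of_set M) W"
  shows "open (snd c ` (fst c \<inter> W))"
proof -
  have "openin (top_of_set (fst c)) (fst c \<inter> W)"
    using openin_Int [OF assms chart_openin] by (simp add: Int_commute openin_subset_trans chart_subset)
  then have "openin (top_of_set (chart_range c)) (snd c ` (fst c \<inter> W))"
    by (rule homeomorphism_imp_open_map [OF chart_homeomorphism])
  then show ?thesis using chart_range_open by (rule openin_open_trans)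
qed

lemma chart_image_closed:
  assumes "closedin (top_of_set M) W"
  shows "closedin (top_of_set (chart_range c)) (snd c ` (fst c \<inter> W))"
proof -
  have "openin (top_of_set M) (M - W)" using assms by (simp add: openin_diff)
  then have "open (snd c ` (fst c \<inter> (M - W)))" by (rule chart_image_open)
  moreover have "snd c ` (fst c \<inter> W) = chart_range c - snd c ` (fst c \<inter> (M - W))"
    using chart_subset chart_image_iff [of "fst c \<inter> W"] chart_image_iff [of "fst c \<inter> (M - W)"] unchart_in by blast
  ultimately show ?thesis
    by (metis Diff_eq closedin_closed_Int closed_Compl)
qed

lemma unchart_image_openin:
  assumes "open W" "W \<subseteq> chart_range c"
  shows "openin (top_of_set M) (unchart c ` W)"
proof -
  have "openin (top_of_set (chart_range c)) W" using assms by (simp add: open_subset)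
  then have "openin (top_of_set (fst c)) (unchart c ` W)"
    using homeomorphism_imp_open_map chart_homeomorphism homeomorphism_sym by blast
  then show ?thesis using chart_openin by (rule openin_trans)
qed

lemma unchart_image_compact:
  assumes "compact K" "K \<subseteq> chart_range c"
  shows "compact (unchart c ` K)"
proof (rule compact_continuous_image)
  show "continuous_on K (unchart c)"
    using chart_homeomorphism assms(2) unfolding homeomorphism_def by (meson continuous_on_subset)
qed (rule assms)

end

abbreviation transition :: "('a, 'n::finite) chart \<Rightarrow> ('a, 'n) chart \<Rightarrow> real^'n \<Rightarrow> real^'n" where
  "transition c d \<equiv> in_chart c (snd d)"

text \<open>
  Row \<open>i\<close> is the \<open>i\<close>-th partial derivative, so this is the transpose of the Jacobian matrix; in this
  form it multiplies the rows of frames.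
\<close>

definition transition_matrix :: "('a, 'n::finite) chart \<Rightarrow> ('a, 'n) chart \<Rightarrow> real^'n \<Rightarrow> real^'n^'n" where
  "transition_matrix c d y = (\<chi> i. partial (transition c d) i y)"

context
  fixes M :: "'a::t2_space set" and c d :: "('a, 'n::finite) chart"
  assumes c: "is_chart M c" and d: "is_chart M d" and cd: "smoothly_compatible c d"
begin

lemma transition_domain_iff: "y \<in> transition_domain c d \<longleftrightarrow> y \<in> chart_range c \<and> unchart c y \<in> fst d"
  unfolding transition_domain_def using chart_image_iff [OF c, of "fst c \<inter> fst d"] unchart_in [OF c] by blast

lemma transition_domain_open: "open (transition_domain c d)"
  unfolding transition_domain_def by (rule chart_image_open [OF c chart_openin [OF d]])

lemma transition_Ck: "Ck_open k (transition c d) (transition_domain c d)"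
  using cd by (simp add: smoothly_compatible_def smooth_open_def)

lemma transition_loc_lip: "loc_lip_on (transition c d) (transition_domain c d)"
  by (rule Ck_open_loc_lip [OF transition_Ck])

lemma transition_differentiable: "y \<in> transition_domain c d \<Longrightarrow> transition c d differentiable (at y)"
  using Ck_open_SucD(2) [OF transition_Ck] by blast

lemma unchart_transition:
  "y \<in> transition_domain c d \<Longrightarrow> unchart d (transition c d y) = unchart c y"
  by (simp add: in_chart_eq transition_domain_iff unchart_chart [OF d])

lemma transition_inverse:
  "y \<in> transition_domain c d \<Longrightarrow> transition d c (transition c d y) = y"
  by (simp add: in_chart_eq [of d] unchart_transition) (simp add: transition_domain_iff chart_unchart [OF c])

lemma in_chart_transition:
  "y \<in> transition_domain c d \<Longrightarrow> in_chart c F y = in_chart d F (transition c d y)"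
  unfolding in_chart_eq [of _ F] by (simp only: unchart_transition)

lemma in_chart_has_derivative_transition:
  fixes F :: "'a \<Rightarrow> 'b::real_normed_vector"
  assumes y: "y \<in> transition_domain c d" and F: "(in_chart d F has_derivative D) (at (transition c d y))"
  shows "(in_chart c F has_derivative (\<lambda>v. D (frechet_derivative (transition c d) (at y) v))) (at y)"
proof (rule has_derivative_transform_within_open)
  show "((\<lambda>y. in_chart d F (transition c d y)) has_derivative (\<lambda>v. D (frechet_derivative (transition c d) (at y) v))) (at y)"
    by (rule has_derivative_compose [OF has_frechet_derivative [OF transition_differentiable [OF y]] F])
qed (rule transition_domain_open, rule y, rule in_chart_transition [symmetric])

lemma partial_transition:
  fixes F :: "'a \<Rightarrow> 'b::real_normed_vector"
  assumes y: "y \<in> transition_domain c d" and F: "in_chart d F differentiable (at (transition c d y))"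
  shows "partial (in_chart c F) i y =
    (\<Sum>j\<in>UNIV. transition_matrix c d y $ i $ j *\<^sub>R partial (in_chart d F) j (transition c d y))"
proof -
  let ?D = "frechet_derivative (in_chart d F) (at (transition c d y))"
  have D: "(in_chart d F has_derivative ?D) (at (transition c d y))" using F by (rule has_frechet_derivative)
  have "partial (in_chart c F) i y = ?D (partial (transition c d) i y)"
    using partial_eq [OF in_chart_has_derivative_transition [OF y D]] by (simp add: partial_def)
  also have "\<dots> = (\<Sum>j\<in>UNIV. partial (transition c d) i y $ j *\<^sub>R axis_images ?D j)"
    by (rule linear_axis_images [OF has_derivative_linear [OF D]])
  finally show ?thesis by (simp add: transition_matrix_def partial_def axis_images_def)
qed

lemma det_transition_matrix:
  assumes y: "y \<in> transition_domain c d"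
  shows "det (transition_matrix c d y) = det (matrix (frechet_derivative (transition c d) (at y)))"
  using matrix_eq_partial [OF has_frechet_derivative [OF transition_differentiable [OF y]]]
  by (simp add: transition_matrix_def)

end

text \<open>
  The outer square makes the function differentiable across the sphere, which is all the regularity that
  the partition of unity needs.
\<close>

definition bump :: "'v::real_inner \<Rightarrow> real \<Rightarrow> 'v \<Rightarrow> real" where
  "bump a R y = (max 0 (R\<^sup>2 - (y - a) \<bullet> (y - a)))\<^sup>2"

lemma bump_pos_iff: "0 < R \<Longrightarrow> 0 < bump a R y \<longleftrightarrow> y \<in> ball a R"
proof -
  assume "0 < R"
  have "0 < bump a R y \<longleftrightarrow> (y - a) \<bullet> (y - a) < R\<^sup>2" by (auto simp: bump_def max_def)
  also have "\<dots> \<longleftrightarrow> norm (y - a) < R"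
    using \<open>0 < R\<close> by (metis abs_norm_cancel abs_of_pos dot_square_norm less_imp_le power2_less_imp_less power_strict_mono norm_ge_zero zero_less_numeral)
  finally show ?thesis by (simp add: dist_norm norm_minus_commute)
qed

lemma bump_nonneg: "0 \<le> bump a R y"
  by (simp add: bump_def)

lemma bump_differentiable: "bump a R differentiable (at y)"
proof -
  have sq: "((\<lambda>x::real. (max 0 x)\<^sup>2) has_real_derivative 2 * max 0 x) (at x)" for x
  proof (cases "x = 0")
    case True
    have "((\<lambda>h. ((max 0 (0 + h))\<^sup>2 - (max 0 0)\<^sup>2) / h) \<longlongrightarrow> 0) (at (0::real))"
    proof (rule Lim_null_comparison)
      show "\<forall>\<^sub>F h in at (0::real). norm (((max 0 (0 + h))\<^sup>2 - (max 0 0)\<^sup>2) / h) \<le> \<bar>h\<bar>"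
        by (rule always_eventually) (auto simp: max_def power2_eq_square)
      show "((\<lambda>h. \<bar>h\<bar>) \<longlongrightarrow> 0) (at (0::real))" by (rule tendsto_rabs_zero) (rule tendsto_ident_at)
    qed
    then show ?thesis using True by (simp add: DERIV_def)
  next
    case False
    show ?thesis
    proof (cases "0 < x")
      case True
      have "((\<lambda>x. x\<^sup>2) has_real_derivative 2 * x) (at x)"
        by (auto intro!: derivative_eq_intros)
      then have "((\<lambda>x. (max 0 x)\<^sup>2) has_real_derivative 2 * x) (at x)"
        by (rule has_field_derivative_transform_within_open [of _ _ _ "{0<..}"]) (use True in auto)
      then show ?thesis using True by simp
    next
      case nonpos: False
      have "((\<lambda>x. 0) has_real_derivative 0) (at x)" by simp
      then have "((\<lambda>x. (max 0 x)\<^sup>2) has_real_derivative 0) (at x)"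
        by (rule has_field_derivative_transform_within_open [of _ _ _ "{..<0}"]) (use False nonpos in auto)
      then show ?thesis using nonpos by simp
    qed
  qed
  have "((\<lambda>y. R\<^sup>2 - (y - a) \<bullet> (y - a)) has_derivative (\<lambda>v. - (2 * ((y - a) \<bullet> v)))) (at y)"
    by (auto intro!: derivative_eq_intros simp: inner_commute)
  from has_derivative_compose [OF this sq [THEN has_field_derivative_imp_has_derivative]]
  show ?thesis unfolding bump_def [abs_def] differentiable_def by blast
qed

lemma bump_loc_lip: "loc_lip_on (bump a R) S"
proof -
  have id: "loc_lip_on (\<lambda>y. y - a) S"
    by (rule loc_lip_on_lipschitz [where L = 1]) (simp add: lipschitz_on_def dist_norm)
  have "loc_lip_on (\<lambda>y. R\<^sup>2 + (- 1) *\<^sub>R ((y - a) \<bullet> (y - a))) S"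
    by (intro loc_lip_on_add loc_lip_on_const loc_lip_on_bilinear [OF bounded_bilinear_scaleR]
        loc_lip_on_bilinear [OF bounded_bilinear_inner] id)
  moreover have "loc_lip_on (max (0::real)) UNIV"
    by (rule loc_lip_on_lipschitz [where L = 1]) (auto simp: lipschitz_on_def dist_real_def max_def)
  ultimately have m: "loc_lip_on (\<lambda>y. max 0 (R\<^sup>2 + (- 1) *\<^sub>R ((y - a) \<bullet> (y - a)))) S"
    by (rule loc_lip_on_compose) auto
  have "loc_lip_on (\<lambda>y. max 0 (R\<^sup>2 + (- 1) *\<^sub>R ((y - a) \<bullet> (y - a))) * max 0 (R\<^sup>2 + (- 1) *\<^sub>R ((y - a) \<bullet> (y - a)))) S"
    by (intro loc_lip_on_bilinear [OF bounded_bilinear_mult] m)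
  then show ?thesis by (simp add: bump_def [abs_def] power2_eq_square)
qed

section \<open>Tame maps and the Stokes density\<close>

text \<open>
  In a chart, the coefficient of an exact \<open>n\<close>-form, namely of the differential of
  \<open>det (F, G, dF, \<dots>, dF)\<close> up to a constant factor.
\<close>

definition stokes_density :: "('a, 'n::finite) chart \<Rightarrow> ('a \<Rightarrow> real^('n option)) \<Rightarrow> ('a \<Rightarrow> real^('n option)) \<Rightarrow> 'a \<Rightarrow> real" where
  "stokes_density c F G p = real CARD('n) * det (normal_frame (G p) (in_chart c F) (snd c p))
     - det_coeff 1 (normal_frame (F p) (in_chart c F) (snd c p)) (normal_frame 0 (in_chart c G) (snd c p))"

definition chart_bump :: "('a, 'n::finite) chart \<Rightarrow> real^'n \<Rightarrow> real \<Rightarrow> 'a \<Rightarrow> real" where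
  "chart_bump c a R p = (if p \<in> fst c then bump a R (snd c p) else 0)"

text \<open>
  The closed set \<open>B\<close> contains the points at which differentiability may fail. It is null in every
  chart, and for a piecewise immersion it is the union of the seams.
\<close>

locale charted_space =
  fixes M :: "'a::t2_space set" and \<A> :: "('a, 'n::finite) chart set" and B :: "'a set"
  assumes atlas: "oriented_atlas M \<A>" and compact_M: "compact M"
    and B_closed: "closedin (top_of_set M) B"
    and B_null: "\<And>c. c \<in> \<A> \<Longrightarrow> negligible (snd c ` (fst c \<inter> B))"
begin

lemma chartD: "c \<in> \<A> \<Longrightarrow> is_chart M c"
  using atlas by (simp add: oriented_atlas_def)

lemma compatD: "c \<in> \<A> \<Longrightarrow> d \<in> \<A> \<Longrightarrow> smoothly_compatible c d"
  using atlas by (simp add: oriented_atlas_def)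

lemma charts_cover: "p \<in> M \<Longrightarrow> \<exists>c\<in>\<A>. p \<in> fst c"
  using atlas by (auto simp: oriented_atlas_def)

lemma chart_sub: "c \<in> \<A> \<Longrightarrow> fst c \<subseteq> M"
  using chart_subset [OF chartD] .

lemma det_transition_pos:
  assumes "c \<in> \<A>" "d \<in> \<A>" "y \<in> transition_domain c d"
  shows "0 < det (transition_matrix c d y)"
  using atlas assms det_transition_matrix [OF chartD [OF assms(1)] chartD [OF assms(2)] compatD [OF assms(1,2)] assms(3)]
  by (simp add: oriented_atlas_def)

lemma in_transition_domain: "p \<in> fst c \<Longrightarrow> p \<in> fst d \<Longrightarrow> snd c p \<in> transition_domain c d"
  by (simp add: transition_domain_def)

lemma transition_chart: "c \<in> \<A> \<Longrightarrow> p \<in> fst c \<Longrightarrow> transition c d (snd c p) = snd d p"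
  by (rule in_chart_chart [OF chartD])

text \<open>
  A regularity class that contains the continuous maps that are piecewise \<open>C^1\<close> with seams in \<open>B\<close>.
  Integration by parts produces no boundary terms along \<open>B\<close>, since the Lipschitz condition holds
  across it.
\<close>

definition tame :: "('a \<Rightarrow> 'b::real_normed_vector) \<Rightarrow> bool" where
  "tame F \<longleftrightarrow> (\<forall>c\<in>\<A>. loc_lip_on (in_chart c F) (chart_range c) \<and>
     (\<forall>p\<in>fst c - B. in_chart c F differentiable (at (snd c p))))"

lemma tameD:
  assumes "tame F" "c \<in> \<A>"
  shows "loc_lip_on (in_chart c F) (chart_range c)"
    "\<And>p. p \<in> fst c \<Longrightarrow> p \<notin> B \<Longrightarrow> in_chart c F differentiable (at (snd c p))"
  using assms by (auto simp: tame_def)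

lemma tame_local:
  assumes "\<And>c y. c \<in> \<A> \<Longrightarrow> y \<in> chart_range c \<Longrightarrow>
    \<exists>W g. open W \<and> y \<in> W \<and> loc_lip_on g W \<and> (unchart c y \<notin> B \<longrightarrow> g differentiable (at y)) \<and>
      (\<forall>z\<in>W \<inter> chart_range c. in_chart c F z = g z)"
  shows "tame F"
  unfolding tame_def
proof (intro ballI conjI)
  fix c assume c: "c \<in> \<A>"
  show "loc_lip_on (in_chart c F) (chart_range c)"
  proof (rule loc_lip_on_local)
    fix y assume "y \<in> chart_range c"
    then obtain W g where W: "open W" "y \<in> W" "loc_lip_on g W" "\<forall>z\<in>W \<inter> chart_range c. in_chart c F z = g z"
      using assms [OF c] by blast
    have "loc_lip_on g (chart_range c \<inter> W)" using W(3) by (rule loc_lip_on_subset) auto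
    then have "loc_lip_on (in_chart c F) (chart_range c \<inter> W)"
      using W(4) by (subst loc_lip_on_cong [where g = g]) auto
    then show "\<exists>W. open W \<and> y \<in> W \<and> loc_lip_on (in_chart c F) (chart_range c \<inter> W)" using W by blast
  qed
  fix p assume p: "p \<in> fst c - B"
  then have y: "snd c p \<in> chart_range c" "unchart c (snd c p) \<notin> B"
    using unchart_chart [OF chartD [OF c]] by auto
  then obtain W g where W: "open W" "snd c p \<in> W" "g differentiable (at (snd c p))"
    "\<And>z. z \<in> W \<inter> chart_range c \<Longrightarrow> in_chart c F z = g z"
    using assms [OF c y(1)] by blast
  obtain D where "(g has_derivative D) (at (snd c p))" using W(3) by (auto simp: differentiable_def)
  then have "(in_chart c F has_derivative D) (at (snd c p))"
  proof (rule has_derivative_transform_within_open)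
    show "open (W \<inter> chart_range c)" using W(1) chart_range_open [OF chartD [OF c]] by blast
  qed (use W y in auto)
  then show "in_chart c F differentiable (at (snd c p))" by (auto simp: differentiable_def)
qed

lemma tame_const: "tame (\<lambda>p. k)"
  unfolding tame_def by (simp add: in_chart_eq [abs_def] loc_lip_on_const)

lemma tame_add: "tame F \<Longrightarrow> tame G \<Longrightarrow> tame (\<lambda>p. F p + G p)"
  unfolding tame_def in_chart_eq [abs_def] by (auto intro!: loc_lip_on_add differentiable_add)

lemma tame_sum: "(\<And>i. i \<in> I \<Longrightarrow> tame (F i)) \<Longrightarrow> tame (\<lambda>p. \<Sum>i\<in>I. F i p)"
  by (induction I rule: infinite_finite_induct) (auto intro: tame_add tame_const)

lemma tame_scaleR: "tame f \<Longrightarrow> tame F \<Longrightarrow> tame (\<lambda>p. f p *\<^sub>R F p)"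
  unfolding tame_def in_chart_eq [abs_def]
  by (auto intro!: loc_lip_on_bilinear [OF bounded_bilinear_scaleR] differentiable_scaleR)

lemma tame_inverse:
  fixes f :: "'a \<Rightarrow> real"
  assumes f: "tame f" and pos: "\<And>p. p \<in> M \<Longrightarrow> 0 < f p"
  shows "tame (\<lambda>p. inverse (f p))"
  unfolding tame_def
proof (intro ballI conjI)
  fix c assume c: "c \<in> \<A>"
  have pos': "0 < in_chart c f y" if "y \<in> chart_range c" for y
    using pos chart_sub [OF c] unchart_in [OF chartD [OF c] that] by (auto simp: in_chart_eq)
  have eq: "in_chart c (\<lambda>p. inverse (f p)) = (\<lambda>y. inverse (in_chart c f y))"
    by (simp add: in_chart_eq [abs_def])
  show "loc_lip_on (in_chart c (\<lambda>p. inverse (f p))) (chart_range c)"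
    unfolding eq by (rule loc_lip_on_inverse [OF tameD(1) [OF f c] pos'])
  fix p assume p: "p \<in> fst c - B"
  then have "in_chart c f (snd c p) \<noteq> 0" using pos' [of "snd c p"] by auto
  then show "in_chart c (\<lambda>p. inverse (f p)) differentiable (at (snd c p))"
    unfolding eq using p by (intro differentiable_inverse tameD(2) [OF f c]) auto
qed

context
  fixes c a R
  assumes c: "c \<in> \<A>" and R: "0 < R" and cball: "cball a R \<subseteq> chart_range c"
begin

lemma chart_bump_nonneg: "0 \<le> chart_bump c a R p"
  by (simp add: chart_bump_def bump_nonneg)

lemma chart_bump_pos_iff: "0 < chart_bump c a R p \<longleftrightarrow> p \<in> unchart c ` ball a R"
proof
  assume "0 < chart_bump c a R p"
  then have "p \<in> fst c" "snd c p \<in> ball a R"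
    using bump_pos_iff [OF R] by (auto simp: chart_bump_def split: if_splits)
  then show "p \<in> unchart c ` ball a R" using unchart_chart [OF chartD [OF c]] by (metis image_eqI)
next
  assume "p \<in> unchart c ` ball a R"
  then obtain y where y: "y \<in> ball a R" "p = unchart c y" by blast
  then have "y \<in> chart_range c" using cball ball_subset_cball by blast
  moreover have "0 < bump a R y" using y(1) bump_pos_iff [OF R] by blast
  ultimately show "0 < chart_bump c a R p"
    using y unchart_in [OF chartD [OF c]] chart_unchart [OF chartD [OF c]]
    by (simp add: chart_bump_def)
qed

lemma chart_bump_eq_0: "p \<notin> unchart c ` ball a R \<Longrightarrow> chart_bump c a R p = 0"
  using chart_bump_pos_iff [of p] chart_bump_nonneg [of p] by linarith

lemma compact_support_complement: "openin (top_of_set M) (M - unchart c ` cball a R)"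
proof -
  have "compact (unchart c ` cball a R)"
    by (rule unchart_image_compact [OF chartD [OF c] compact_cball cball])
  then show ?thesis
    by (simp add: compact_imp_closed Diff_eq openin_open_Int open_Compl)
qed

text \<open>
  Away from the domain of its chart the bump vanishes on an open set, since the closed ball has a
  compact, hence closed, image in \<open>M\<close>.
\<close>

lemma chart_bump_tame: "tame (chart_bump c a R)"
proof (rule tame_local)
  fix d y assume d: "d \<in> \<A>" and y: "y \<in> chart_range d"
  note c' = chartD [OF c] and d' = chartD [OF d] and dc = compatD [OF d c]
  show "\<exists>W g. open W \<and> y \<in> W \<and> loc_lip_on g W \<and> (unchart d y \<notin> B \<longrightarrow> g differentiable (at y)) \<and>
      (\<forall>z\<in>W \<inter> chart_range d. in_chart d (chart_bump c a R) z = g z)"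
  proof (cases "unchart d y \<in> fst c")
    case True
    let ?W = "transition_domain d c" and ?g = "\<lambda>z. bump a R (transition d c z)"
    have yW: "y \<in> ?W" using True y transition_domain_iff [OF d' c' dc] by blast
    moreover have "loc_lip_on ?g ?W"
      by (rule loc_lip_on_compose [OF transition_loc_lip [OF d' c' dc] bump_loc_lip subset_UNIV])
    moreover have "?g differentiable (at y)"
      by (rule differentiable_compose [OF bump_differentiable transition_differentiable [OF d' c' dc yW]])
    moreover have "in_chart d (chart_bump c a R) z = ?g z" if "z \<in> ?W" for z
      using that by (simp add: in_chart_eq chart_bump_def transition_domain_iff [OF d' c' dc])
    ultimately show ?thesis using transition_domain_open [OF d' c' dc] by blast
  next
    case False
    let ?K = "unchart c ` cball a R"
    let ?W = "snd d ` (fst d \<inter> (M - ?K))"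
    have "?K \<subseteq> fst c" using unchart_in [OF c'] cball by blast
    then have "unchart d y \<in> fst d \<inter> (M - ?K)"
      using False unchart_in [OF d' y] chart_sub [OF d] by blast
    then have "y \<in> ?W" using chart_unchart [OF d' y] by (metis image_eqI)
    moreover have "open ?W" by (rule chart_image_open [OF d' compact_support_complement])
    moreover have "in_chart d (chart_bump c a R) z = 0" if "z \<in> ?W" for z
    proof -
      have "unchart d z \<notin> ?K" using that unchart_chart [OF d'] by auto
      then have "unchart d z \<notin> unchart c ` ball a R" using ball_subset_cball by blast
      then show ?thesis by (simp add: in_chart_eq chart_bump_eq_0)
    qed
    ultimately show ?thesis
      by (intro exI [of _ ?W] exI [of _ "\<lambda>_. 0"]) (auto simp: loc_lip_on_const)
  qed
qed

end

text \<open>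
  The doubled balls leave room around the supports of the bumps that are placed on the balls.
\<close>

lemma finite_ball_cover:
  obtains I :: "(('a, 'n) chart \<times> (real^'n) \<times> real) set" where "finite I"
    "\<forall>c a R. (c, a, R) \<in> I \<longrightarrow> c \<in> \<A> \<and> 0 < R \<and> cball a (2 * R) \<subseteq> chart_range c"
    "M \<subseteq> (\<Union>(c, a, R)\<in>I. unchart c ` ball a R)"
proof -
  let ?good = "{(c, a, R). c \<in> \<A> \<and> 0 < R \<and> cball a (2 * R) \<subseteq> chart_range c}"
  let ?f = "\<lambda>(c, a, R). unchart c ` ball a R"
  have "\<exists>D\<subseteq>?f ` ?good. finite D \<and> M \<subseteq> \<Union>D"
  proof (rule compact_eq_openin_cover [THEN iffD1, OF compact_M, rule_format], intro conjI ballI)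
    fix W assume "W \<in> ?f ` ?good"
    then obtain c a R where c: "c \<in> \<A>" "0 < R" "cball a (2 * R) \<subseteq> chart_range c" and W: "W = unchart c ` ball a R"
      by auto
    have "ball a R \<subseteq> chart_range c" using c(2,3) by (auto simp: subset_iff)
    then show "openin (top_of_set M) W"
      unfolding W by (rule unchart_image_openin [OF chartD [OF c(1)] open_ball])
  next
    show "M \<subseteq> \<Union>(?f ` ?good)"
    proof
      fix p assume "p \<in> M"
      then obtain c where c: "c \<in> \<A>" "p \<in> fst c" using charts_cover by blast
      then obtain R' where "0 < R'" "cball (snd c p) R' \<subseteq> chart_range c"
        using open_contains_cball_eq [OF chart_range_open [OF chartD [OF c(1)]]] by blast
      then obtain R where R: "0 < R" "cball (snd c p) (2 * R) \<subseteq> chart_range c"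
        using that [of "R' / 2"] by simp
      have "p \<in> ?f (c, snd c p, R)"
      proof -
        have "unchart c (snd c p) \<in> unchart c ` ball (snd c p) R" using R(1) by (intro imageI) simp
        then show ?thesis by (simp add: unchart_chart [OF chartD [OF c(1)] c(2)])
      qed
      then show "p \<in> \<Union>(?f ` ?good)" using c R by blast
    qed
  qed
  then obtain D where D: "D \<subseteq> ?f ` ?good" "finite D" "M \<subseteq> \<Union>D" by blast
  then obtain I where I: "I \<subseteq> ?good" "finite I" "D = ?f ` I"
    using finite_subset_image [OF D(2,1)] by blast
  show thesis
  proof (rule that [of I])
    show "\<forall>c a R. (c, a, R) \<in> I \<longrightarrow> c \<in> \<A> \<and> 0 < R \<and> cball a (2 * R) \<subseteq> chart_range c"
      using I(1) by blast
    show "M \<subseteq> (\<Union>(c, a, R)\<in>I. unchart c ` ball a R)"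
      using D(3) unfolding I(3) by simp
  qed (rule I(2))
qed

lemma normal_frame_transition:
  assumes F: "tame F" and cd: "c \<in> \<A>" "d \<in> \<A>" and p: "p \<in> fst c" "p \<in> fst d" "p \<notin> B"
  shows "normal_frame v (in_chart c F) (snd c p) =
    frame v (\<lambda>i. \<Sum>j\<in>UNIV. transition_matrix c d (snd c p) $ i $ j *\<^sub>R partial (in_chart d F) j (snd d p))"
  unfolding normal_frame_eq
  using partial_transition [OF chartD [OF cd(1)] chartD [OF cd(2)] compatD [OF cd] in_transition_domain [OF p(1,2)], of F]
    tameD(2) [OF F cd(2) p(2,3)] transition_chart [OF cd(1) p(1)] by simp

lemma det_normal_frame_transition:
  assumes F: "tame F" and cd: "c \<in> \<A>" "d \<in> \<A>" and p: "p \<in> fst c" "p \<in> fst d" "p \<notin> B"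
  shows "det (normal_frame v (in_chart c F) (snd c p)) =
    det (transition_matrix c d (snd c p)) * det (normal_frame v (in_chart d F) (snd d p))"
  by (simp only: normal_frame_transition [OF assms] det_frame_transform) (simp only: normal_frame_eq)

text \<open>
  Both terms of the density acquire the Jacobian of the coordinate change, hence the density defines
  an \<open>n\<close>-form.
\<close>

lemma stokes_density_transition:
  assumes F: "tame F" and G: "tame G" and cd: "c \<in> \<A>" "d \<in> \<A>" and p: "p \<in> fst c" "p \<in> fst d" "p \<notin> B"
  shows "stokes_density c F G p = det (transition_matrix c d (snd c p)) * stokes_density d F G p"
proof -
  have "det_coeff 1 (normal_frame (F p) (in_chart c F) (snd c p)) (normal_frame 0 (in_chart c G) (snd c p))
     = det (transition_matrix c d (snd c p)) * det_coeff 1 (normal_frame (F p) (in_chart d F) (snd d p)) (normal_frame 0 (in_chart d G) (snd d p))"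
    unfolding normal_frame_transition [OF F cd p] normal_frame_transition [OF G cd p] det_coeff_1_frame_transform
    by (simp add: normal_frame_eq)
  then show ?thesis
    unfolding stokes_density_def det_normal_frame_transition [OF F cd p] by (simp add: algebra_simps)
qed

lemma stokes_density_sum:
  assumes G: "\<And>i. i \<in> I \<Longrightarrow> tame (G i)" and c: "c \<in> \<A>" and p: "p \<in> fst c" "p \<notin> B"
  shows "stokes_density c F (\<lambda>p. \<Sum>i\<in>I. G i p) p = (\<Sum>i\<in>I. stokes_density c F (G i) p)"
proof -
  have "partial (in_chart c (\<lambda>p. \<Sum>i\<in>I. G i p)) j (snd c p) = (\<Sum>i\<in>I. partial (in_chart c (G i)) j (snd c p))" for j
  proof -
    have "((\<lambda>y. \<Sum>i\<in>I. in_chart c (G i) y) has_derivative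
       (\<lambda>v. \<Sum>i\<in>I. frechet_derivative (in_chart c (G i)) (at (snd c p)) v)) (at (snd c p))"
      by (intro has_derivative_sum has_frechet_derivative tameD(2) [OF G c p])
    then have "(in_chart c (\<lambda>p. \<Sum>i\<in>I. G i p) has_derivative
       (\<lambda>v. \<Sum>i\<in>I. frechet_derivative (in_chart c (G i)) (at (snd c p)) v)) (at (snd c p))"
      by (simp add: in_chart_eq [abs_def])
    then show ?thesis by (simp add: partial_eq) (simp add: partial_def)
  qed
  then show ?thesis
    unfolding stokes_density_def normal_frame_eq
    by (simp only: det_coeff_1_frame_sum linear_sum [OF linear_det_frame] sum_distrib_left sum_subtractf)
qed

lemma stokes_density_0:
  assumes c: "c \<in> \<A>" and p: "p \<in> fst c" and W: "openin (top_of_set M) W" "p \<in> W" "\<And>q. q \<in> W \<Longrightarrow> G q = 0"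
  shows "stokes_density c F G p = 0"
proof -
  have "(in_chart c G has_derivative (\<lambda>v. 0)) (at (snd c p))"
  proof (rule has_derivative_transform_within_open [OF has_derivative_const])
    show "open (snd c ` (fst c \<inter> W))" by (rule chart_image_open [OF chartD [OF c] W(1)])
    show "snd c p \<in> snd c ` (fst c \<inter> W)" using p W(2) by blast
    fix y assume "y \<in> snd c ` (fst c \<inter> W)"
    then obtain q where "q \<in> fst c" "q \<in> W" "y = snd c q" by blast
    then show "0 = in_chart c G y" using W(3) by (simp add: in_chart_chart [OF chartD [OF c]])
  qed
  then have "partial (in_chart c G) i (snd c p) = 0" for i by (simp add: partial_eq)
  then show ?thesis
    unfolding stokes_density_def normal_frame_eq det_coeff_1_frame
    using W by (simp add: linear_0 [OF linear_det_frame] linear_0 [OF linear_det_frame_upd])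
qed

text \<open>
  In the chart this is the Stokes identity on a ball; it remains to extend \<open>G\<close> from the closed ball by
  zero without losing the Lipschitz condition.
\<close>

lemma has_bochner_integral_stokes_chart:
  assumes F: "tame F" and G: "tame G" and c: "c \<in> \<A>" and R: "0 < R" "cball a R \<subseteq> chart_range c"
    and zero: "\<And>p. p \<notin> unchart c ` ball a R \<Longrightarrow> G p = 0"
  shows "has_bochner_integral lebesgue
    (\<lambda>y. indicator (ball a R - snd c ` (fst c \<inter> B)) y * stokes_density c F G (unchart c y)) 0"
proof -
  note c' = chartD [OF c]
  let ?N = "snd c ` (fst c \<inter> B)"
  have ball: "ball a R \<subseteq> chart_range c" using R(2) ball_subset_cball by blast
  \<comment> \<open>Outside the ball the closest point lies on the sphere, where \<open>G\<close> is
    zero.\<close>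
  define G' where "G' y = in_chart c G (closest_point (cball a R) y)" for y
  have ne: "cball a R \<noteq> {}" using R by auto
  obtain K where K: "K-lipschitz_on (cball a R) (in_chart c G)"
    using loc_lip_on_compact_imp_lipschitz [OF tameD(1) [OF G c] compact_cball R(2)] .
  obtain L where L: "L-lipschitz_on (cball a R) (in_chart c F)"
    using loc_lip_on_compact_imp_lipschitz [OF tameD(1) [OF F c] compact_cball R(2)] .
  have cp: "1-lipschitz_on UNIV (closest_point (cball a R))"
    using closest_point_lipschitz [OF convex_cball closed_cball ne] by (auto simp: lipschitz_on_def)
  have cpB: "range (closest_point (cball a R)) \<subseteq> cball a R"
    using closest_point_in_set [OF closed_cball ne] by auto
  have G'_lip: "(K * 1)-lipschitz_on UNIV G'"
    unfolding G'_def by (rule lipschitz_on_compose2 [OF cp lipschitz_on_subset [OF K cpB]])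
  have G'_eq: "G' y = in_chart c G y" if "y \<in> cball a R" for y
    using that by (simp add: G'_def closest_point_self)
  have chart_zero: "in_chart c G y = 0" if "y \<in> chart_range c" "y \<notin> ball a R" for y
  proof -
    have "unchart c y \<notin> unchart c ` ball a R"
    proof
      assume "unchart c y \<in> unchart c ` ball a R"
      then obtain x where x: "x \<in> ball a R" "unchart c y = unchart c x" by blast
      then have "x = y" using ball chart_unchart [OF c', of x] chart_unchart [OF c', of y] that(1) by auto
      then show False using x that by simp
    qed
    then show ?thesis using zero by (simp add: in_chart_eq)
  qed
  have G'_0: "G' y = 0" if "y \<notin> ball a R" for y
  proof -
    have "closest_point (cball a R) y \<notin> ball a R"
    proof -
      have "interior (cball a R) \<noteq> {}" using R by simp
      from affine_hull_nonempty_interior [OF this] rel_interior_nonempty_interior [OF this]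
      have "affine hull (cball a R) = UNIV" "rel_interior (cball a R) = ball a R"
        by (simp_all only: interior_cball)
      then show ?thesis
        using closest_point_in_rel_interior [OF closed_cball ne, of y] that by simp
    qed
    then show ?thesis using cpB R(2) chart_zero unfolding G'_def by blast
  qed
  have N: "y \<in> ?N \<longleftrightarrow> unchart c y \<in> B" if "y \<in> chart_range c" for y
    using that chart_image_iff [OF c', of "fst c \<inter> B"] unchart_in [OF c'] by auto
  have DG': "(G' has_derivative frechet_derivative (in_chart c G) (at y)) (at y)"
    and DF: "in_chart c F differentiable (at y)" if y: "y \<in> ball a R - ?N" for y
  proof -
    have p: "unchart c y \<in> fst c" "unchart c y \<notin> B" "snd c (unchart c y) = y"
      using y ball N unchart_in [OF c'] chart_unchart [OF c'] by auto
    show "in_chart c F differentiable (at y)" using tameD(2) [OF F c p(1,2)] p(3) by simp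
    have "(in_chart c G has_derivative frechet_derivative (in_chart c G) (at y)) (at y)"
      using tameD(2) [OF G c p(1,2)] p(3) by (intro has_frechet_derivative) simp
    then show "(G' has_derivative frechet_derivative (in_chart c G) (at y)) (at y)"
      by (rule has_derivative_transform_within_open [OF _ open_ball]) (use y G'_eq in auto)
  qed
  have "has_bochner_integral lebesgue
     (\<lambda>y. indicator (ball a R - ?N) y * (real CARD('n) * det (normal_frame (G' y) (in_chart c F) y)
         - det_coeff 1 (normal_frame (in_chart c F y) (in_chart c F) y) (normal_frame 0 G' y))) 0"
  proof (rule has_bochner_integral_frame_stokes [OF L G'_lip R(1) B_null [OF c]])
    show "in_chart c F differentiable (at y) \<and> G' differentiable (at y)" if "y \<in> ball a R - ?N" for y
      using DF [OF that] DG' [OF that] unfolding differentiable_def by blast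
  qed (rule G'_0)
  moreover have "indicator (ball a R - ?N) y * (real CARD('n) * det (normal_frame (G' y) (in_chart c F) y)
         - det_coeff 1 (normal_frame (in_chart c F y) (in_chart c F) y) (normal_frame 0 G' y))
    = indicator (ball a R - ?N) y * stokes_density c F G (unchart c y)" for y
  proof (cases "y \<in> ball a R - ?N")
    case True
    then have "y \<in> chart_range c" using ball by blast
    then have "snd c (unchart c y) = y" using chart_unchart [OF c'] by blast
    moreover have "partial G' i y = partial (in_chart c G) i y" for i
      using partial_eq [OF DG' [OF True]] by (simp add: partial_def)
    ultimately show ?thesis
      using True G'_eq [of y] by (simp add: stokes_density_def normal_frame_eq in_chart_eq)
  qed simp
  ultimately show ?thesis by (simp only:)
qed

end

section \<open>The induced volume measure\<close>

text \<open>
  A partial derivative is a pointwise limit of difference quotients along the steps \<open>1 / (k + 1)\<close>.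
\<close>

lemma borel_measurable_partial:
  fixes f :: "real^'n::finite \<Rightarrow> real^'m::finite"
  assumes V: "open V" and f: "continuous_on V f" and N: "negligible N"
    and diff: "\<And>y. y \<in> V - N \<Longrightarrow> f differentiable (at y)"
  shows "(\<lambda>y. indicator (V - N) y *\<^sub>R partial f i y) \<in> borel_measurable lebesgue"
proof -
  \<comment> \<open>The difference quotients leave \<open>V\<close>; extending by zero keeps them
    Borel measurable.\<close>
  define g where "g y = indicator V y *\<^sub>R f y" for y
  have g: "g \<in> borel_measurable borel"
    unfolding g_def using V f by (intro borel_measurable_continuous_on_indicator) auto
  define h where "h k = 1 / real (Suc k)" for k
  define s where "s k y = indicator (V - N) y *\<^sub>R ((1 / h k) *\<^sub>R (g (y + h k *\<^sub>R axis i 1) - g y))" for k y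
  have VN: "V - N \<in> sets lebesgue"
    using V N by (intro sets.Diff) (auto simp: negligible_imp_sets)
  have "s k \<in> borel_measurable lebesgue" for k
  proof -
    have "(\<lambda>y. g (y + h k *\<^sub>R axis i 1)) \<in> borel_measurable borel"
      by (rule measurable_compose [OF _ g]) simp
    then have "(\<lambda>y. (1 / h k) *\<^sub>R (g (y + h k *\<^sub>R axis i 1) - g y)) \<in> borel_measurable borel"
      using g by measurable
    then have "(\<lambda>y. (1 / h k) *\<^sub>R (g (y + h k *\<^sub>R axis i 1) - g y)) \<in> borel_measurable lebesgue"
      by (simp add: measurable_completion)
    then show ?thesis unfolding s_def using VN by measurable
  qed
  moreover have "(\<lambda>k. s k y) \<longlonglongrightarrow> indicator (V - N) y *\<^sub>R partial f i y" for y
  proof (cases "y \<in> V - N")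
    case True
    then have y: "y \<in> V" by blast
    have D: "(f has_derivative frechet_derivative f (at y)) (at y)"
      using diff [OF True] by (rule has_frechet_derivative)
    have "(g has_derivative frechet_derivative f (at y)) (at y)"
      by (rule has_derivative_transform_within_open [OF D V y]) (simp add: g_def)
    moreover have "((\<lambda>t. y + t *\<^sub>R axis i 1) has_derivative (\<lambda>t. t *\<^sub>R axis i 1)) (at 0)"
      by (auto intro!: derivative_eq_intros)
    ultimately have "((\<lambda>t. g (y + t *\<^sub>R axis i 1)) has_derivative (\<lambda>t. frechet_derivative f (at y) (t *\<^sub>R axis i 1))) (at 0)"
      using has_derivative_compose [of "\<lambda>t. y + t *\<^sub>R axis i 1" _ 0 UNIV g] by simp
    moreover have "frechet_derivative f (at y) (t *\<^sub>R axis i 1) = t *\<^sub>R partial f i y" for t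
      by (simp add: linear_cmul [OF has_derivative_linear [OF D]] partial_def)
    ultimately have "((\<lambda>t. g (y + t *\<^sub>R axis i 1)) has_vector_derivative partial f i y) (at 0)"
      by (simp add: has_vector_derivative_def)
    then have "((\<lambda>t. g (y + t *\<^sub>R axis i 1) $ j) has_real_derivative partial f i y $ j) (at 0)" for j
      unfolding has_real_derivative_iff_has_vector_derivative
      by (rule bounded_linear.has_vector_derivative [OF bounded_linear_vec_nth])
    then have "((\<lambda>t. (g (y + t *\<^sub>R axis i 1) $ j - g y $ j) / t) \<longlongrightarrow> partial f i y $ j) (at 0)" for j
      by (simp add: DERIV_def)
    then have "((\<lambda>t. (1 / t) *\<^sub>R (g (y + t *\<^sub>R axis i 1) - g y)) \<longlongrightarrow> partial f i y) (at 0)"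
      by (intro vec_tendstoI) simp
    moreover have "filterlim h (at 0) sequentially"
      unfolding filterlim_at h_def
      using LIMSEQ_inverse_real_of_nat by (auto simp: inverse_eq_divide simp del: of_nat_Suc)
    ultimately have "(\<lambda>k. (1 / h k) *\<^sub>R (g (y + h k *\<^sub>R axis i 1) - g y)) \<longlonglongrightarrow> partial f i y"
      by (rule filterlim_compose)
    then show ?thesis using True by (simp add: s_def)
  qed (simp add: s_def)
  ultimately show ?thesis by (rule borel_measurable_LIMSEQ_metric) 
qed

lemma borel_measurable_det:
  fixes A :: "'x \<Rightarrow> real^'n::finite^'n"
  assumes "\<And>i j. (\<lambda>x. A x $ i $ j) \<in> borel_measurable M"
  shows "(\<lambda>x. det (A x)) \<in> borel_measurable M"
  unfolding det_def using assms by measurable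

locale immersed_space = charted_space M \<A> B
  for M :: "'a::t2_space set" and \<A> :: "('a, 'n::finite) chart set" and B +
  fixes X :: "'a \<Rightarrow> real^('n option)"
  assumes X_tame: "tame X" and M_nonempty: "M \<noteq> {}"
    and X_inj: "\<And>c p. c \<in> \<A> \<Longrightarrow> p \<in> fst c \<Longrightarrow> p \<notin> B \<Longrightarrow> inj (frechet_derivative (in_chart c X) (at (snd c p)))"
begin

abbreviation dX :: "('a, 'n) chart \<Rightarrow> 'a \<Rightarrow> real^'n \<Rightarrow> real^('n option)" where
  "dX c p \<equiv> frechet_derivative (in_chart c X) (at (snd c p))"

abbreviation n_X :: "'a \<Rightarrow> real^('n option)" where
  "n_X \<equiv> unit_normal \<A> X"

abbreviation vol :: "('a, 'n) chart \<Rightarrow> 'a \<Rightarrow> real" where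
  "vol c p \<equiv> volume_density (in_chart c X) (snd c p)"

lemma axis_images_dX: "axis_images (dX c p) i = partial (in_chart c X) i (snd c p)"
  by (simp add: axis_images_def partial_def)

lemma normal_frame_dX: "normal_frame v (in_chart c X) (snd c p) = frame v (axis_images (dX c p))"
  by (simp add: normal_frame_eq axis_images_dX [abs_def])

lemma linear_dX: "c \<in> \<A> \<Longrightarrow> p \<in> fst c \<Longrightarrow> p \<notin> B \<Longrightarrow> linear (dX c p)"
  using has_derivative_linear [OF has_frechet_derivative [OF tameD(2) [OF X_tame]]] .

text \<open>
  An oriented normal in one chart is one in every chart, because tangent vectors are transformed
  linearly and with positive determinant. So the definite description in \<open>unit_normal\<close> has exactly
  one solution.
\<close>

lemma oriented_normal_unit_normal:
  assumes c: "c \<in> \<A>" and p: "p \<in> fst c" "p \<notin> B"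
  shows "oriented_normal (dX c p) (n_X p)"
proof -
  obtain v where v: "oriented_normal (dX c p) v"
    using oriented_normal_exists [OF linear_dX [OF c p] X_inj [OF c p]] by blast
  have v': "v \<bullet> partial (in_chart d X) i (snd d p) = 0 \<and> 0 < det (normal_frame v (in_chart d X) (snd d p))"
    if d: "d \<in> \<A>" "p \<in> fst d" for d i
  proof
    have "partial (in_chart d X) i (snd d p) =
       (\<Sum>j\<in>UNIV. transition_matrix d c (snd d p) $ i $ j *\<^sub>R partial (in_chart c X) j (snd c p))"
      using partial_transition [OF chartD [OF d(1)] chartD [OF c] compatD [OF d(1) c] in_transition_domain [OF d(2) p(1)], of X]
        tameD(2) [OF X_tame c p] transition_chart [OF d] by simp
    then show "v \<bullet> partial (in_chart d X) i (snd d p) = 0"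
      using v by (simp add: inner_sum_right oriented_normal_def axis_images_dX)
    have "0 < det (transition_matrix d c (snd d p))"
      by (rule det_transition_pos [OF d(1) c in_transition_domain [OF d(2) p(1)]])
    moreover have "0 < det (normal_frame v (in_chart c X) (snd c p))"
      using v by (simp add: oriented_normal_def normal_frame_dX)
    ultimately show "0 < det (normal_frame v (in_chart d X) (snd d p))"
      using det_normal_frame_transition [OF X_tame d(1) c d(2) p] by simp
  qed
  have "n_X p = v"
    unfolding unit_normal_def
  proof (rule the_equality)
    show "norm v = 1 \<and> (\<forall>d\<in>\<A>. p \<in> fst d \<longrightarrow> (\<forall>i. v \<bullet> partial (in_chart d X) i (snd d p) = 0) \<and>
        0 < det (normal_frame v (in_chart d X) (snd d p)))"
      using v v' by (auto simp: oriented_normal_def)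
    fix w assume w: "norm w = 1 \<and> (\<forall>d\<in>\<A>. p \<in> fst d \<longrightarrow> (\<forall>i. w \<bullet> partial (in_chart d X) i (snd d p) = 0) \<and>
        0 < det (normal_frame w (in_chart d X) (snd d p)))"
    then have "oriented_normal (dX c p) w"
      using c p by (auto simp: oriented_normal_def axis_images_dX normal_frame_dX)
    then show "w = v" by (rule oriented_normal_unique [OF linear_dX [OF c p] X_inj [OF c p] v])
  qed
  then show ?thesis using v by simp
qed

lemma vol_eq_det:
  assumes "c \<in> \<A>" "p \<in> fst c" "p \<notin> B"
  shows "vol c p = det (normal_frame (n_X p) (in_chart c X) (snd c p))"
  using gram_det_oriented_normal [OF oriented_normal_unit_normal [OF assms]]
  by (simp add: volume_density_def normal_frame_dX axis_images_dX)

lemma vol_pos: "c \<in> \<A> \<Longrightarrow> p \<in> fst c \<Longrightarrow> p \<notin> B \<Longrightarrow> 0 < vol c p"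
  using oriented_normal_unit_normal by (simp add: vol_eq_det normal_frame_dX oriented_normal_def)

lemma vol_transition:
  assumes "c \<in> \<A>" "d \<in> \<A>" "p \<in> fst c" "p \<in> fst d" "p \<notin> B"
  shows "vol c p = det (transition_matrix c d (snd c p)) * vol d p"
  using assms det_normal_frame_transition [OF X_tame assms] by (simp add: vol_eq_det)

definition reg_range :: "('a, 'n) chart \<Rightarrow> (real^'n) set" where
  "reg_range c = chart_range c - snd c ` (fst c \<inter> B)"

text \<open>
  The volume density set to zero on \<open>B\<close>, where partial derivatives carry no information; this makes it
  measurable.
\<close>

definition vol_reg :: "('a, 'n) chart \<Rightarrow> real^'n \<Rightarrow> real" where
  "vol_reg c y = indicator (reg_range c) y * volume_density (in_chart c X) y"

lemma reg_range_iff: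
  assumes "c \<in> \<A>"
  shows "y \<in> reg_range c \<longleftrightarrow> y \<in> chart_range c \<and> unchart c y \<notin> B"
  using chart_image_iff [OF chartD [OF assms], of "fst c \<inter> B" y] unchart_in [OF chartD [OF assms]]
  unfolding reg_range_def by blast

lemma reg_range_lebesgue: "c \<in> \<A> \<Longrightarrow> reg_range c \<in> sets lebesgue"
  unfolding reg_range_def using chart_range_open [OF chartD] B_null
  by (intro sets.Diff) (auto simp: negligible_imp_sets)

lemma vol_reg_eq:
  assumes "c \<in> \<A>" "y \<in> reg_range c"
  shows "vol_reg c y = vol c (unchart c y)" "0 < vol_reg c y"
proof -
  have y: "y \<in> chart_range c" "unchart c y \<notin> B" using assms reg_range_iff by auto
  then have y': "unchart c y \<in> fst c" "snd c (unchart c y) = y"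
    using unchart_in [OF chartD [OF assms(1)]] chart_unchart [OF chartD [OF assms(1)]] by auto
  show "vol_reg c y = vol c (unchart c y)" using assms(2) y' by (simp add: vol_reg_def)
  then show "0 < vol_reg c y" using vol_pos [OF assms(1) y'(1) y(2)] by simp
qed

lemma vol_reg_nonneg: "c \<in> \<A> \<Longrightarrow> 0 \<le> vol_reg c y"
  using vol_reg_eq(2) [of c y] by (cases "y \<in> reg_range c") (auto simp: vol_reg_def)

lemma vol_reg_measurable:
  assumes c: "c \<in> \<A>"
  shows "vol_reg c \<in> borel_measurable lebesgue"
proof -
  define P where "P i y = indicator (reg_range c) y *\<^sub>R partial (in_chart c X) i y" for i y
  have P: "P i \<in> borel_measurable lebesgue" for i
    unfolding P_def reg_range_def
  proof (rule borel_measurable_partial)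
    show "open (chart_range c)" by (rule chart_range_open [OF chartD [OF c]])
    show "continuous_on (chart_range c) (in_chart c X)"
      by (rule loc_lip_on_continuous [OF tameD(1) [OF X_tame c]])
    show "negligible (snd c ` (fst c \<inter> B))" by (rule B_null [OF c])
    fix y assume "y \<in> chart_range c - snd c ` (fst c \<inter> B)"
    then have y: "y \<in> chart_range c" "unchart c y \<notin> B"
      using reg_range_iff [OF c] by (auto simp: reg_range_def)
    then show "in_chart c X differentiable (at y)"
      using tameD(2) [OF X_tame c unchart_in [OF chartD [OF c] y(1)] y(2)] chart_unchart [OF chartD [OF c] y(1)] by simp
  qed
  have "(\<lambda>y. det (\<chi> i j. P i y \<bullet> P j y)) \<in> borel_measurable lebesgue"
    using P by (intro borel_measurable_det) simp
  then have *: "(\<lambda>y. indicator (reg_range c) y * sqrt (det (\<chi> i j. P i y \<bullet> P j y))) \<in> borel_measurable lebesgue"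
    using reg_range_lebesgue [OF c] by measurable
  have "vol_reg c y = indicator (reg_range c) y * sqrt (det (\<chi> i j. P i y \<bullet> P j y))" for y
    by (cases "y \<in> reg_range c") (simp_all add: vol_reg_def P_def volume_density_def)
  then have "vol_reg c = (\<lambda>y. indicator (reg_range c) y * sqrt (det (\<chi> i j. P i y \<bullet> P j y)))" ..
  with * show ?thesis by (simp only:)
qed

text \<open>
  The volume of a subset of a chart domain. The measure on \<open>M\<close> is glued from these set functions.
\<close>

definition chart_measure :: "('a, 'n) chart \<Rightarrow> 'a set \<Rightarrow> ennreal" where
  "chart_measure c W = emeasure (density lebesgue (vol_reg c)) (snd c ` W)"

lemma lebesgue_setsD:
  "W \<in> lebesgue_sets M \<A> \<Longrightarrow> c \<in> \<A> \<Longrightarrow> snd c ` (W \<inter> fst c) \<in> sets lebesgue"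
  by (simp add: lebesgue_sets_def)

lemma lebesgue_setsI_chart:
  assumes c: "c \<in> \<A>" and W: "W \<subseteq> fst c" "snd c ` W \<in> sets lebesgue"
  shows "W \<in> lebesgue_sets M \<A>"
  unfolding lebesgue_sets_def
proof (intro CollectI conjI ballI)
  show "W \<subseteq> M" using W(1) chart_sub [OF c] by blast
  fix d assume d: "d \<in> \<A>"
  let ?T = "transition_domain c d"
  have "snd d ` (W \<inter> fst d) = transition c d ` (snd c ` W \<inter> ?T)"
  proof -
    have "snd c ` W \<inter> ?T = snd c ` (W \<inter> fst d)"
      using W(1) transition_domain_iff [OF chartD [OF c] chartD [OF d] compatD [OF c d]]
      by (auto simp: unchart_chart [OF chartD [OF c]])
    then have "transition c d ` (snd c ` W \<inter> ?T) = (\<lambda>p. transition c d (snd c p)) ` (W \<inter> fst d)"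
      by (simp add: image_image)
    also have "\<dots> = snd d ` (W \<inter> fst d)"
      using W(1) transition_chart [OF c] by (intro image_cong) auto
    finally show ?thesis ..
  qed
  also have "\<dots> \<in> sets lebesgue"
  proof (rule differentiable_image_in_sets_lebesgue)
    show "snd c ` W \<inter> ?T \<in> sets lebesgue"
      using W(2) transition_domain_open [OF chartD [OF c] chartD [OF d] compatD [OF c d]] by (intro sets.Int) auto
    show "transition c d differentiable_on (snd c ` W \<inter> ?T)"
      using transition_differentiable [OF chartD [OF c] chartD [OF d] compatD [OF c d]]
      by (auto simp: differentiable_on_def intro: differentiable_at_withinI)
  qed simp
  finally show "snd d ` (W \<inter> fst d) \<in> sets lebesgue" .
qed

lemma sigma_algebra_lebesgue_sets: "sigma_algebra M (lebesgue_sets M \<A>)"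
  unfolding sigma_algebra_iff2
proof (intro conjI allI ballI impI)
  show "lebesgue_sets M \<A> \<subseteq> Pow M" "{} \<in> lebesgue_sets M \<A>" by (auto simp: lebesgue_sets_def)
  show "M - W \<in> lebesgue_sets M \<A>" if W: "W \<in> lebesgue_sets M \<A>" for W
    unfolding lebesgue_sets_def
  proof (intro CollectI conjI ballI)
    fix c assume c: "c \<in> \<A>"
    have "inj_on (snd c) (fst c)" using unchart_chart [OF chartD [OF c]] by (metis inj_onI)
    moreover have "(M - W) \<inter> fst c = fst c - W \<inter> fst c" using chart_sub [OF c] by blast
    ultimately have "snd c ` ((M - W) \<inter> fst c) = chart_range c - snd c ` (W \<inter> fst c)"
      by (simp add: inj_on_image_set_diff)
    also have "\<dots> \<in> sets lebesgue"
      using lebesgue_setsD [OF W c] chart_range_open [OF chartD [OF c]] by (intro sets.Diff) auto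
    finally show "snd c ` ((M - W) \<inter> fst c) \<in> sets lebesgue" .
  qed blast
  show "(\<Union>i. W i) \<in> lebesgue_sets M \<A>" if W: "range W \<subseteq> lebesgue_sets M \<A>" for W :: "nat \<Rightarrow> 'a set"
    unfolding lebesgue_sets_def
  proof (intro CollectI conjI ballI)
    show "(\<Union>i. W i) \<subseteq> M" using W by (auto simp: lebesgue_sets_def)
    fix c assume c: "c \<in> \<A>"
    have "snd c ` ((\<Union>i. W i) \<inter> fst c) = (\<Union>i. snd c ` (W i \<inter> fst c))" by blast
    also have "\<dots> \<in> sets lebesgue"
      using W lebesgue_setsD [OF _ c] by (intro sets.countable_UN) auto
    finally show "snd c ` ((\<Union>i. W i) \<inter> fst c) \<in> sets lebesgue" .
  qed
qed

lemma chart_in_lebesgue_sets: "c \<in> \<A> \<Longrightarrow> fst c \<in> lebesgue_sets M \<A>"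
  using chart_range_open [OF chartD] by (intro lebesgue_setsI_chart) auto

text \<open>
  Change of variables, with the transformation law of the volume density.
\<close>

lemma chart_measure_transition:
  assumes cd: "c \<in> \<A>" "d \<in> \<A>" and W: "W \<in> lebesgue_sets M \<A>" "W \<subseteq> fst c" "W \<subseteq> fst d"
  shows "chart_measure c W = chart_measure d W"
proof -
  note cc = chartD [OF cd(1)] and dd = chartD [OF cd(2)]
  note cdc = compatD [OF cd] and dcc = compatD [OF cd(2,1)]
  let ?g = "transition c d" and ?h = "transition d c"
  let ?S = "snd c ` W"
  have S: "?S \<in> sets lebesgue" using lebesgue_setsD [OF W(1) cd(1)] W(2) by (simp add: Int_absorb2)
  have Wd: "snd d ` W \<in> sets lebesgue" using lebesgue_setsD [OF W(1) cd(2)] W(3) by (simp add: Int_absorb2)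
  have ST: "?S \<subseteq> transition_domain c d" using W by (auto simp: transition_domain_def)
  have gS: "?g ` ?S = snd d ` W"
    unfolding image_image using W transition_chart [OF cd(1)] by (intro image_cong) auto
  have "chart_measure d W = (\<integral>\<^sup>+y. ennreal (vol_reg d y) * indicator (?g ` ?S) y \<partial>lebesgue)"
    unfolding chart_measure_def gS using vol_reg_measurable [OF cd(2)] Wd
    by (subst emeasure_density) auto
  also have "\<dots> = (\<integral>\<^sup>+x. ennreal \<bar>det (matrix (frechet_derivative ?g (at x)))\<bar> * ennreal (vol_reg d (?g x)) * indicator ?S x \<partial>lebesgue)"
  proof (rule nn_integral_change_of_variables [where h = ?h])
    show "?S \<in> sets lebesgue" by (rule S)
    show "(?g has_derivative frechet_derivative ?g (at x)) (at x within ?S)" if "x \<in> ?S" for x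
      using has_frechet_derivative [OF transition_differentiable [OF cc dd cdc]] ST that
      by (meson has_derivative_at_withinI subsetD)
    show "?h differentiable_on ?g ` ?S"
      unfolding gS differentiable_on_def
    proof
      fix y assume "y \<in> snd d ` W"
      then have "y \<in> transition_domain d c" using W by (auto simp: transition_domain_def)
      then show "?h differentiable (at y within snd d ` W)"
        using transition_differentiable [OF dd cc dcc] by (rule_tac differentiable_at_withinI) blast
    qed
    show "?h (?g x) = x" if "x \<in> ?S" for x
      using transition_inverse [OF cc dd cdc] ST that by blast
    show "(\<lambda>y. ennreal (vol_reg d y)) \<in> borel_measurable lebesgue"
      using vol_reg_measurable [OF cd(2)] by measurable
  qed
  also have "\<dots> = (\<integral>\<^sup>+x. ennreal (vol_reg c x) * indicator ?S x \<partial>lebesgue)"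
  proof (intro nn_integral_cong)
    fix x
    show "ennreal \<bar>det (matrix (frechet_derivative ?g (at x)))\<bar> * ennreal (vol_reg d (?g x)) * indicator ?S x
        = ennreal (vol_reg c x) * indicator ?S x"
    proof (cases "x \<in> ?S")
      case True
      then obtain p where p: "p \<in> W" "x = snd c p" by blast
      then have pc: "p \<in> fst c" "p \<in> fst d" using W by auto
      have gx: "?g x = snd d p" using transition_chart [OF cd(1) pc(1)] p by simp
      have rx: "x \<in> reg_range c \<longleftrightarrow> p \<notin> B" "?g x \<in> reg_range d \<longleftrightarrow> p \<notin> B"
        using pc p gx reg_range_iff [OF cd(1)] reg_range_iff [OF cd(2)] unchart_chart [OF cc] unchart_chart [OF dd] by auto
      have xT: "x \<in> transition_domain c d" using True ST by blast
      have "\<bar>det (matrix (frechet_derivative ?g (at x)))\<bar> * vol_reg d (?g x) = vol_reg c x"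
      proof (cases "p \<in> B")
        case False
        then have "vol_reg c x = vol c p" "vol_reg d (?g x) = vol d p"
          using vol_reg_eq(1) [OF cd(1), of x] vol_reg_eq(1) [OF cd(2), of "?g x"] rx p gx pc
            unchart_chart [OF cc] unchart_chart [OF dd] by auto
        then show ?thesis
          using vol_transition [OF cd pc False] det_transition_pos [OF cd xT] det_transition_matrix [OF cc dd cdc xT] p
          by simp
      qed (use rx in \<open>simp add: vol_reg_def\<close>)
      then show ?thesis using True vol_reg_nonneg [OF cd(2)] by (simp add: ennreal_mult' [symmetric])
    qed simp
  qed
  also have "\<dots> = chart_measure c W"
    unfolding chart_measure_def using vol_reg_measurable [OF cd(1)] S
    by (subst emeasure_density) auto
  finally show ?thesis ..
qed

end

lemma (in charted_space) finite_chart_cover: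
  obtains cs :: "nat \<Rightarrow> ('a, 'n) chart" and m where "\<forall>k<m. cs k \<in> \<A>" "M \<subseteq> (\<Union>k<m. fst (cs k))"
proof -
  obtain I :: "(('a, 'n) chart \<times> (real^'n) \<times> real) set" where I: "finite I"
    "\<forall>c a R. (c, a, R) \<in> I \<longrightarrow> c \<in> \<A> \<and> 0 < R \<and> cball a (2 * R) \<subseteq> chart_range c"
    "M \<subseteq> (\<Union>(c, a, R)\<in>I. unchart c ` ball a R)"
    by (rule finite_ball_cover, rule that)
  note I2 = I(2) [rule_format]
  obtain xs where xs: "set xs = I" using finite_list [OF I(1)] by blast
  show thesis
  proof (rule that [of "length xs" "\<lambda>k. fst (xs ! k)"])
    have "fst (xs ! k) \<in> \<A>" if "k < length xs" for k
      using I2 [of "fst (xs ! k)" "fst (snd (xs ! k))" "snd (snd (xs ! k))"] that xs nth_mem [of k xs] by simp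
    then show "\<forall>k<length xs. fst (xs ! k) \<in> \<A>" by blast
    show "M \<subseteq> (\<Union>k<length xs. fst (fst (xs ! k)))"
    proof
      fix p assume "p \<in> M"
      then obtain c a R where p: "(c, a, R) \<in> I" "p \<in> unchart c ` ball a R" using I(3) by auto
      then obtain y where y: "y \<in> ball a R" "p = unchart c y" by blast
      then have "y \<in> chart_range c" using I2 [OF p(1)] by (auto simp: subset_iff)
      then have "p \<in> fst c" using y(2) unchart_in [OF chartD] I2 [OF p(1)] by blast
      moreover obtain k where "k < length xs" "xs ! k = (c, a, R)"
        using p(1) xs by (metis in_set_conv_nth)
      ultimately show "p \<in> (\<Union>k<length xs. fst (fst (xs ! k)))" by force
    qed
  qed
qed

context immersed_space
begin

lemma chart_measure_countably_additive:
  assumes c: "c \<in> \<A>" and W: "range W \<subseteq> lebesgue_sets M \<A>" "disjoint_family W" "\<And>i. W i \<subseteq> fst c"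
  shows "(\<Sum>i. chart_measure c (W i)) = chart_measure c (\<Union>i. W i)"
  unfolding chart_measure_def image_UN
proof (rule suminf_emeasure)
  show "range (\<lambda>i. snd c ` W i) \<subseteq> sets (density lebesgue (vol_reg c))"
    using W lebesgue_setsD [OF _ c] by (auto simp: Int_absorb2 image_subset_iff) (metis Int_absorb2 range_subsetD)
  have "inj_on (snd c) (fst c)" using unchart_chart [OF chartD [OF c]] by (metis inj_onI)
  then show "disjoint_family (\<lambda>i. snd c ` W i)"
    using W(2,3) unfolding disjoint_family_on_def by (simp add: inj_on_image_Int [symmetric])
qed

text \<open>
  Finitely many charts cover \<open>M\<close>. Cut down to disjoint sets, they allow a measurable set to be
  distributed over single charts; the result does not depend on the charts by
  \<open>chart_measure_transition\<close>.
\<close>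

lemma volume_measure_exists:
  obtains \<mu> where "space \<mu> = M" "sets \<mu> = lebesgue_sets M \<A>"
    "\<And>c W. c \<in> \<A> \<Longrightarrow> W \<in> lebesgue_sets M \<A> \<Longrightarrow> W \<subseteq> fst c \<Longrightarrow> emeasure \<mu> W = chart_measure c W"
proof -
  let ?L = "lebesgue_sets M \<A>"
  interpret L: sigma_algebra M ?L by (rule sigma_algebra_lebesgue_sets)
  obtain cs :: "nat \<Rightarrow> ('a, 'n) chart" and m where cs0: "\<forall>k<m. cs k \<in> \<A>" "M \<subseteq> (\<Union>k<m. fst (cs k))"
    by (rule finite_chart_cover, rule that)
  then have cs: "\<And>k. k < m \<Longrightarrow> cs k \<in> \<A>" "M \<subseteq> (\<Union>k<m. fst (cs k))" by blast+
  \<comment> \<open>Each point is assigned to the first chart that contains it.\<close>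
  define D where "D k = fst (cs k) - (\<Union>j<k. fst (cs j))" for k
  have D_sets: "D k \<in> ?L" if "k < m" for k
    unfolding D_def using that cs(1) by (intro L.Diff L.finite_UN) (auto intro: chart_in_lebesgue_sets)
  have D_sub: "D k \<subseteq> fst (cs k)" for k by (auto simp: D_def)
  have D_disj: "disjoint_family D"
  proof -
    have "D i \<inter> D j = {}" if "i < j" for i j using that by (auto simp: D_def)
    then show ?thesis unfolding disjoint_family_on_def by (metis Int_commute linorder_neqE_nat)
  qed
  have D_cover: "M \<subseteq> (\<Union>k<m. D k)"
  proof
    fix p assume "p \<in> M"
    then obtain k where k: "k < m" "p \<in> fst (cs k)" using cs(2) by blast
    define j where "j = (LEAST j. p \<in> fst (cs j))"
    have "p \<in> fst (cs j)" "j \<le> k" "\<And>i. i < j \<Longrightarrow> p \<notin> fst (cs i)"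
      unfolding j_def using k(2) by (auto intro: LeastI Least_le dest: not_less_Least)
    then have "p \<in> D j" "j < m" using k by (auto simp: D_def)
    then show "p \<in> (\<Union>k<m. D k)" by blast
  qed
  define f where "f W = (\<Sum>k<m. chart_measure (cs k) (W \<inter> D k))" for W
  have split: "f W = chart_measure c W" if c: "c \<in> \<A>" and W: "W \<in> ?L" "W \<subseteq> fst c" for c W
  proof -
    have "f W = (\<Sum>k<m. chart_measure c (W \<inter> D k))"
      unfolding f_def
    proof (intro sum.cong refl)
      fix k assume "k \<in> {..<m}"
      then show "chart_measure (cs k) (W \<inter> D k) = chart_measure c (W \<inter> D k)"
        using cs(1) D_sets W subsetD [OF D_sub] c by (intro chart_measure_transition) auto
    qed
    also have "\<dots> = (\<Sum>k. chart_measure c (if k < m then W \<inter> D k else {}))"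
      by (subst suminf_finite [of "{..<m}"]) (auto simp: chart_measure_def)
    also have "\<dots> = chart_measure c (\<Union>k. if k < m then W \<inter> D k else {})"
    proof (rule chart_measure_countably_additive [OF c])
      show "disjoint_family (\<lambda>k. if k < m then W \<inter> D k else {})"
        using D_disj unfolding disjoint_family_on_def by (simp add: Int_assoc) blast
    qed (use W D_sets in auto)
    also have "(\<Union>k. if k < m then W \<inter> D k else {}) = W"
    proof
      have "W \<subseteq> (\<Union>k<m. D k)" using D_cover L.sets_into_space [OF W(1)] by blast
      then show "W \<subseteq> (\<Union>k. if k < m then W \<inter> D k else {})" by (auto split: if_splits)
    qed (auto split: if_splits)
    finally show ?thesis .
  qed
  have ca: "countably_additive ?L f"
  proof (rule countably_additiveI)
    fix W :: "nat \<Rightarrow> 'a set" assume W: "range W \<subseteq> ?L" "disjoint_family W"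
    have "(\<Sum>i. f (W i)) = (\<Sum>k<m. \<Sum>i. chart_measure (cs k) (W i \<inter> D k))"
      unfolding f_def by (intro suminf_sum) simp
    also have "\<dots> = (\<Sum>k<m. chart_measure (cs k) (\<Union>i. W i \<inter> D k))"
    proof (intro sum.cong refl chart_measure_countably_additive)
      fix k assume "k \<in> {..<m}"
      then have k: "k < m" by simp
      show "cs k \<in> \<A>" by (rule cs(1) [OF k])
      show "range (\<lambda>i. W i \<inter> D k) \<subseteq> ?L" using W(1) L.Int D_sets [OF k] by blast
      show "disjoint_family (\<lambda>i. W i \<inter> D k)" using W(2) unfolding disjoint_family_on_def by blast
      show "W i \<inter> D k \<subseteq> fst (cs k)" for i using D_sub by blast
    qed
    also have "\<dots> = f (\<Union>i. W i)"
    proof -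
      have "(\<Union>i. W i \<inter> D k) = (\<Union>i. W i) \<inter> D k" for k by blast
      then show ?thesis by (simp only: f_def)
    qed
    finally show "(\<Sum>i. f (W i)) = f (\<Union>i. W i)" .
  qed
  have pos: "positive ?L f" by (simp add: positive_def f_def chart_measure_def)
  show thesis
  proof (rule that [of "measure_of M ?L f"])
    show "emeasure (measure_of M ?L f) W = chart_measure c W" if "c \<in> \<A>" "W \<in> ?L" "W \<subseteq> fst c" for c W
      using emeasure_measure_of_sigma [OF sigma_algebra_lebesgue_sets pos ca that(2)] split [OF that] by simp
  qed auto
qed

lemma chart_measure_eq_integral:
  assumes c: "c \<in> \<A>" and W: "W \<in> lebesgue_sets M \<A>" "W \<subseteq> fst c"
  shows "chart_measure c W = (\<integral>\<^sup>+y\<in>snd c ` W. ennreal (volume_density (in_chart c X) y) \<partial>lebesgue)"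
proof -
  have S: "snd c ` W \<in> sets lebesgue" using lebesgue_setsD [OF W(1) c] W(2) by (simp add: Int_absorb2)
  have "chart_measure c W = (\<integral>\<^sup>+y. ennreal (vol_reg c y) * indicator (snd c ` W) y \<partial>lebesgue)"
    unfolding chart_measure_def using vol_reg_measurable [OF c] S by (subst emeasure_density) auto
  also have "\<dots> = (\<integral>\<^sup>+y\<in>snd c ` W. ennreal (volume_density (in_chart c X) y) \<partial>lebesgue)"
  proof (rule nn_integral_cong_AE)
    have "snd c ` (fst c \<inter> B) \<in> null_sets lebesgue"
      using B_null [OF c] by (simp add: negligible_iff_null_sets)
    then have "AE y in lebesgue. y \<notin> snd c ` (fst c \<inter> B)" by (rule AE_not_in)
    then show "AE y in lebesgue. ennreal (vol_reg c y) * indicator (snd c ` W) y =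
        ennreal (volume_density (in_chart c X) y) * indicator (snd c ` W) y"
    proof eventually_elim
      case (elim y)
      show ?case
      proof (cases "y \<in> snd c ` W")
        case True
        then have "y \<in> reg_range c" using elim W(2) by (auto simp: reg_range_def)
        then show ?thesis by (simp add: vol_reg_def)
      qed simp
    qed
  qed
  finally show ?thesis .
qed

text \<open>
  A measurable set is a disjoint union of finitely many sets that lie in single charts.
\<close>

lemma volume_measure_unique:
  assumes "space \<mu> = M" "sets \<mu> = lebesgue_sets M \<A>"
    "\<And>c W. c \<in> \<A> \<Longrightarrow> W \<in> lebesgue_sets M \<A> \<Longrightarrow> W \<subseteq> fst c \<Longrightarrow> emeasure \<mu> W = chart_measure c W"
    and "space \<mu>' = M" "sets \<mu>' = lebesgue_sets M \<A>"
    "\<And>c W. c \<in> \<A> \<Longrightarrow> W \<in> lebesgue_sets M \<A> \<Longrightarrow> W \<subseteq> fst c \<Longrightarrow> emeasure \<mu>' W = chart_measure c W"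
  shows "\<mu> = \<mu>'"
proof (rule measure_eqI)
  let ?L = "lebesgue_sets M \<A>"
  interpret L: sigma_algebra M ?L by (rule sigma_algebra_lebesgue_sets)
  obtain cs :: "nat \<Rightarrow> ('a, 'n) chart" and m where cs0: "\<forall>k<m. cs k \<in> \<A>" "M \<subseteq> (\<Union>k<m. fst (cs k))"
    by (rule finite_chart_cover, rule that)
  then have cs: "\<And>k. k < m \<Longrightarrow> cs k \<in> \<A>" "M \<subseteq> (\<Union>k<m. fst (cs k))" by blast+
  fix W assume "W \<in> sets \<mu>"
  then have W: "W \<in> ?L" by (simp add: assms)
  define E where "E k = (if k < m then W \<inter> fst (cs k) else {})" for k
  have E: "E k \<in> ?L" for k
    unfolding E_def using W cs(1) by (auto intro!: L.Int chart_in_lebesgue_sets)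
  have dE: "disjointed E k \<in> ?L" for k
    using E L.range_disjointed_sets [of E] by blast
  have "emeasure \<mu> (disjointed E k) = emeasure \<mu>' (disjointed E k)" for k
  proof (cases "k < m")
    case True
    have "disjointed E k \<subseteq> fst (cs k)" using disjointed_subset [of E k] True by (auto simp: E_def)
    then show ?thesis using assms(3,6) cs(1) [OF True] dE by simp
  next
    case False
    then have "disjointed E k = {}" using disjointed_subset [of E k] by (auto simp: E_def)
    then show ?thesis by simp
  qed
  moreover have "emeasure \<mu> (\<Union>k. disjointed E k) = (\<Sum>k. emeasure \<mu> (disjointed E k))"
    using dE assms(2) by (intro suminf_emeasure [symmetric] disjoint_family_disjointed) auto
  moreover have "emeasure \<mu>' (\<Union>k. disjointed E k) = (\<Sum>k. emeasure \<mu>' (disjointed E k))"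
    using dE assms(5) by (intro suminf_emeasure [symmetric] disjoint_family_disjointed) auto
  moreover have "(\<Union>k. disjointed E k) = W"
    unfolding UN_disjointed_eq using cs(2) L.sets_into_space [OF W] by (auto simp: E_def split: if_splits)
  ultimately show "emeasure \<mu> W = emeasure \<mu>' W" by simp
qed (simp add: assms)

abbreviation vm :: "'a measure" where "vm \<equiv> volume_measure M \<A> X"

lemma volume_measure_props:
  "space vm = M" "sets vm = lebesgue_sets M \<A>"
  "\<And>c W. c \<in> \<A> \<Longrightarrow> W \<in> lebesgue_sets M \<A> \<Longrightarrow> W \<subseteq> fst c \<Longrightarrow> emeasure vm W = chart_measure c W"
proof -
  let ?P = "\<lambda>\<mu>. space \<mu> = M \<and> sets \<mu> = lebesgue_sets M \<A> \<and>
     (\<forall>c\<in>\<A>. \<forall>W\<in>sets \<mu>. W \<subseteq> fst c \<longrightarrow>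
        emeasure \<mu> W = (\<integral>\<^sup>+y\<in>snd c ` W. ennreal (volume_density (in_chart c X) y) \<partial>lebesgue))"
  have P_iff: "?P \<mu> \<longleftrightarrow> space \<mu> = M \<and> sets \<mu> = lebesgue_sets M \<A> \<and>
     (\<forall>c\<in>\<A>. \<forall>W\<in>lebesgue_sets M \<A>. W \<subseteq> fst c \<longrightarrow> emeasure \<mu> W = chart_measure c W)" for \<mu>
    by (auto simp: chart_measure_eq_integral)
  obtain \<mu> where \<mu>: "?P \<mu>"
    unfolding P_iff using volume_measure_exists by metis
  have "?P vm"
    unfolding volume_measure_def
  proof (rule theI [of ?P, OF \<mu>])
    fix \<mu>' assume "?P \<mu>'"
    with \<mu> show "\<mu>' = \<mu>" unfolding P_iff by (intro volume_measure_unique) blast+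
  qed
  then show "space vm = M" "sets vm = lebesgue_sets M \<A>"
    "\<And>c W. c \<in> \<A> \<Longrightarrow> W \<in> lebesgue_sets M \<A> \<Longrightarrow> W \<subseteq> fst c \<Longrightarrow> emeasure vm W = chart_measure c W"
    unfolding P_iff by blast+
qed

text \<open>
  On the chart domain, the volume measure is the push-forward of the density \<open>vol_reg c\<close> under the
  inverse chart.
\<close>

lemma has_bochner_integral_volume_chart:
  fixes g :: "'a \<Rightarrow> real"
  assumes c: "c \<in> \<A>" and zero: "\<And>p. p \<in> M \<Longrightarrow> p \<notin> fst c - B \<Longrightarrow> g p = 0"
    and int: "has_bochner_integral lebesgue (\<lambda>y. vol_reg c y * g (unchart c y)) x"
  shows "has_bochner_integral vm g x"
proof -
  note c' = chartD [OF c]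
  obtain p0 where p0: "p0 \<in> M" using M_nonempty by blast
  interpret L: sigma_algebra M "lebesgue_sets M \<A>" by (rule sigma_algebra_lebesgue_sets)
  \<comment> \<open>A total inverse of the chart; its values outside the chart range do not matter,
    as \<open>vol_reg c\<close> vanishes there.\<close>
  define \<psi> where "\<psi> y = (if y \<in> chart_range c then unchart c y else p0)" for y
  have V: "open (chart_range c)" by (rule chart_range_open [OF c'])
  have pre: "\<psi> -` W = snd c ` (W \<inter> fst c) \<union> (if p0 \<in> W then - chart_range c else {})" for W
    using chart_image_iff [OF c', of "W \<inter> fst c"] unchart_in [OF c'] by (auto simp: \<psi>_def unchart_chart [OF c'] split: if_splits)
  have pre_meas: "\<psi> -` W \<in> sets lebesgue" if "W \<in> lebesgue_sets M \<A>" for W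
    unfolding pre using lebesgue_setsD [OF that c] V by (auto intro!: sets.Un simp: borel_open borel_closed)
  have \<psi>: "\<psi> \<in> lebesgue \<rightarrow>\<^sub>M vm"
  proof (rule measurableI)
    show "\<psi> y \<in> space vm" for y
      using p0 unchart_in [OF c', of y] chart_sub [OF c] by (auto simp: \<psi>_def volume_measure_props)
    show "\<psi> -` W \<inter> space lebesgue \<in> sets lebesgue" if "W \<in> sets vm" for W
      using pre_meas that by (simp add: volume_measure_props)
  qed
  have eq: "distr (density lebesgue (vol_reg c)) vm \<psi> = density vm (indicator (fst c))"
  proof (rule measure_eqI)
    fix W assume "W \<in> sets (distr (density lebesgue (vol_reg c)) vm \<psi>)"
    then have W: "W \<in> lebesgue_sets M \<A>" by (simp add: volume_measure_props)
    then have Wc: "W \<inter> fst c \<in> lebesgue_sets M \<A>" by (intro L.Int chart_in_lebesgue_sets c)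
    have "emeasure (distr (density lebesgue (vol_reg c)) vm \<psi>) W = emeasure (density lebesgue (vol_reg c)) (\<psi> -` W)"
      using \<psi> W by (subst emeasure_distr) (auto simp: volume_measure_props measurable_def)
    also have "\<dots> = (\<integral>\<^sup>+y. ennreal (vol_reg c y) * indicator (\<psi> -` W) y \<partial>lebesgue)"
      using vol_reg_measurable [OF c] pre_meas [OF W] by (subst emeasure_density) auto
    also have "\<dots> = (\<integral>\<^sup>+y. ennreal (vol_reg c y) * indicator (snd c ` (W \<inter> fst c)) y \<partial>lebesgue)"
      by (intro nn_integral_cong) (auto simp: pre vol_reg_def reg_range_def indicator_def)
    also have "\<dots> = chart_measure c (W \<inter> fst c)"
      unfolding chart_measure_def using vol_reg_measurable [OF c] lebesgue_setsD [OF W c]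
      by (subst emeasure_density) auto
    also have "\<dots> = emeasure vm (W \<inter> fst c)"
      by (rule volume_measure_props(3) [OF c Wc, symmetric]) simp
    also have "\<dots> = emeasure (density vm (indicator (fst c))) W"
    proof -
      have "fst c \<in> sets vm" "W \<in> sets vm" "W \<inter> fst c \<in> sets vm"
        using W Wc chart_in_lebesgue_sets [OF c] by (simp_all add: volume_measure_props)
      then show ?thesis
        by (subst emeasure_density) (simp_all add: indicator_inter_arith [symmetric] Int_commute)
    qed
    finally show "emeasure (distr (density lebesgue (vol_reg c)) vm \<psi>) W = emeasure (density vm (indicator (fst c))) W" .
  qed simp
  let ?W = "fst c - B"
  have W_sub: "?W \<subseteq> fst c" by blast
  have W_image: "snd c ` ?W = reg_range c"
    using chart_image_iff [OF c' W_sub] reg_range_iff [OF c] unchart_in [OF c'] by blast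
  have g_meas: "g \<in> borel_measurable vm"
  proof (rule measurableI)
    fix E :: "real set" assume E: "E \<in> sets borel"
    \<comment> \<open>Measurability of \<open>g\<close> is recovered from that of the product, since
      the density is positive at regular points.\<close>
    define q where "q y = (vol_reg c y * g (unchart c y)) / vol_reg c y" for y
    have q: "q \<in> borel_measurable lebesgue"
      unfolding q_def using has_bochner_integral_implies_finite_norm int vol_reg_measurable [OF c]
      by (intro borel_measurable_divide) (auto dest: borel_measurable_has_bochner_integral)
    have "snd c ` {p \<in> ?W. g p \<in> E} = reg_range c \<inter> q -` E"
    proof -
      have "q y = g (unchart c y)" if "y \<in> reg_range c" for y
        using vol_reg_eq(2) [OF c that] by (simp add: q_def)
      then show ?thesis
        using chart_image_iff [OF c', of "{p \<in> ?W. g p \<in> E}"] reg_range_iff [OF c] unchart_in [OF c'] by auto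
    qed
    also have "\<dots> \<in> sets lebesgue"
      using reg_range_lebesgue [OF c] measurable_sets [OF q E] by simp
    finally have 1: "{p \<in> ?W. g p \<in> E} \<in> lebesgue_sets M \<A>"
      by (intro lebesgue_setsI_chart [OF c]) auto
    have 2: "?W \<in> lebesgue_sets M \<A>"
      using W_image reg_range_lebesgue [OF c] by (intro lebesgue_setsI_chart [OF c]) auto
    have "g -` E \<inter> space vm = {p \<in> ?W. g p \<in> E} \<union> (if 0 \<in> E then M - ?W else {})"
    proof (rule set_eqI)
      fix p show "p \<in> g -` E \<inter> space vm \<longleftrightarrow> p \<in> {p \<in> ?W. g p \<in> E} \<union> (if 0 \<in> E then M - ?W else {})"
        using zero [of p] chart_sub [OF c] by (cases "p \<in> ?W") (auto simp: volume_measure_props)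
    qed
    also have "\<dots> \<in> sets vm" using 1 2 by (auto simp: volume_measure_props)
    finally show "g -` E \<inter> space vm \<in> sets vm" .
  qed simp
  have ind: "indicator (fst c) \<in> borel_measurable vm"
    using chart_in_lebesgue_sets [OF c] by (intro borel_measurable_indicator) (simp add: volume_measure_props)
  have g_\<psi>: "vol_reg c y * g (\<psi> y) = vol_reg c y * g (unchart c y)" for y
    by (auto simp: \<psi>_def vol_reg_def reg_range_def)
  have g_ind: "indicator (fst c) p * g p = g p" if "p \<in> space vm" for p
    using zero [of p] that by (cases "p \<in> fst c") (auto simp: volume_measure_props)
  have eq': "density vm (\<lambda>p. ennreal (indicator (fst c) p)) = distr (density lebesgue (vol_reg c)) vm \<psi>"
    unfolding eq by (simp add: ennreal_indicator [abs_def])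
  have dens_meas: "\<psi> \<in> density lebesgue (vol_reg c) \<rightarrow>\<^sub>M vm" using \<psi> by (simp add: measurable_def)
  have g\<psi>_meas: "(\<lambda>y. g (\<psi> y)) \<in> borel_measurable lebesgue" by (rule measurable_compose [OF \<psi> g_meas])
  have ae: "AE y in lebesgue. 0 \<le> vol_reg c y" by (simp add: vol_reg_nonneg [OF c])
  have "integrable vm g \<longleftrightarrow> integrable vm (\<lambda>p. indicator (fst c) p *\<^sub>R g p)"
    by (intro Bochner_Integration.integrable_cong refl) (simp add: g_ind)
  also have "\<dots> \<longleftrightarrow> integrable (density vm (\<lambda>p. ennreal (indicator (fst c) p))) g"
    by (rule integrable_density [symmetric, OF g_meas ind]) simp
  also have "\<dots> \<longleftrightarrow> integrable (density lebesgue (vol_reg c)) (\<lambda>y. g (\<psi> y))"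
    unfolding eq' by (rule integrable_distr_eq [OF dens_meas g_meas])
  also have "\<dots> \<longleftrightarrow> integrable lebesgue (\<lambda>y. vol_reg c y *\<^sub>R g (\<psi> y))"
    by (rule integrable_density [OF g\<psi>_meas vol_reg_measurable [OF c] ae])
  finally have 1: "integrable vm g" using int by (simp add: g_\<psi> has_bochner_integral_iff)
  have "integral\<^sup>L vm g = integral\<^sup>L vm (\<lambda>p. indicator (fst c) p *\<^sub>R g p)"
    by (intro Bochner_Integration.integral_cong refl) (simp add: g_ind)
  also have "\<dots> = integral\<^sup>L (density vm (\<lambda>p. ennreal (indicator (fst c) p))) g"
    by (rule integral_density [symmetric, OF g_meas ind]) simp
  also have "\<dots> = integral\<^sup>L (density lebesgue (vol_reg c)) (\<lambda>y. g (\<psi> y))"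
    unfolding eq' by (rule integral_distr [OF dens_meas g_meas])
  also have "\<dots> = integral\<^sup>L lebesgue (\<lambda>y. vol_reg c y *\<^sub>R g (\<psi> y))"
    by (rule integral_density [OF g\<psi>_meas vol_reg_measurable [OF c] ae])
  finally have "integral\<^sup>L vm g = x" using int by (simp add: g_\<psi> has_bochner_integral_iff)
  with 1 show ?thesis by (simp add: has_bochner_integral_iff)
qed

end

section \<open>Stokes' theorem on the closed manifold\<close>

context charted_space
begin

lemma in_chart_has_derivative_cong:
  fixes G :: "'a \<Rightarrow> 'b::real_normed_vector"
  assumes c: "c \<in> \<A>" and p: "p \<in> fst c" and W: "openin (top_of_set M) W" "p \<in> W" "\<And>q. q \<in> W \<Longrightarrow> G q = G' q"
    and G: "(in_chart c G has_derivative D) (at (snd c p))"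
  shows "(in_chart c G' has_derivative D) (at (snd c p))"
proof (rule has_derivative_transform_within_open [OF G])
  show "open (snd c ` (fst c \<inter> W))" by (rule chart_image_open [OF chartD [OF c] W(1)])
  show "snd c p \<in> snd c ` (fst c \<inter> W)" using p W(2) by blast
  fix y assume "y \<in> snd c ` (fst c \<inter> W)"
  then obtain q where "q \<in> fst c" "q \<in> W" "y = snd c q" by blast
  then show "in_chart c G y = in_chart c G' y" using W(3) by (simp add: in_chart_chart [OF chartD [OF c]])
qed

lemma stokes_density_cong:
  assumes c: "c \<in> \<A>" and p: "p \<in> fst c" "p \<notin> B" and G: "tame G" and eq: "\<And>q. q \<in> M \<Longrightarrow> G q = G' q"
  shows "stokes_density c F G p = stokes_density c F G' p"
proof -
  have pM: "p \<in> M" using chart_sub [OF c] p by blast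
  have "(in_chart c G' has_derivative frechet_derivative (in_chart c G) (at (snd c p))) (at (snd c p))"
    using pM eq by (intro in_chart_has_derivative_cong [OF c p(1) openin_subtopology_self pM _ has_frechet_derivative [OF tameD(2) [OF G c p]]]) auto
  from partial_eq [OF this] have "partial (in_chart c G') i (snd c p) = partial (in_chart c G) i (snd c p)" for i
    by (simp add: partial_def)
  then show ?thesis using eq [OF pM] by (simp add: stokes_density_def normal_frame_eq)
qed

end

context immersed_space
begin

text \<open>
  The density is linear in its second map. A partition of unity splits \<open>W\<close> into maps supported in
  balls of single charts, for which the integral vanishes. The quotients by \<open>vol c\<close> do not depend on
  the chart, as numerator and denominator transform in the same way.
\<close>

theorem has_bochner_integral_stokes:
  assumes F: "tame F" and W: "tame W"
    and \<Phi>: "\<And>c p. c \<in> \<A> \<Longrightarrow> p \<in> fst c \<Longrightarrow> p \<notin> B \<Longrightarrow> \<Phi> p = stokes_density c F W p / vol c p"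
    and \<Phi>_B: "\<And>p. p \<in> M \<inter> B \<Longrightarrow> \<Phi> p = 0"
  shows "has_bochner_integral vm \<Phi> 0"
proof -
  obtain I :: "(('a, 'n) chart \<times> (real^'n) \<times> real) set" where I: "finite I"
    "\<forall>c a R. (c, a, R) \<in> I \<longrightarrow> c \<in> \<A> \<and> 0 < R \<and> cball a (2 * R) \<subseteq> chart_range c"
    and cover: "M \<subseteq> (\<Union>(c, a, R)\<in>I. unchart c ` ball a R)"
    by (rule finite_ball_cover)
  define bmp where "bmp i = (case i of (c, a, R) \<Rightarrow> chart_bump c a R)" for i :: "('a, 'n) chart \<times> (real^'n) \<times> real"
  have Ic: "fst i \<in> \<A>" "0 < snd (snd i)" "cball (fst (snd i)) (2 * snd (snd i)) \<subseteq> chart_range (fst i)"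
    "cball (fst (snd i)) (snd (snd i)) \<subseteq> chart_range (fst i)" if "i \<in> I" for i
  proof -
    obtain c a R where i: "i = (c, a, R)" by (cases i)
    have "(c, a, R) \<in> I" using that i by simp
    then have *: "c \<in> \<A>" "0 < R" "cball a (2 * R) \<subseteq> chart_range c" using I(2) by blast+
    then have "cball a R \<subseteq> chart_range c" by (auto simp: subset_iff)
    with * show "fst i \<in> \<A>" "0 < snd (snd i)" "cball (fst (snd i)) (2 * snd (snd i)) \<subseteq> chart_range (fst i)"
      "cball (fst (snd i)) (snd (snd i)) \<subseteq> chart_range (fst i)" using i by auto
  qed
  have bmp_eq: "bmp i = chart_bump (fst i) (fst (snd i)) (snd (snd i))" for i
    by (simp add: bmp_def case_prod_beta)
  have bmp_tame: "tame (bmp i)" if "i \<in> I" for i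
    unfolding bmp_eq using Ic [OF that] by (intro chart_bump_tame)
  have bmp_nonneg: "0 \<le> bmp i p" for i p
    by (simp add: bmp_eq chart_bump_def bump_nonneg)
  define \<beta> where "\<beta> p = (\<Sum>i\<in>I. bmp i p)" for p
  have \<beta>_pos: "0 < \<beta> p" if "p \<in> M" for p
  proof -
    have "p \<in> (\<Union>(c, a, R)\<in>I. unchart c ` ball a R)" using cover that ..
    then obtain c a R where "(c, a, R) \<in> I" "p \<in> unchart c ` ball a R" by auto
    moreover define i where "i = (c, a, R)"
    ultimately have i: "i \<in> I" "p \<in> unchart (fst i) ` ball (fst (snd i)) (snd (snd i))" by simp_all
    then have "0 < bmp i p"
      unfolding bmp_eq using chart_bump_pos_iff [OF Ic(1,2,4) [OF i(1)]] by blast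
    then show ?thesis unfolding \<beta>_def using I(1) i(1) bmp_nonneg by (intro sum_pos2) auto
  qed
  have \<beta>_tame: "tame \<beta>" unfolding \<beta>_def [abs_def] by (intro tame_sum bmp_tame)
  \<comment> \<open>The partition of unity is \<open>bmp i / \<beta>\<close>; its members are tame,
    because \<open>\<beta>\<close> is tame and positive.\<close>
  define G where "G i p = bmp i p *\<^sub>R (inverse (\<beta> p) *\<^sub>R W p)" for i p
  have G_tame: "tame (G i)" if "i \<in> I" for i
    unfolding G_def [abs_def] by (intro tame_scaleR bmp_tame [OF that] tame_inverse \<beta>_tame \<beta>_pos W)
  have G_zero: "G i p = 0" if "i \<in> I" "p \<notin> unchart (fst i) ` ball (fst (snd i)) (snd (snd i))" for i p
    using chart_bump_eq_0 [OF Ic(1,2,4) [OF that(1)] that(2)] by (simp add: G_def bmp_eq)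
  have G_sum: "(\<Sum>i\<in>I. G i p) = W p" if "p \<in> M" for p
  proof -
    have "(\<Sum>i\<in>I. G i p) = \<beta> p *\<^sub>R (inverse (\<beta> p) *\<^sub>R W p)"
      by (simp only: G_def \<beta>_def scaleR_sum_left)
    then show ?thesis using \<beta>_pos [OF that] by simp
  qed
  have G_far: "stokes_density c F (G i) p = 0"
    if i: "i \<in> I" and c: "c \<in> \<A>" and p: "p \<in> fst c" "p \<notin> unchart (fst i) ` cball (fst (snd i)) (snd (snd i))" for i c p
  proof (rule stokes_density_0 [OF c p(1) compact_support_complement [OF Ic(1,2,4) [OF i]]])
    show "p \<in> M - unchart (fst i) ` cball (fst (snd i)) (snd (snd i))" using p chart_sub [OF c] by blast
    show "G i q = 0" if "q \<in> M - unchart (fst i) ` cball (fst (snd i)) (snd (snd i))" for q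
      using that ball_subset_cball by (intro G_zero [OF i]) blast
  qed
  define \<phi> where "\<phi> i p = (if p \<in> fst (fst i) - B then stokes_density (fst i) F (G i) p / vol (fst i) p else 0)" for i p
  have int: "has_bochner_integral vm (\<phi> i) 0" if i: "i \<in> I" for i
  proof -
    obtain c a R where ieq: "i = (c, a, R)" by (cases i)
    note Ici = Ic [OF i, unfolded ieq, simplified]
    have c: "c \<in> \<A>" and R: "0 < R" "cball a (2 * R) \<subseteq> chart_range c" "cball a R \<subseteq> chart_range c" using Ici by auto
    note c' = chartD [OF c]
    show ?thesis
    proof (rule has_bochner_integral_volume_chart [OF c])
      show "\<phi> i p = 0" if "p \<notin> fst c - B" for p using that by (auto simp: \<phi>_def ieq)
      \<comment> \<open>The Stokes identity is used on the doubled ball: outside it the density is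
        zero, because \<open>G i\<close> vanishes in a neighbourhood of each such point.\<close>
      have "has_bochner_integral lebesgue
        (\<lambda>y. indicator (ball a (2 * R) - snd c ` (fst c \<inter> B)) y * stokes_density c F (G i) (unchart c y)) 0"
      proof (rule has_bochner_integral_stokes_chart [OF F G_tame [OF i] c _ R(2)])
        show "G i p = 0" if "p \<notin> unchart c ` ball a (2 * R)" for p
        proof (rule G_zero [OF i])
          have "ball a R \<subseteq> ball a (2 * R)" using R(1) by (intro subset_ball) simp
          then show "p \<notin> unchart (fst i) ` ball (fst (snd i)) (snd (snd i))" using that ieq by auto
        qed
      qed (use R in simp)
      moreover have "indicator (ball a (2 * R) - snd c ` (fst c \<inter> B)) y * stokes_density c F (G i) (unchart c y)
         = vol_reg c y * \<phi> i (unchart c y)" for y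
      proof (cases "y \<in> reg_range c")
        case True
        then have y: "y \<in> chart_range c" "unchart c y \<notin> B" using reg_range_iff [OF c] by auto
        have p: "unchart c y \<in> fst c" by (rule unchart_in [OF c' y(1)])
        have "vol_reg c y * \<phi> i (unchart c y) = stokes_density c F (G i) (unchart c y)"
          using vol_reg_eq [OF c True] p y by (simp add: \<phi>_def ieq)
        moreover have "stokes_density c F (G i) (unchart c y) = 0" if "y \<notin> ball a (2 * R)"
        proof (rule G_far [OF i c p])
          show "unchart c y \<notin> unchart (fst i) ` cball (fst (snd i)) (snd (snd i))"
          proof
            assume "unchart c y \<in> unchart (fst i) ` cball (fst (snd i)) (snd (snd i))"
            then obtain x where x: "x \<in> cball a R" "unchart c y = unchart c x" using ieq by auto
            then have "y = x" using chart_unchart [OF c' y(1)] chart_unchart [OF c', of x] R(3) by auto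
            then show False using x(1) that R(1) by auto
          qed
        qed
        ultimately show ?thesis using True by (auto simp: reg_range_def indicator_def)
      next
        case False
        then have "y \<notin> ball a (2 * R) - snd c ` (fst c \<inter> B)"
          using subset_trans [OF ball_subset_cball R(2)] unfolding reg_range_def by blast
        then show ?thesis using False by (simp add: vol_reg_def)
      qed
      ultimately show "has_bochner_integral lebesgue (\<lambda>y. vol_reg c y * \<phi> i (unchart c y)) 0"
        by (simp only:)
    qed
  qed
  have sum: "\<Phi> p = (\<Sum>i\<in>I. \<phi> i p)" if p: "p \<in> space vm" for p
  proof (cases "p \<in> B")
    case True
    then show ?thesis using \<Phi>_B p by (simp add: \<phi>_def volume_measure_props)
  next
    case False
    have pM: "p \<in> M" using p by (simp add: volume_measure_props)
    then obtain c where c: "c \<in> \<A>" "p \<in> fst c" using charts_cover by blast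
    have "\<phi> i p = stokes_density c F (G i) p / vol c p" if i: "i \<in> I" for i
    proof (cases "p \<in> fst (fst i)")
      case True
      let ?J = "det (transition_matrix c (fst i) (snd c p))"
      have "0 < ?J" by (rule det_transition_pos [OF c(1) Ic(1) [OF i] in_transition_domain [OF c(2) True]])
      then show ?thesis
        using True False stokes_density_transition [OF F G_tame [OF i] c(1) Ic(1) [OF i] c(2) True False]
          vol_transition [OF c(1) Ic(1) [OF i] c(2) True False]
        by (simp add: \<phi>_def)
    next
      case notin: False
      have "unchart (fst i) ` cball (fst (snd i)) (snd (snd i)) \<subseteq> fst (fst i)"
        using Ic(4) [OF i] unchart_in [OF chartD [OF Ic(1) [OF i]]] by blast
      then have "stokes_density c F (G i) p = 0" using notin by (intro G_far [OF i c]) blast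
      then show ?thesis using notin by (simp add: \<phi>_def)
    qed
    then have "(\<Sum>i\<in>I. \<phi> i p) = (\<Sum>i\<in>I. stokes_density c F (G i) p) / vol c p"
      by (simp add: sum_divide_distrib)
    also have "(\<Sum>i\<in>I. stokes_density c F (G i) p) = stokes_density c F (\<lambda>p. \<Sum>i\<in>I. G i p) p"
      by (rule stokes_density_sum [OF G_tame c False, symmetric])
    also have "\<dots> = stokes_density c F W p"
      by (rule stokes_density_cong [OF c False tame_sum G_sum]) (rule G_tame)
    finally show ?thesis using \<Phi> [OF c False] by simp
  qed
  have "has_bochner_integral vm (\<lambda>p. \<Sum>i\<in>I. \<phi> i p) (\<Sum>i\<in>I. 0)"
    by (intro has_bochner_integral_sum int)
  then have "has_bochner_integral vm (\<lambda>p. \<Sum>i\<in>I. \<phi> i p) 0" by simp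
  moreover have "has_bochner_integral vm \<Phi> 0 \<longleftrightarrow> has_bochner_integral vm (\<lambda>p. \<Sum>i\<in>I. \<phi> i p) 0"
    by (rule has_bochner_integral_cong [OF refl sum refl])
  ultimately show ?thesis by simp
qed

lemma subset_B_null:
  assumes "S \<subseteq> M \<inter> B"
  shows "S \<in> null_sets vm"
proof -
  interpret L: sigma_algebra M "lebesgue_sets M \<A>" by (rule sigma_algebra_lebesgue_sets)
  have sets: "T \<in> lebesgue_sets M \<A>" if "T \<subseteq> M \<inter> B" for T
    unfolding lebesgue_sets_def
  proof (intro CollectI conjI ballI)
    show "T \<subseteq> M" using that by blast
    fix c assume c: "c \<in> \<A>"
    have "negligible (snd c ` (T \<inter> fst c))"
      using that by (intro negligible_subset [OF B_null [OF c]]) blast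
    then show "snd c ` (T \<inter> fst c) \<in> sets lebesgue" by (rule negligible_imp_sets)
  qed
  obtain cs :: "nat \<Rightarrow> ('a, 'n) chart" and m where cs: "\<forall>k<m. cs k \<in> \<A>" "M \<subseteq> (\<Union>k<m. fst (cs k))"
    by (rule finite_chart_cover, rule that)
  have "S \<inter> fst (cs k) \<in> null_sets vm" if k: "k < m" for k
  proof -
    have c: "cs k \<in> \<A>" using cs(1) k by blast
    have T: "S \<inter> fst (cs k) \<in> lebesgue_sets M \<A>" using assms by (intro sets) blast
    have "emeasure vm (S \<inter> fst (cs k)) = chart_measure (cs k) (S \<inter> fst (cs k))"
      by (rule volume_measure_props(3) [OF c T]) simp
    also have "\<dots> = 0"
    proof -
      have "negligible (snd (cs k) ` (S \<inter> fst (cs k)))"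
        using assms by (intro negligible_subset [OF B_null [OF c]]) blast
      then have "snd (cs k) ` (S \<inter> fst (cs k)) \<in> null_sets (density lebesgue (vol_reg (cs k)))"
      proof (subst null_sets_density_iff)
        assume "negligible (snd (cs k) ` (S \<inter> fst (cs k)))"
        then have "snd (cs k) ` (S \<inter> fst (cs k)) \<in> null_sets lebesgue"
          by (simp add: negligible_iff_null_sets)
        from AE_not_in [OF this] null_setsD2 [OF this]
        show "snd (cs k) ` (S \<inter> fst (cs k)) \<in> sets lebesgue \<and>
          (AE y in lebesgue. y \<in> snd (cs k) ` (S \<inter> fst (cs k)) \<longrightarrow> ennreal (vol_reg (cs k) y) = 0)"
          by (auto elim: eventually_mono)
      qed (use vol_reg_measurable [OF c] in simp)
      then show ?thesis by (simp add: chart_measure_def null_setsD1)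
    qed
    finally show ?thesis using T by (simp add: null_sets_def volume_measure_props)
  qed
  then have "(\<Union>k<m. S \<inter> fst (cs k)) \<in> null_sets vm" by (intro null_sets_UN') auto
  moreover have "(\<Union>k<m. S \<inter> fst (cs k)) = S" using cs(2) assms by blast
  ultimately show ?thesis by simp
qed

text \<open>
  Every subset of \<open>B\<close> is measurable, as the measure is complete along \<open>B\<close>; hence \<open>f\<close> may be
  arbitrary there.
\<close>

lemma has_bochner_integral_null_modification:
  fixes f g :: "'a \<Rightarrow> real"
  assumes g: "has_bochner_integral vm g x" and eq: "\<And>p. p \<in> M - B \<Longrightarrow> f p = g p"
  shows "has_bochner_integral vm f x"
proof -
  have gm: "g \<in> borel_measurable vm" using g by (rule borel_measurable_has_bochner_integral)
  have B: "M \<inter> B \<in> null_sets vm" by (rule subset_B_null) simp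
  have fm: "f \<in> borel_measurable vm"
  proof (rule measurableI)
    fix E :: "real set" assume E: "E \<in> sets borel"
    have "f -` E \<inter> space vm = (g -` E \<inter> space vm - M \<inter> B) \<union> (f -` E \<inter> M \<inter> B)"
      using eq by (auto simp: volume_measure_props)
    also have "\<dots> \<in> sets vm"
      using measurable_sets [OF gm E] B subset_B_null [of "f -` E \<inter> M \<inter> B"]
      by (intro sets.Un sets.Diff) (auto simp: null_setsD2)
    finally show "f -` E \<inter> space vm \<in> sets vm" .
  qed simp
  have "AE p in vm. p \<notin> M \<inter> B" by (rule AE_not_in [OF B])
  then have "AE p in vm. f p = g p"
    using AE_space by eventually_elim (use eq in \<open>auto simp: volume_measure_props\<close>)
  then show ?thesis using g fm gm by (subst has_bochner_integral_cong_AE [where g = g]) auto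
qed

end

section \<open>Anisotropic curvatures and the parallel family\<close>

definition complexify :: "real^'n^'m \<Rightarrow> complex^'n^'m" where
  "complexify A = (\<chi> i j. complex_of_real (A $ i $ j))"

lemma complexify_mult: "complexify (A ** B) = complexify A ** complexify B"
  by (simp add: complexify_def matrix_matrix_mult_def vec_eq_iff)

lemma det_complexify: "det (complexify A) = complex_of_real (det A)"
  by (simp add: complexify_def det_def)

lemma charpoly_conjugate:
  fixes S S' T :: "real^'n::finite^'n"
  assumes T: "det T \<noteq> 0" and TS: "T ** S = S' ** T"
  shows "det (mat z - complexify S) = det (mat z - complexify S')"
proof -
  have scalar: "mat z ** A = A ** mat z" for A :: "complex^'n^'n"
    by (simp add: matrix_matrix_mult_def mat_def vec_eq_iff if_distrib [where f = "\<lambda>x. x * _"]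
        if_distrib [where f = "\<lambda>x. _ * x"] mult.commute cong: if_cong)
  have ld: "A ** (C - D) = A ** C - A ** D" and rd: "(C - D) ** A = C ** A - D ** A"
    for A C D :: "complex^'n^'n"
    by (simp_all add: matrix_matrix_mult_def vec_eq_iff right_diff_distrib left_diff_distrib sum_subtractf)
  have "complexify T ** (mat z - complexify S) = (mat z - complexify S') ** complexify T"
    by (simp add: ld rd scalar complexify_mult [symmetric] TS)
  then have "det (complexify T) * det (mat z - complexify S) = det (mat z - complexify S') * det (complexify T)"
    by (metis det_mul)
  then show ?thesis using T by (simp add: det_complexify)
qed

text \<open>
  \<open>\<Xi>\<close> is the Cahn-Hoffman field along the immersion. At points of \<open>B\<close>, where there is no normal, its
  values are those that make it Lipschitz. The last assumption says that the
  derivative of \<open>\<Xi>\<close> is tangential, so that it defines a shape operator.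
\<close>

locale cahn_hoffman_immersion = immersed_space M \<A> B X
  for M :: "'a::t2_space set" and \<A> :: "('a, 'n::finite) chart set" and B and X :: "'a \<Rightarrow> real^('n option)" +
  fixes \<gamma> :: "real^('n option) \<Rightarrow> real" and \<Xi> :: "'a \<Rightarrow> real^('n option)"
  assumes \<Xi>_tame: "tame \<Xi>"
    and \<Xi>_eq: "\<And>p. p \<in> M - B \<Longrightarrow> \<Xi> p = cahn_hoffman \<gamma> (n_X p)"
    and \<Xi>_normal: "\<And>p. p \<in> M - B \<Longrightarrow> \<Xi> p \<bullet> n_X p = \<gamma> (n_X p)"
    and \<Xi>_perp: "\<And>c p u. c \<in> \<A> \<Longrightarrow> p \<in> fst c \<Longrightarrow> p \<notin> B \<Longrightarrow>
      frechet_derivative (in_chart c \<Xi>) (at (snd c p)) u \<bullet> n_X p = 0"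
begin

abbreviation d\<Xi> :: "('a, 'n) chart \<Rightarrow> 'a \<Rightarrow> real^'n \<Rightarrow> real^('n option)" where
  "d\<Xi> c p \<equiv> frechet_derivative (in_chart c \<Xi>) (at (snd c p))"

abbreviation S_X :: "('a, 'n) chart \<Rightarrow> 'a \<Rightarrow> real^'n^'n" where
  "S_X c p \<equiv> shape_matrix \<gamma> \<A> X c p"

abbreviation \<kappa>_X :: "'a \<Rightarrow> 'n \<Rightarrow> complex" where
  "\<kappa>_X \<equiv> aniso_principal_curvatures \<gamma> \<A> X"

lemma linear_d\<Xi>: "c \<in> \<A> \<Longrightarrow> p \<in> fst c \<Longrightarrow> p \<notin> B \<Longrightarrow> linear (d\<Xi> c p)"
  using has_derivative_linear [OF has_frechet_derivative [OF tameD(2) [OF \<Xi>_tame]]] .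

lemma regular_open: "openin (top_of_set M) (M - B)"
  using B_closed by (simp add: openin_diff)

lemma shape_matrix_eq:
  assumes c: "c \<in> \<A>" and p: "p \<in> fst c" "p \<notin> B"
  shows "dX c p (S_X c p *v u) = - d\<Xi> c p u"
proof -
  have pM: "p \<in> M - B" using chart_sub [OF c] p by blast
  have "(in_chart c (\<lambda>q. cahn_hoffman \<gamma> (n_X q)) has_derivative d\<Xi> c p) (at (snd c p))"
    by (rule in_chart_has_derivative_cong [OF c p(1) regular_open pM \<Xi>_eq has_frechet_derivative [OF tameD(2) [OF \<Xi>_tame c p]]])
  then have eq: "frechet_derivative (in_chart c (\<lambda>q. cahn_hoffman \<gamma> (n_X q))) (at (snd c p)) = d\<Xi> c p"
    by (rule frechet_derivative_at [symmetric])
  have "\<exists>!S. \<forall>u. dX c p (S *v u) = - d\<Xi> c p u"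
    by (rule shape_operator_exists_unique [OF linear_dX [OF c p] X_inj [OF c p]
          oriented_normal_unit_normal [OF c p] linear_d\<Xi> [OF c p] \<Xi>_perp [OF c p]])
  from theI' [OF this] show ?thesis unfolding shape_matrix_def eq by blast
qed

text \<open>
  Both matrices represent \<open>- d\<Xi>\<close> on the range of \<open>dX\<close>, and \<open>T\<close> exchanges the coordinates.
\<close>

lemma shape_matrix_conjugate:
  assumes cd: "c \<in> \<A>" "d \<in> \<A>" and p: "p \<in> fst c" "p \<in> fst d" "p \<notin> B"
  defines "T \<equiv> matrix (frechet_derivative (transition c d) (at (snd c p)))"
  shows "T ** S_X c p = S_X d p ** T" "det T \<noteq> 0"
proof -
  let ?\<tau> = "frechet_derivative (transition c d) (at (snd c p))"
  note cc = chartD [OF cd(1)] and dd = chartD [OF cd(2)] and cdc = compatD [OF cd]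
  note y = in_transition_domain [OF p(1,2)]
  have \<tau>p: "transition c d (snd c p) = snd d p" by (rule transition_chart [OF cd(1) p(1)])
  have \<tau>: "(transition c d has_derivative ?\<tau>) (at (snd c p))"
    by (rule has_frechet_derivative [OF transition_differentiable [OF cc dd cdc y]])
  have T: "T *v u = ?\<tau> u" for u
    unfolding T_def using has_derivative_linear [OF \<tau>] by (simp add: matrix_works linear_matrix_vector_mul_eq)
  have chain: "frechet_derivative (in_chart c F) (at (snd c p)) u = frechet_derivative (in_chart d F) (at (snd d p)) (T *v u)"
    if "tame F" for F :: "'a \<Rightarrow> real^('n option)" and u
  proof -
    have "(in_chart d F has_derivative frechet_derivative (in_chart d F) (at (snd d p))) (at (transition c d (snd c p)))"
      unfolding \<tau>p by (rule has_frechet_derivative [OF tameD(2) [OF that cd(2) p(2,3)]])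
    from frechet_derivative_at [OF in_chart_has_derivative_transition [OF cc dd cdc y this]]
    show ?thesis unfolding T by (metis (mono_tags))
  qed
  have "dX d p (T *v (S_X c p *v u)) = dX d p (S_X d p *v (T *v u))" for u
    using shape_matrix_eq [OF cd(1) p(1,3), of u] shape_matrix_eq [OF cd(2) p(2,3), of "T *v u"]
      chain [OF X_tame] chain [OF \<Xi>_tame] by simp
  then have "T *v (S_X c p *v u) = S_X d p *v (T *v u)" for u
    using X_inj [OF cd(2) p(2,3)] by (simp add: inj_eq)
  then show "T ** S_X c p = S_X d p ** T"
    by (simp add: matrix_eq matrix_vector_mul_assoc [symmetric])
  show "det T \<noteq> 0"
    using det_transition_pos [OF cd y] det_transition_matrix [OF cc dd cdc y] by (simp add: T_def)
qed

text \<open>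
  Matrices in different charts are conjugate, so one list of eigenvalues serves all charts at once, as
  the choice in \<open>aniso_principal_curvatures\<close> requires.
\<close>

lemma principal_curvatures_charpoly:
  assumes c: "c \<in> \<A>" and p: "p \<in> fst c" "p \<notin> B"
  shows "det (mat z - complexify (S_X c p)) = (\<Prod>l\<in>UNIV. z - \<kappa>_X p l)"
proof -
  obtain \<kappa> :: "'n \<Rightarrow> complex" where \<kappa>: "\<And>z. det (mat z - complexify (S_X c p)) = (\<Prod>l\<in>UNIV. z - \<kappa> l)"
    using charpoly_factorization [of "complexify (S_X c p)"] by blast
  have "\<forall>d\<in>\<A>. p \<in> fst d \<longrightarrow> (\<forall>z. det (mat z - complexify (S_X d p)) = (\<Prod>l\<in>UNIV. z - \<kappa> l))"
  proof (intro ballI impI allI)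
    fix d z assume d: "d \<in> \<A>" "p \<in> fst d"
    show "det (mat z - complexify (S_X d p)) = (\<Prod>l\<in>UNIV. z - \<kappa> l)"
      using charpoly_conjugate [OF shape_matrix_conjugate(2,1) [OF c d(1) p(1) d(2) p(2)], of z] \<kappa> [of z] by simp
  qed
  then have "\<forall>d\<in>\<A>. p \<in> fst d \<longrightarrow> (\<forall>z. det (mat z - complexify (S_X d p)) = (\<Prod>l\<in>UNIV. z - \<kappa>_X p l))"
    unfolding aniso_principal_curvatures_def complexify_def
    by (rule someI [where P = "\<lambda>\<kappa>. \<forall>c\<in>\<A>. p \<in> fst c \<longrightarrow>
      (\<forall>z. det (mat z - (\<chi> i j. complex_of_real (S_X c p $ i $ j))) = (\<Prod>l\<in>UNIV. z - \<kappa> l))"])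
  then show ?thesis using c p by blast
qed

definition \<sigma>_X :: "nat \<Rightarrow> 'a \<Rightarrow> real" where
  "\<sigma>_X k p = Re (elem_sym k (\<kappa>_X p))"

lemma \<sigma>_X_eq_mean_curvature:
  "k \<le> CARD('n) \<Longrightarrow> \<sigma>_X k p = real (CARD('n) choose k) * aniso_mean_curvature \<gamma> \<A> X k p"
  by (simp add: \<sigma>_X_def elem_sym_def aniso_mean_curvature_def)

lemma \<sigma>_X_beyond: "\<sigma>_X (Suc CARD('n)) p = 0"
proof -
  have "{L :: 'n set. card L = Suc CARD('n)} = {}"
  proof -
    have "card L \<noteq> Suc CARD('n)" for L :: "'n set"
      using card_mono [OF finite_class.finite_UNIV, of L] by auto
    then show ?thesis by blast
  qed
  then show ?thesis by (simp add: \<sigma>_X_def elem_sym_def)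
qed

text \<open>
  The tangent vectors of \<open>X + t \<Xi>\<close> are perpendicular to the normal of \<open>X\<close>, and the volume that they
  span is multiplied by \<open>det (1 - t S)\<close>, the generating function of the curvatures.
\<close>

lemma det_frame_parallel_immersion:
  assumes c: "c \<in> \<A>" and p: "p \<in> fst c" "p \<notin> B"
  shows "det (frame v (\<lambda>i. axis_images (dX c p) i + t *\<^sub>R axis_images (d\<Xi> c p) i))
    = (\<Sum>k\<le>CARD('n). (- t) ^ k * \<sigma>_X k p) * ((v \<bullet> n_X p) * vol c p)"
proof -
  have "det (mat 1 - t *\<^sub>R S_X c p) = (\<Sum>k\<le>CARD('n). (- t) ^ k * \<sigma>_X k p)"
    unfolding \<sigma>_X_def
    by (rule det_pencil_elem_sym [OF principal_curvatures_charpoly [OF c p, unfolded complexify_def]])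
  moreover have "det (frame v (axis_images (dX c p))) = (v \<bullet> n_X p) * vol c p"
    unfolding vol_eq_det [OF c p] normal_frame_dX
    by (rule det_frame_inner_normal [OF linear_dX [OF c p] X_inj [OF c p] oriented_normal_unit_normal [OF c p]])
  ultimately show ?thesis
    by (simp add: det_frame_parallel [OF linear_dX [OF c p] linear_d\<Xi> [OF c p] shape_matrix_eq [OF c p]])
qed

definition parallel :: "real \<Rightarrow> 'a \<Rightarrow> real^('n option)" where
  "parallel t p = X p + t *\<^sub>R \<Xi> p"

lemma parallel_tame: "tame (parallel t)"
  unfolding parallel_def [abs_def] by (intro tame_add X_tame tame_scaleR tame_const \<Xi>_tame)

lemma normal_frame_parallel:
  assumes c: "c \<in> \<A>" and p: "p \<in> fst c" "p \<notin> B"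
  shows "normal_frame v (in_chart c (parallel t)) (snd c p) = frame v (\<lambda>i. axis_images (dX c p) i + t *\<^sub>R axis_images (d\<Xi> c p) i)"
proof -
  have "((\<lambda>y. in_chart c X y + t *\<^sub>R in_chart c \<Xi> y) has_derivative (\<lambda>u. dX c p u + t *\<^sub>R d\<Xi> c p u)) (at (snd c p))"
    by (intro has_derivative_add has_derivative_scaleR_right has_frechet_derivative
        tameD(2) [OF X_tame c p] tameD(2) [OF \<Xi>_tame c p])
  then have "(in_chart c (parallel t) has_derivative (\<lambda>u. dX c p u + t *\<^sub>R d\<Xi> c p u)) (at (snd c p))"
    by (simp add: in_chart_eq [abs_def] parallel_def)
  from partial_eq [OF this] show ?thesis by (simp add: normal_frame_eq axis_images_def)
qed

definition minkowski_coeff :: "nat \<Rightarrow> 'a \<Rightarrow> real" where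
  "minkowski_coeff k p = (- 1) ^ k * (real (CARD('n) - k) * \<sigma>_X k p * (\<Xi> p \<bullet> n_X p) + real (Suc k) * \<sigma>_X (Suc k) p * (X p \<bullet> n_X p))"

text \<open>
  With \<open>q(t) = det (1 - t S)\<close>, the first term of the Stokes density, relative to the volume density, is
  \<open>n q(t) (\<Xi> \<bullet> \<nu>)\<close>. In the
  second one a single row is differentiated with respect to \<open>t\<close> at a time, which gives
  \<open>q'(t) ((X + t \<Xi>) \<bullet> \<nu>)\<close>.
\<close>

lemma stokes_density_parallel:
  assumes c: "c \<in> \<A>" and p: "p \<in> fst c" "p \<notin> B"
  shows "stokes_density c (parallel t) \<Xi> p / vol c p = (\<Sum>k\<le>CARD('n). t ^ k * minkowski_coeff k p)"
proof -
  let ?n = "CARD('n)"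
  let ?R = "\<lambda>v t. frame v (\<lambda>i. axis_images (dX c p) i + t *\<^sub>R axis_images (d\<Xi> c p) i)"
  let ?E = "frame 0 (axis_images (d\<Xi> c p))"
  define q where "q t = (\<Sum>k\<le>?n. (- t) ^ k * \<sigma>_X k p)" for t
  define q' where "q' t = (\<Sum>k\<le>?n. (- 1) ^ k * real k * t ^ (k - 1) * \<sigma>_X k p)" for t
  have Dq: "(q has_real_derivative q' t) (at t)"
  proof -
    have "((\<lambda>t. \<Sum>k\<le>?n. (- 1) ^ k * \<sigma>_X k p * t ^ k) has_real_derivative (\<Sum>k\<le>?n. (- 1) ^ k * \<sigma>_X k p * (real k * t ^ (k - 1)))) (at t)"
      by (auto intro!: derivative_eq_intros sum.cong simp: mult_ac)
    moreover have "(\<lambda>t. \<Sum>k\<le>?n. (- 1) ^ k * \<sigma>_X k p * t ^ k) = q"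
    proof
      fix t
      show "(\<Sum>k\<le>?n. (- 1) ^ k * \<sigma>_X k p * t ^ k) = q t"
        unfolding q_def by (intro sum.cong refl) (simp only: power_minus [of t] mult_ac)
    qed
    moreover have "(\<Sum>k\<le>?n. (- 1) ^ k * \<sigma>_X k p * (real k * t ^ (k - 1))) = q' t"
      by (simp add: q'_def mult_ac)
    ultimately show ?thesis by simp
  qed
  let ?w = "(parallel t p \<bullet> n_X p) * vol c p"
  have "det_coeff 1 (?R (parallel t p) t) ?E = q' t * ?w"
  proof (rule DERIV_unique)
    show "((\<lambda>s. det (?R (parallel t p) t + s *\<^sub>R ?E)) has_real_derivative det_coeff 1 (?R (parallel t p) t) ?E) (at 0)"
      by (rule det_pencil_deriv)
    have "?R (parallel t p) t + s *\<^sub>R ?E = ?R (parallel t p) (t + s)" for s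
      by (rule frame_eqI) (auto simp: algebra_simps)
    then have "det (?R (parallel t p) t + s *\<^sub>R ?E) = q (s + t) * ?w" for s
      using det_frame_parallel_immersion [OF c p, of "parallel t p" "t + s"] by (simp add: q_def add.commute)
    moreover have "((\<lambda>s. q (s + t) * ?w) has_real_derivative q' t * ?w) (at 0)"
      using Dq DERIV_shift [of q "q' t" 0 t] by (intro DERIV_cmult_right) simp
    ultimately show "((\<lambda>s. det (?R (parallel t p) t + s *\<^sub>R ?E)) has_real_derivative q' t * ?w) (at 0)" by simp
  qed
  moreover have "normal_frame 0 (in_chart c \<Xi>) (snd c p) = ?E"
    by (simp add: normal_frame_eq axis_images_def [abs_def] partial_def)
  ultimately have "stokes_density c (parallel t) \<Xi> p = (real ?n * q t * (\<Xi> p \<bullet> n_X p) - q' t * (parallel t p \<bullet> n_X p)) * vol c p"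
    unfolding stokes_density_def normal_frame_parallel [OF c p] det_frame_parallel_immersion [OF c p] q_def [symmetric]
    by (simp add: algebra_simps)
  then have "stokes_density c (parallel t) \<Xi> p / vol c p = real ?n * q t * (\<Xi> p \<bullet> n_X p) - q' t * (parallel t p \<bullet> n_X p)"
    using vol_pos [OF c p] by simp
  also have "\<dots> = (real ?n * q t - t * q' t) * (\<Xi> p \<bullet> n_X p) - q' t * (X p \<bullet> n_X p)"
    by (simp add: parallel_def inner_add_left algebra_simps)
  also have "real ?n * q t - t * q' t = (\<Sum>k\<le>?n. (- 1) ^ k * t ^ k * (real (?n - k) * \<sigma>_X k p))"
  proof -
    have "t * (real k * t ^ (k - 1)) = real k * t ^ k" for k by (cases k) auto
    then have "(- 1) ^ k * t ^ k * (real (?n - k) * \<sigma>_X k p)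
      = real ?n * ((- t) ^ k * \<sigma>_X k p) - t * ((- 1) ^ k * real k * t ^ (k - 1) * \<sigma>_X k p)" if "k \<le> ?n" for k
    proof -
      assume *: "\<And>k. t * (real k * t ^ (k - 1)) = real k * t ^ k"
      have "t * ((- 1) ^ k * real k * t ^ (k - 1) * \<sigma>_X k p) = (- 1) ^ k * \<sigma>_X k p * (t * (real k * t ^ (k - 1)))"
        by (simp add: mult_ac)
      also have "\<dots> = (- 1) ^ k * \<sigma>_X k p * (real k * t ^ k)" by (simp only: *)
      finally show ?thesis using that by (simp add: power_minus [of t] of_nat_diff algebra_simps)
    qed
    then show ?thesis
      unfolding q_def q'_def sum_distrib_left sum_subtractf [symmetric] by (intro sum.cong) auto
  qed
  also have "q' t = (\<Sum>k\<le>?n. (- 1) ^ Suc k * t ^ k * (real (Suc k) * \<sigma>_X (Suc k) p))"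
  proof -
    have "q' t = (\<Sum>k\<le>Suc ?n. (- 1) ^ k * real k * t ^ (k - 1) * \<sigma>_X k p)"
      by (simp add: q'_def \<sigma>_X_beyond)
    also have "\<dots> = (\<Sum>k\<le>?n. (- 1) ^ Suc k * real (Suc k) * t ^ (Suc k - 1) * \<sigma>_X (Suc k) p)"
      by (subst sum.atMost_Suc_shift) simp
    finally show ?thesis by (simp add: mult_ac)
  qed
  also have "(\<Sum>k\<le>?n. (- 1) ^ k * t ^ k * (real (?n - k) * \<sigma>_X k p)) * (\<Xi> p \<bullet> n_X p)
     - (\<Sum>k\<le>?n. (- 1) ^ Suc k * t ^ k * (real (Suc k) * \<sigma>_X (Suc k) p)) * (X p \<bullet> n_X p)
     = (\<Sum>k\<le>?n. t ^ k * minkowski_coeff k p)"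
    unfolding sum_distrib_right sum_subtractf [symmetric] minkowski_coeff_def
    by (intro sum.cong refl) (simp add: algebra_simps)
  finally show ?thesis .
qed

text \<open>
  The coefficient of \<open>t^r\<close> in the Stokes identity for \<open>X + t \<Xi>\<close> and \<open>\<Xi>\<close> contains
  \<open>(n - r) (n choose r) H_r\<close> and \<open>(r + 1) (n choose (r + 1)) H_{r+1}\<close>. The two numerical factors are
  equal.
\<close>

theorem minkowski_formula:
  assumes r: "r < CARD('n)"
  shows "has_bochner_integral vm (\<lambda>p. \<gamma> (n_X p) * aniso_mean_curvature \<gamma> \<A> X r p
     + (X p \<bullet> n_X p) * aniso_mean_curvature \<gamma> \<A> X (r + 1) p) 0"
proof -
  let ?n = "CARD('n)" and ?H = "aniso_mean_curvature \<gamma> \<A> X"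
  \<comment> \<open>Stokes' theorem is stated for integrands that are zero on \<open>B\<close>,
    where the curvatures are meaningless.\<close>
  define a where "a k p = indicator (- B) p * minkowski_coeff k p" for k p
  have "has_bochner_integral vm (a r) 0"
  proof (rule has_bochner_integral_coeff_0 [where \<delta> = 1 and d = ?n])
    fix t :: real
    show "has_bochner_integral vm (\<lambda>p. \<Sum>k\<le>?n. t ^ k * a k p) 0"
    proof (rule has_bochner_integral_stokes [OF parallel_tame \<Xi>_tame])
      show "(\<Sum>k\<le>?n. t ^ k * a k p) = stokes_density c (parallel t) \<Xi> p / vol c p"
        if "c \<in> \<A>" "p \<in> fst c" "p \<notin> B" for c p
        using stokes_density_parallel [OF that] that(3) by (simp add: a_def)
    qed (simp add: a_def)
  qed (use r in auto)
  then have "has_bochner_integral vm (\<lambda>p. (- 1) ^ r / real ((?n - r) * (?n choose r)) * a r p) ((- 1) ^ r / real ((?n - r) * (?n choose r)) * 0)"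
    by (rule has_bochner_integral_mult_right)
  then have int: "has_bochner_integral vm (\<lambda>p. (- 1) ^ r / real ((?n - r) * (?n choose r)) * a r p) 0" by simp
  show ?thesis
  proof (rule has_bochner_integral_null_modification [OF int])
    fix p assume p: "p \<in> M - B"
    let ?b = "real ((?n - r) * (?n choose r))"
    have b: "?b \<noteq> 0" using r by simp
    have "Suc r * (?n choose Suc r) = (?n - r) * (?n choose r)"
      by (simp only: binomial_absorb_comp binomial_absorption)
    then have choose: "real (Suc r) * real (?n choose Suc r) = ?b" by (metis of_nat_mult)
    have "a r p = (- 1) ^ r * (real (?n - r) * (real (?n choose r) * ?H r p) * \<gamma> (n_X p)
       + real (Suc r) * (real (?n choose Suc r) * ?H (Suc r) p) * (X p \<bullet> n_X p))"
      using p r by (simp add: a_def minkowski_coeff_def \<sigma>_X_eq_mean_curvature \<Xi>_normal del: of_nat_Suc)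
    also have "\<dots> = (- 1) ^ r * (?b * (?H r p * \<gamma> (n_X p))
       + (real (Suc r) * real (?n choose Suc r)) * (?H (Suc r) p * (X p \<bullet> n_X p)))"
      by (simp only: of_nat_mult mult_ac)
    also have "\<dots> = (- 1) ^ r * ?b * (\<gamma> (n_X p) * ?H r p + (X p \<bullet> n_X p) * ?H (r + 1) p)"
      unfolding choose by (simp add: algebra_simps)
    finally have "(- 1) ^ r / ?b * a r p = ((- 1) ^ r * (- 1) ^ r) * (?b / ?b) * (\<gamma> (n_X p) * ?H r p + (X p \<bullet> n_X p) * ?H (r + 1) p)"
      by simp
    moreover have "(- 1) ^ r * (- 1) ^ r = (1::real)" by (simp add: power_add [symmetric])
    ultimately show "\<gamma> (n_X p) * ?H r p + (X p \<bullet> n_X p) * ?H (r + 1) p = (- 1) ^ r / ?b * a r p"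
      using b by simp
  qed
qed

end

section \<open>Piecewise immersions\<close>

lemma Ck_on_interior_differentiable:
  assumes f: "Ck_on (Suc m) f S" and V: "open V" "V \<subseteq> S" "y \<in> V"
  shows "f differentiable (at y)"
proof -
  obtain U g where U: "y \<in> U" "Ck_open (Suc m) g U" "\<forall>x\<in>S \<inter> U. g x = f x"
    using f V unfolding Ck_on_def by blast
  have "(g has_derivative frechet_derivative g (at y)) (at y)"
    by (rule has_frechet_derivative [OF Ck_open_SucD(2) [OF U(2,1)]])
  then have "(f has_derivative frechet_derivative g (at y)) (at y)"
  proof (rule has_derivative_transform_within_open)
    show "open (U \<inter> V)" using Ck_open_SucD(1) [OF U(2)] V(1) by blast
  qed (use U V in auto)
  then show ?thesis by (auto simp: differentiable_def)
qed

text \<open>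
  In suitable coordinates the cell lies in a hyperplane, and coordinate changes preserve null sets.
\<close>

lemma negligible_smooth_cell:
  fixes \<A> :: "('a::t2_space, 'n::finite) chart set"
  assumes cell: "smooth_cell M \<A> \<Gamma>" and c: "c \<in> \<A>" "is_chart M c"
  shows "negligible (snd c ` (fst c \<inter> \<Gamma>))"
proof -
  obtain d a where d: "is_chart M d" "smoothly_compatible d c" "\<Gamma> \<subseteq> fst d"
    and face: "snd d ` \<Gamma> = {y \<in> cbox 0 1. y $ a = 0}"
    using cell c unfolding smooth_cell_def by blast
  have "{y. y $ a = 0} = {y :: real^'n. axis a 1 \<bullet> y = 0}"
    by (simp add: inner_axis' )
  then have "negligible {y :: real^'n. y $ a = 0}"
    using negligible_hyperplane [of "axis a 1 :: real^'n" 0] by (simp add: axis_eq_0_iff)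
  then have neg: "negligible (snd d ` (fst c \<inter> \<Gamma>))"
    by (rule negligible_subset) (use face in blast)
  have sub: "snd d ` (fst c \<inter> \<Gamma>) \<subseteq> transition_domain d c"
    using d(3) by (auto simp: transition_domain_def)
  have "negligible (transition d c ` snd d ` (fst c \<inter> \<Gamma>))"
  proof (rule negligible_differentiable_image_negligible [OF order_refl neg])
    show "transition d c differentiable_on snd d ` (fst c \<inter> \<Gamma>)"
      unfolding differentiable_on_def
      using sub transition_differentiable [OF d(1) c(2) d(2)] by (blast intro: differentiable_at_withinI)
  qed
  moreover have "transition d c ` snd d ` (fst c \<inter> \<Gamma>) = snd c ` (fst c \<inter> \<Gamma>)"
    unfolding image_image using d(3) in_chart_chart [OF d(1)] by (intro image_cong) auto
  ultimately show ?thesis by simp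
qed

locale piecewise_immersion =
  fixes \<gamma> :: "real^('n::finite option) \<Rightarrow> real"
    and M :: "'a::t2_space set"
    and \<A> :: "('a, 'n) chart set"
    and k :: nat
    and Mi :: "nat \<Rightarrow> 'a set"
    and X :: "'a \<Rightarrow> real^('n option)"
    and \<nu> :: "nat \<Rightarrow> 'a \<Rightarrow> real^('n option)"
  assumes \<gamma>_C2: "Ck_on 2 \<gamma> (sphere 0 1)"
    and manifold: "piecewise_manifold M \<A> k Mi"
    and immersion: "piecewise_weak_immersion 2 M \<A> k Mi X \<nu>"
    and matching: "\<And>i j \<zeta>. i \<in> {1..k} \<Longrightarrow> j \<in> {1..k} \<Longrightarrow>
      \<zeta> \<in> mfd_boundary M (Mi i) \<inter> mfd_boundary M (Mi j) \<Longrightarrow> cahn_hoffman \<gamma> (\<nu> i \<zeta>) = cahn_hoffman \<gamma> (\<nu> j \<zeta>)"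
begin

definition seams :: "'a set" where
  "seams = (\<Union>i\<in>{1..k}. mfd_boundary M (Mi i))"

lemma oriented: "oriented_atlas M \<A>" and compact_space: "compact M" and nonempty_space: "M \<noteq> {}"
  and pieces_cover: "M = (\<Union>i\<in>{1..k}. Mi i)"
  and piece_domain: "\<And>i. i \<in> {1..k} \<Longrightarrow> piecewise_smooth_domain M \<A> (Mi i)"
  and pieces_meet: "\<And>i j. i \<in> {1..k} \<Longrightarrow> j \<in> {1..k} \<Longrightarrow> i \<noteq> j \<Longrightarrow>
        Mi i \<inter> Mi j = mfd_boundary M (Mi i) \<inter> mfd_boundary M (Mi j)"
  using manifold unfolding piecewise_manifold_def by blast+

lemma piece_closed: "i \<in> {1..k} \<Longrightarrow> closedin (top_of_set M) (Mi i)"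
proof -
  assume "i \<in> {1..k}"
  then have "compact (Mi i)" "Mi i \<subseteq> M"
    using piece_domain unfolding piecewise_smooth_domain_def by blast+
  then show ?thesis by (simp add: closed_subset compact_imp_closed)
qed

lemma piece_interior: "mfd_interior M (Mi i) \<subseteq> Mi i" "openin (top_of_set M) (mfd_interior M (Mi i))"
  unfolding mfd_interior_def by (rule interior_of_subset, rule openin_interior_of)

lemma regular_in_interior:
  assumes "p \<in> M" "p \<notin> seams"
  obtains i where "i \<in> {1..k}" "p \<in> mfd_interior M (Mi i)"
proof -
  obtain i where i: "i \<in> {1..k}" "p \<in> Mi i" using assms(1) pieces_cover by blast
  then have "p \<notin> mfd_boundary M (Mi i)" using assms(2) by (auto simp: seams_def)
  then have "p \<in> mfd_interior M (Mi i)"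
    using i(2) closure_of_closedin [OF piece_closed [OF i(1)]]
    by (simp add: mfd_boundary_def mfd_interior_def frontier_of_def)
  then show thesis using that i(1) by blast
qed

lemma seams_null:
  assumes c: "c \<in> \<A>"
  shows "negligible (snd c ` (fst c \<inter> seams))"
proof -
  have c': "is_chart M c" using oriented c by (simp add: oriented_atlas_def)
  have "negligible (snd c ` (fst c \<inter> mfd_boundary M (Mi i)))" if i: "i \<in> {1..k}" for i
  proof -
    obtain \<G> where G: "finite \<G>" "\<forall>\<Gamma>\<in>\<G>. smooth_cell M \<A> \<Gamma>" "mfd_boundary M (Mi i) = \<Union>\<G>"
      using piece_domain [OF i] unfolding piecewise_smooth_domain_def by blast
    have "negligible (\<Union>\<Gamma>\<in>\<G>. snd c ` (fst c \<inter> \<Gamma>))"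
      using G negligible_smooth_cell [OF _ c c'] by (intro negligible_Union) auto
    moreover have "(\<Union>\<Gamma>\<in>\<G>. snd c ` (fst c \<inter> \<Gamma>)) = snd c ` (fst c \<inter> mfd_boundary M (Mi i))"
      unfolding G(3) by blast
    ultimately show ?thesis by simp
  qed
  then have "negligible (\<Union>i\<in>{1..k}. snd c ` (fst c \<inter> mfd_boundary M (Mi i)))"
    by (intro negligible_Union) auto
  moreover have "(\<Union>i\<in>{1..k}. snd c ` (fst c \<inter> mfd_boundary M (Mi i))) = snd c ` (fst c \<inter> seams)"
    unfolding seams_def by blast
  ultimately show ?thesis by simp
qed

lemma seams_closed: "closedin (top_of_set M) seams"
  unfolding seams_def mfd_boundary_def by (intro closedin_Union) (auto intro: closedin_frontier_of)

sublocale charted_space M \<A> seams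
  by unfold_locales (fact oriented compact_space seams_closed seams_null)+

text \<open>
  The pieces are closed and finite in number, so Lipschitz conditions on them combine across the seams.
\<close>

lemma tame_piecewise:
  fixes F :: "'a \<Rightarrow> 'b::real_normed_vector"
  assumes lip: "\<And>i c. i \<in> {1..k} \<Longrightarrow> c \<in> \<A> \<Longrightarrow> loc_lip_on (in_chart c F) (snd c ` (fst c \<inter> Mi i))"
    and diff: "\<And>i c p. i \<in> {1..k} \<Longrightarrow> c \<in> \<A> \<Longrightarrow> p \<in> fst c \<Longrightarrow> p \<in> mfd_interior M (Mi i) \<Longrightarrow>
      in_chart c F differentiable (at (snd c p))"
  shows "tame F"
  unfolding tame_def
proof (intro ballI conjI)
  fix c assume c: "c \<in> \<A>"
  show "loc_lip_on (in_chart c F) (chart_range c)"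
  proof (rule loc_lip_on_closed_cover [where I = "{1..k}" and C = "\<lambda>i. snd c ` (fst c \<inter> Mi i)"])
    show "open (chart_range c)" by (rule chart_range_open [OF chartD [OF c]])
    show "chart_range c \<subseteq> (\<Union>i\<in>{1..k}. snd c ` (fst c \<inter> Mi i))"
      using chart_sub [OF c] pieces_cover by blast
    show "closedin (top_of_set (chart_range c)) (snd c ` (fst c \<inter> Mi i))" if "i \<in> {1..k}" for i
      by (rule chart_image_closed [OF chartD [OF c] piece_closed [OF that]])
    show "loc_lip_on (in_chart c F) (snd c ` (fst c \<inter> Mi i))" if "i \<in> {1..k}" for i
      by (rule lip [OF that c])
  qed simp
  fix p assume p: "p \<in> fst c - seams"
  then have "p \<in> M" "p \<notin> seams" using chart_sub [OF c] by blast+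
  then obtain i where "i \<in> {1..k}" "p \<in> mfd_interior M (Mi i)" by (rule regular_in_interior)
  then show "in_chart c F differentiable (at (snd c p))" using diff c p by blast
qed

lemma interior_chart_image:
  assumes "c \<in> \<A>"
  shows "open (snd c ` (fst c \<inter> mfd_interior M (Mi i)))"
    "snd c ` (fst c \<inter> mfd_interior M (Mi i)) \<subseteq> snd c ` (fst c \<inter> Mi i)"
  using chart_image_open [OF chartD [OF assms] piece_interior(2)] piece_interior(1) by blast+

lemma X_piece: "i \<in> {1..k} \<Longrightarrow> c \<in> \<A> \<Longrightarrow> Ck_on (Suc (Suc 0)) (in_chart c X) (snd c ` (fst c \<inter> Mi i))"
  and \<nu>_piece: "i \<in> {1..k} \<Longrightarrow> c \<in> \<A> \<Longrightarrow> Ck_on (Suc 0) (in_chart c (\<nu> i)) (snd c ` (fst c \<inter> Mi i))"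
  using immersion by (simp_all add: piecewise_weak_immersion_def Ck_on_mfd_def numeral_2_eq_2)

lemma \<nu>_unit: "i \<in> {1..k} \<Longrightarrow> p \<in> Mi i \<Longrightarrow> \<nu> i p \<in> sphere 0 1"
  and \<nu>_eq_unit_normal: "i \<in> {1..k} \<Longrightarrow> p \<in> mfd_interior M (Mi i) \<Longrightarrow> \<nu> i p = unit_normal \<A> X p"
  and X_inj_interior: "i \<in> {1..k} \<Longrightarrow> c \<in> \<A> \<Longrightarrow> p \<in> fst c \<Longrightarrow> p \<in> mfd_interior M (Mi i) \<Longrightarrow>
      inj (frechet_derivative (in_chart c X) (at (snd c p)))"
  using immersion unfolding piecewise_weak_immersion_def by blast+

lemma immersion_tame: "tame X"
proof (rule tame_piecewise)
  fix i c assume i: "i \<in> {1..k}" and c: "c \<in> \<A>"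
  show "loc_lip_on (in_chart c X) (snd c ` (fst c \<inter> Mi i))" by (rule Ck_on_loc_lip [OF X_piece [OF i c]])
  show "in_chart c X differentiable (at (snd c p))" if "p \<in> fst c" "p \<in> mfd_interior M (Mi i)" for p
    by (rule Ck_on_interior_differentiable [OF X_piece [OF i c] interior_chart_image [OF c]]) (use that in blast)
qed

text \<open>
  On a seam the choice of the piece is immaterial by the matching condition. This is where the
  condition enters: the normals \<open>\<nu> i\<close> themselves may jump.
\<close>

definition ch_field :: "'a \<Rightarrow> real^('n option)" where
  "ch_field p = cahn_hoffman \<gamma> (\<nu> (SOME i. i \<in> {1..k} \<and> p \<in> Mi i) p)"

lemma ch_field_piece:
  assumes i: "i \<in> {1..k}" "p \<in> Mi i"
  shows "ch_field p = cahn_hoffman \<gamma> (\<nu> i p)"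
proof -
  define j where "j = (SOME i. i \<in> {1..k} \<and> p \<in> Mi i)"
  have j: "j \<in> {1..k}" "p \<in> Mi j"
    using someI [of "\<lambda>i. i \<in> {1..k} \<and> p \<in> Mi i" i] i unfolding j_def by blast+
  have "cahn_hoffman \<gamma> (\<nu> j p) = cahn_hoffman \<gamma> (\<nu> i p)"
  proof (cases "j = i")
    case False
    then show ?thesis using pieces_meet [OF j(1) i(1)] i(2) j(2) by (intro matching [OF j(1) i(1)]) blast
  qed simp
  then show ?thesis by (simp add: ch_field_def j_def)
qed

lemma ch_field_derivative:
  assumes i: "i \<in> {1..k}" and c: "c \<in> \<A>" and p: "p \<in> fst c" "p \<in> mfd_interior M (Mi i)"
  obtains D where "(in_chart c ch_field has_derivative D) (at (snd c p))" "\<And>u. D u \<bullet> \<nu> i p = 0"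
proof -
  let ?V = "snd c ` (fst c \<inter> mfd_interior M (Mi i))"
  have y: "snd c p \<in> ?V" using p by blast
  have diff: "in_chart c (\<nu> i) differentiable (at (snd c p))"
    by (rule Ck_on_interior_differentiable [OF \<nu>_piece [OF i c] interior_chart_image [OF c] y])
  have unit: "in_chart c (\<nu> i) ` ?V \<subseteq> sphere 0 1"
  proof
    fix v assume "v \<in> in_chart c (\<nu> i) ` ?V"
    then obtain q where q: "q \<in> fst c" "q \<in> mfd_interior M (Mi i)" "v = in_chart c (\<nu> i) (snd c q)" by blast
    then show "v \<in> sphere 0 1"
      using \<nu>_unit [OF i, of q] piece_interior(1) [of i] by (auto simp: in_chart_chart [OF chartD [OF c]])
  qed
  obtain D where D: "((\<lambda>z. cahn_hoffman \<gamma> (in_chart c (\<nu> i) z)) has_derivative D) (at (snd c p))"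
    "\<And>u. D u \<bullet> in_chart c (\<nu> i) (snd c p) = 0"
    using cahn_hoffman_field_derivative [OF \<gamma>_C2 interior_chart_image(1) [OF c] y diff unit] by blast
  show thesis
  proof (rule that)
    have "(in_chart c (\<lambda>q. cahn_hoffman \<gamma> (\<nu> i q)) has_derivative D) (at (snd c p))"
      using D(1) by (simp add: in_chart_eq [abs_def])
    then show "(in_chart c ch_field has_derivative D) (at (snd c p))"
    proof (rule in_chart_has_derivative_cong [OF c p(1) piece_interior(2) p(2), rotated])
      show "cahn_hoffman \<gamma> (\<nu> i q) = ch_field q" if "q \<in> mfd_interior M (Mi i)" for q
        using ch_field_piece [OF i] piece_interior(1) that by fastforce
    qed
    show "D u \<bullet> \<nu> i p = 0" for u using D(2) by (simp add: in_chart_chart [OF chartD [OF c] p(1)])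
  qed
qed

lemma ch_field_tame: "tame ch_field"
proof (rule tame_piecewise)
  fix i c assume i: "i \<in> {1..k}" and c: "c \<in> \<A>"
  let ?S = "snd c ` (fst c \<inter> Mi i)"
  have unit: "in_chart c (\<nu> i) ` ?S \<subseteq> sphere 0 1"
    using \<nu>_unit [OF i] by (auto simp: in_chart_chart [OF chartD [OF c]])
  have "loc_lip_on (\<lambda>y. cahn_hoffman \<gamma> (in_chart c (\<nu> i) y)) ?S"
    by (rule loc_lip_on_compose [OF Ck_on_loc_lip [OF \<nu>_piece [OF i c]] cahn_hoffman_loc_lip [OF \<gamma>_C2] unit])
  moreover have "in_chart c ch_field y = cahn_hoffman \<gamma> (in_chart c (\<nu> i) y)" if "y \<in> ?S" for y
    using that ch_field_piece [OF i] by (auto simp: in_chart_chart [OF chartD [OF c]])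
  ultimately show "loc_lip_on (in_chart c ch_field) ?S"
    by (subst loc_lip_on_cong) auto
  show "in_chart c ch_field differentiable (at (snd c p))" if "p \<in> fst c" "p \<in> mfd_interior M (Mi i)" for p
    using ch_field_derivative [OF i c that] by (metis differentiable_def)
qed

sublocale cahn_hoffman_immersion M \<A> seams X \<gamma> ch_field
proof unfold_locales
  show "tame X" by (rule immersion_tame)
  show "M \<noteq> {}" by (rule nonempty_space)
  show "tame ch_field" by (rule ch_field_tame)
  show "inj (frechet_derivative (in_chart c X) (at (snd c p)))"
    if c: "c \<in> \<A>" and p: "p \<in> fst c" "p \<notin> seams" for c p
  proof -
    have "p \<in> M" using chart_sub [OF c] p by blast
    then obtain i where i: "i \<in> {1..k}" "p \<in> mfd_interior M (Mi i)" using p(2) by (rule regular_in_interior)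
    show ?thesis by (rule X_inj_interior [OF i(1) c p(1) i(2)])
  qed
  show "frechet_derivative (in_chart c ch_field) (at (snd c p)) u \<bullet> unit_normal \<A> X p = 0"
    if c: "c \<in> \<A>" and p: "p \<in> fst c" "p \<notin> seams" for c p u
  proof -
    have "p \<in> M" using chart_sub [OF c] p by blast
    then obtain i where i: "i \<in> {1..k}" "p \<in> mfd_interior M (Mi i)" using p(2) by (rule regular_in_interior)
    obtain D where D: "(in_chart c ch_field has_derivative D) (at (snd c p))" "\<And>u. D u \<bullet> \<nu> i p = 0"
      using ch_field_derivative [OF i(1) c p(1) i(2)] by blast
    show ?thesis using D(2) frechet_derivative_at [OF D(1)] \<nu>_eq_unit_normal [OF i] by metis
  qed
  fix p assume p: "p \<in> M - seams"
  then obtain i where i: "i \<in> {1..k}" "p \<in> mfd_interior M (Mi i)" using regular_in_interior by blast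
  then have pi: "p \<in> Mi i" using piece_interior(1) by blast
  show eq: "ch_field p = cahn_hoffman \<gamma> (unit_normal \<A> X p)"
    using ch_field_piece [OF i(1) pi] \<nu>_eq_unit_normal [OF i] by simp
  show "ch_field p \<bullet> unit_normal \<A> X p = \<gamma> (unit_normal \<A> X p)"
    unfolding eq using cahn_hoffman_inner [OF \<gamma>_C2 \<nu>_unit [OF i(1) pi]] \<nu>_eq_unit_normal [OF i] by simp
qed

end

theorem theorem11p1:
  fixes \<gamma> :: "real^('n::finite option) \<Rightarrow> real"
    and M :: "'a::t2_space set"
    and \<A> :: "('a, 'n) chart set"
    and k :: nat
    and Mi :: "nat \<Rightarrow> 'a set"
    and X :: "'a \<Rightarrow> real^('n option)"
    and \<nu> :: "nat \<Rightarrow> 'a \<Rightarrow> real^('n option)"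
  assumes "Ck_on 2 \<gamma> (sphere 0 1)"
    and "\<forall>x\<in>sphere 0 1. \<gamma> x > 0"
    and "piecewise_manifold M \<A> k Mi"
    and "piecewise_weak_immersion 2 M \<A> k Mi X \<nu>"
    and "\<forall>r\<in>{1..CARD('n)}.
           integrable (volume_measure M \<A> X) (aniso_mean_curvature \<gamma> \<A> X r)"
    and "\<forall>i\<in>{1..k}. \<forall>j\<in>{1..k}. \<forall>\<zeta>\<in>mfd_boundary M (Mi i) \<inter> mfd_boundary M (Mi j).
           cahn_hoffman \<gamma> (\<nu> i \<zeta>) = cahn_hoffman \<gamma> (\<nu> j \<zeta>)"
  shows "(\<forall>r\<in>{0..CARD('n) - 1}.
            has_bochner_integral (volume_measure M \<A> X)
              (\<lambda>p. \<gamma> (unit_normal \<A> X p) * aniso_mean_curvature \<gamma> \<A> X r p +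
                   (X p \<bullet> unit_normal \<A> X p) * aniso_mean_curvature \<gamma> \<A> X (r + 1) p) 0)
       \<and> has_bochner_integral (volume_measure M \<A> X)
              (\<lambda>p. \<gamma> (unit_normal \<A> X p) + aniso_Lambda \<gamma> \<A> X p * (X p \<bullet> unit_normal \<A> X p)) 0"
proof -
  interpret piecewise_immersion \<gamma> M \<A> k Mi X \<nu>
    using assms by unfold_locales blast+
  have n: "0 < CARD('n)" by simp
  have "aniso_mean_curvature \<gamma> \<A> X 0 p = 1" for p
  proof -
    have "{L :: 'n set. card L = 0} = {{}}" by auto
    then show ?thesis by (simp add: aniso_mean_curvature_def)
  qed
  then have "has_bochner_integral vm (\<lambda>p. \<gamma> (n_X p) + aniso_Lambda \<gamma> \<A> X p * (X p \<bullet> n_X p)) 0"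
    using minkowski_formula [OF n] by (simp add: mult.commute)
  moreover have "r < CARD('n)" if "r \<in> {0..CARD('n) - 1}" for r
    using that n unfolding atLeastAtMost_iff by linarith
  ultimately show ?thesis using minkowski_formula by blast
qed

end
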